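(* Let $\underline\omega_0$ be a limit state on the scaling algebra $\underline{\mathfrak A}$, with GNS objects $(\mathcal H_0,\pi_0,\Omega_0)$. Let $\mathcal Z$ be a compact Hausdorff space, $\nu$ a regular Borel probability measure on $\mathcal Z$, and $\underline\omega_z$ ($z\in\mathcal Z$) multiplicative limit states such that $\underline\omega_0(\underline A)=\int_{\mathcal Z}d\nu(z)\,\underline\omega_z(\underline A)$ for all $\underline A\in\underline{\mathfrak A}$ and such that $\underline C\mapsto(z\mapsto\underline\omega_z(\underline C))$ is a (well-defined) surjective map $\mathfrak Z(\underline{\mathfrak A})\to\mathcal C(\mathcal Z)$. Let $(\mathcal H_z,\pi_z,\Omega_z)$ be the GNS objects of $\underline\omega_z$. Then $$\Gamma:=\{z\mapsto\pi_z(\underline A)\Omega_z\,|\,\underline A\in\underline{\mathfrak A}\}\subset\prod_{z\in\mathcal Z}\mathcal H_z$$ is a fundamental family. With respect to this family, $$\mathcal H_0\cong\int_{\mathcal Z}^{\Gamma}d\nu(z)\,\mathcal H_z,$$ where the isomorphism (of Hilbert spaces) is given by $\pi_0(\underline A)\Omega_0\mapsto\int_{\mathcal Z}^\Gamma d\nu(z)\,\pi_z(\underline A)\Omega_z$, $\underline A\in\underline{\mathfrak A}$.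
   Context: Nets. Minkowski space is $\mathbb R^{s+1}$. A net of algebras assigns to each open bounded region $\mathcal O\subset\mathbb R^{s+1}$ a C*-algebra $\mathfrak A(\mathcal O)$ with $\mathfrak A(\mathcal O_1)\subset\mathfrak A(\mathcal O_2)$ if $\mathcal O_1\subset\mathcal O_2$; $\mathfrak A$ also denotes the quasilocal algebra (C*-inductive limit). A local net with symmetry group $\mathcal G$ (a Lie group of point transformations of Minkowski space containing the translations) is a net with a representation $g\mapsto\alpha_g$ of $\mathcal G$ by automorphisms such that (i) $[A_1,A_2]=0$ if $A_i\in\mathfrak A(\mathcal O_i)$ with $\mathcal O_1,\mathcal O_2$ spacelike separated, (ii) $\alpha_g\mathfrak A(\mathcal O)=\mathfrak A(g.\mathcal O)$. It is in a positive energy representation if moreover the $\mathfrak A(\mathcal O)$ are W*-algebras on a common Hilbert space $\mathcal H$, $\alpha_g=\mathrm{ad}\,U(g)$ for a strongly continuous unitary representation $U$ of $\mathcal G$, the joint spectrum of the generators of the translations lies in the closed forward light cone, and there is a vector $\Omega\in\mathcal H$ invariant under all $U(g)$ and cyclic for $\mathfrak A$. It is in the vacuum sector if moreover $\Omega$ is unique up to scalars as a translation-invariant vector. Standing assumption: $\mathfrak A$ is a fixed local net in the vacuum sector with symmetry group the Poincaré group $\mathcal P_+^\uparrow$; $\omega=(\Omega|\,\cdot\,\Omega)$. Scaling algebra. $\underline{\mathfrak B}$ is the C*-algebra of bounded functions $\underline B:\mathbb R_+\to\mathcal B(\mathcal H)$, $\lambda\mapsto\underline B_\lambda$, with pointwise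 operations and norm $\sup_\lambda\|\underline B_\lambda\|$. $\underline{\mathcal G}$ is the group generated by Poincaré transformations and dilations, with elements $g=(\mu,x,\Lambda)$, $\mu\in\mathbb R_+$; it acts by $(\underline\alpha_g\underline B)_\lambda=\alpha_{\lambda\mu x,\Lambda}(\underline B_{\lambda\mu})$. Put $\underline{\mathfrak A}(\mathcal O)=\{\underline A\in\underline{\mathfrak B}\,|\,\underline A_\lambda\in\mathfrak A(\lambda\mathcal O)\ \forall\lambda>0,\ g\mapsto\underline\alpha_g(\underline A)\text{ norm continuous}\}$; $\underline{\mathfrak A}$ is the associated quasilocal C*-algebra. Its center $\mathfrak Z(\underline{\mathfrak A})$ consists of the functions $\lambda\mapsto f(\lambda)\mathbf 1$ with $f:\mathbb R_+\to\mathbb C$ bounded and uniformly continuous with respect to the multiplicative group structure. Limit states. A mean $\mathsf m$ is a state on $\mathfrak Z(\underline{\mathfrak A})$; it is asymptotic if $\mathsf m(f)=0$ whenever $f(\lambda)=0$ for small $\lambda$, and multiplicative if $\mathsf m(fg)=\mathsf m(f)\mathsf m(g)$. Let $\omega:\underline{\mathfrak A}\to\mathfrak Z(\underline{\mathfrak A})$, $(\omega(\underline A))_\lambda=\omega(\underline A_\lambda)\mathbf 1$. A limit state is a state $\underline\omega_0=\mathsf m\circ\omega$ on $\underline{\mathfrak A}$ with $\mathsf m$ an asymptotic mean; it is called multiplicative if $\mathsf m$ is. Direct integrals. Let $\mathcal Z$ be compact Hausdorff with finite regular Borel measure $\nu$ and $\mathcal H_z$, $z\in\mathcal Z$, Hilbert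 spaces (no separability assumed). A fundamental family is a linear subspace $\Gamma\subset\prod_z\mathcal H_z$ such that $z\mapsto\|\chi(z)\|^2$ is $\nu$-integrable for each $\chi\in\Gamma$. It extends to a unique minimal vector space $\bar\Gamma\supset\Gamma$ in $\prod_z\mathcal H_z$ such that: $z\mapsto\|\chi(z)\|^2$ is integrable for $\chi\in\bar\Gamma$; $\bar\Gamma$ is closed under a.e. modification and under multiplication by $L^\infty(\mathcal Z,\nu)$ functions; $\bar\Gamma$ is complete in the seminorm $(\int d\nu(z)\|\chi(z)\|^2)^{1/2}$. The direct integral $\int_{\mathcal Z}^\Gamma d\nu(z)\mathcal H_z$ is $\bar\Gamma$ modulo vectors of zero seminorm; its elements are written $\int_{\mathcal Z}^\Gamma d\nu(z)\chi(z)$. *)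

theory Defs
  imports "HOL-Probability.Probability_Measure" "HOL-Algebra.Module"
begin

section \<open>Operators on a complex Hilbert space\<close>

text \<open>
  The vacuum Hilbert space is a type of the following class. Inner products are linear in the
  second argument. Positive definiteness and completeness are inherited from the Banach norm.
\<close>

class chilbert_space = banach +
  fixes scaleC :: "complex \<Rightarrow> 'a \<Rightarrow> 'a" (infixr "*\<^sub>C" 75)
    and cinner :: "'a \<Rightarrow> 'a \<Rightarrow> complex"
  assumes scaleR_scaleC: "r *\<^sub>R x = complex_of_real r *\<^sub>C x"
    and scaleC_add_right: "a *\<^sub>C (x + y) = a *\<^sub>C x + a *\<^sub>C y"
    and scaleC_add_left: "(a + b) *\<^sub>C x = a *\<^sub>C x + b *\<^sub>C x"
    and scaleC_scaleC: "a *\<^sub>C b *\<^sub>C x = (a * b) *\<^sub>C x"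
    and cinner_commute: "cinner y x = cnj (cinner x y)"
    and cinner_add_right: "cinner x (y + z) = cinner x y + cinner x z"
    and cinner_scaleC_right: "cinner x (a *\<^sub>C y) = a * cinner x y"
    and cinner_self: "cinner x x = complex_of_real ((norm x)\<^sup>2)"

type_synonym 'h oper = "'h \<Rightarrow>\<^sub>L 'h"

text \<open>
  \<open>\<B>(\<H>)\<close>: type \<open>'h oper\<close> consists of the real-linear bounded maps, so complex linearity
  is imposed separately. The operator norm is that of bounded real-linear maps.
\<close>

definition bounded_ops :: "'h::chilbert_space oper set" where
  "bounded_ops = {T. \<forall>c x. blinfun_apply T (c *\<^sub>C x) = c *\<^sub>C blinfun_apply T x}"

definition hadj :: "'h::chilbert_space oper \<Rightarrow> 'h oper" where
  "hadj T = (THE S. S \<in> bounded_ops \<and>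
     (\<forall>x y. cinner (blinfun_apply S x) y = cinner x (blinfun_apply T y)))"

definition scalar_op :: "complex \<Rightarrow> 'h::chilbert_space oper" where
  "scalar_op c = Blinfun (\<lambda>x. c *\<^sub>C x)"

definition unitary_op :: "'h::chilbert_space oper \<Rightarrow> bool" where
  "unitary_op V \<longleftrightarrow> V \<in> bounded_ops \<and>
     hadj V o\<^sub>L V = id_blinfun \<and> V o\<^sub>L hadj V = id_blinfun"

definition ad_op :: "'h::chilbert_space oper \<Rightarrow> 'h oper \<Rightarrow> 'h oper" where
  "ad_op V T = V o\<^sub>L T o\<^sub>L hadj V"

definition commutant :: "'h::chilbert_space oper set \<Rightarrow> 'h oper set" where
  "commutant M = {T \<in> bounded_ops. \<forall>A\<in>M. T o\<^sub>L A = A o\<^sub>L T}"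

text \<open>W*-algebras on \<open>\<H>\<close> are concrete von Neumann algebras.\<close>

definition von_neumann_algebra :: "'h::chilbert_space oper set \<Rightarrow> bool" where
  "von_neumann_algebra M \<longleftrightarrow>
     M \<subseteq> bounded_ops \<and> (\<forall>A\<in>M. hadj A \<in> M) \<and> commutant (commutant M) = M"

section \<open>Minkowski space and the Poincare group\<close>

text \<open>
  Points of \<open>\<real>\<^sup>s\<^sup>+\<^sup>1\<close> with \<open>s = CARD('s)\<close>; the index \<open>None\<close> is the time direction.
  A Poincare transformation \<open>(x, \<Lambda>)\<close> acts by \<open>y \<mapsto> \<Lambda> y + x\<close>.
\<close>

type_synonym 's mink = "real ^ ('s option)"
type_synonym 's poinc = "'s mink \<times> (real ^ ('s option) ^ ('s option))"

definition mink_form :: "'s::finite mink \<Rightarrow> 's mink \<Rightarrow> real" where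
  "mink_form x y = x $ None * y $ None - (\<Sum>i\<in>UNIV. x $ Some i * y $ Some i)"

definition forward_cone :: "'s::finite mink set" where
  "forward_cone = {p. 0 \<le> p $ None \<and> 0 \<le> mink_form p p}"

definition spacelike_separated :: "'s::finite mink set \<Rightarrow> 's mink set \<Rightarrow> bool" where
  "spacelike_separated O1 O2 \<longleftrightarrow> (\<forall>x\<in>O1. \<forall>y\<in>O2. mink_form (x - y) (x - y) < 0)"

definition region :: "'s::finite mink set \<Rightarrow> bool" where
  "region R \<longleftrightarrow> open R \<and> bounded R \<and> R \<noteq> {}"

definition lorentz :: "(real ^ ('s::finite option) ^ ('s option)) set" where
  "lorentz = {L. (\<forall>x y. mink_form (L *v x) (L *v y) = mink_form x y) \<and>
                 det L = 1 \<and> 0 < L $ None $ None}"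

definition poincare :: "'s::finite poinc set" where
  "poincare = UNIV \<times> lorentz"

definition poinc_mult :: "'s::finite poinc \<Rightarrow> 's poinc \<Rightarrow> 's poinc" where
  "poinc_mult g h = (fst g + snd g *v fst h, snd g ** snd h)"

definition poinc_act :: "'s::finite poinc \<Rightarrow> 's mink \<Rightarrow> 's mink" where
  "poinc_act g y = snd g *v y + fst g"

section \<open>Joint spectrum of the generators of the translations\<close>

text \<open>
  \<open>spectral_resolution E T\<close>: \<open>E\<close> is a projection-valued Borel measure with
  \<open>T x = \<integral> exp (i p\<cdot>x) dE(p)\<close>, the joint spectral measure of the commuting self-adjoint
  generators of the unitary group \<open>T\<close> (it exists and is unique by Stone's theorem in
  several variables). The joint spectrum of the generators is the support of \<open>E\<close>.
\<close>

definition spectral_dist ::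
    "('s::finite mink set \<Rightarrow> 'h::chilbert_space oper) \<Rightarrow> 'h \<Rightarrow> 's mink measure" where
  "spectral_dist E v = measure_of UNIV (sets borel)
     (\<lambda>A. ennreal (Re (cinner v (blinfun_apply (E A) v))))"

definition spectral_resolution ::
    "('s::finite mink set \<Rightarrow> 'h::chilbert_space oper) \<Rightarrow> ('s mink \<Rightarrow> 'h oper) \<Rightarrow> bool" where
  "spectral_resolution E T \<longleftrightarrow>
     (\<forall>A\<in>sets borel. E A \<in> bounded_ops \<and> hadj (E A) = E A) \<and>
     (\<forall>A\<in>sets borel. \<forall>B\<in>sets borel. E (A \<inter> B) = E A o\<^sub>L E B) \<and>
     E {} = 0 \<and> E UNIV = id_blinfun \<and>
     (\<forall>v. countably_additive (sets borel)
            (\<lambda>A. ennreal (Re (cinner v (blinfun_apply (E A) v))))) \<and>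
     (\<forall>x v. has_bochner_integral (spectral_dist E v) (\<lambda>p. cis (mink_form p x))
              (cinner v (blinfun_apply (T x) v)))"

definition joint_spectrum :: "('s::finite mink set \<Rightarrow> 'h::chilbert_space oper) \<Rightarrow> 's mink set" where
  "joint_spectrum E = {p. \<forall>N. open N \<longrightarrow> p \<in> N \<longrightarrow> E N \<noteq> 0}"

section \<open>Local nets in the vacuum sector\<close>

definition quasilocal :: "('s::finite mink set \<Rightarrow> 'h::chilbert_space oper set) \<Rightarrow> 'h oper set" where
  "quasilocal \<AA> = closure (\<Union>R\<in>{R. region R}. \<AA> R)"

text \<open>The automorphism \<open>\<alpha>\<^sub>g\<close> of a net in a positive energy representation is \<open>ad_op (U g)\<close>.\<close>

locale local_net =
  fixes \<AA> :: "'s::finite mink set \<Rightarrow> 'h::chilbert_space oper set"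
    and U :: "'s poinc \<Rightarrow> 'h oper"
  assumes algebra: "region R \<Longrightarrow> von_neumann_algebra (\<AA> R)"
    and isotony: "region R1 \<Longrightarrow> region R2 \<Longrightarrow> R1 \<subseteq> R2 \<Longrightarrow> \<AA> R1 \<subseteq> \<AA> R2"
    and unitary: "g \<in> poincare \<Longrightarrow> unitary_op (U g)"
    and homomorphism: "g \<in> poincare \<Longrightarrow> h \<in> poincare \<Longrightarrow> U (poinc_mult g h) = U g o\<^sub>L U h"
    and strongly_continuous: "continuous_on poincare (\<lambda>g. blinfun_apply (U g) v)"
    and locality: "region R1 \<Longrightarrow> region R2 \<Longrightarrow> spacelike_separated R1 R2 \<Longrightarrow>
          A1 \<in> \<AA> R1 \<Longrightarrow> A2 \<in> \<AA> R2 \<Longrightarrow> A1 o\<^sub>L A2 = A2 o\<^sub>L A1"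
    and covariance: "g \<in> poincare \<Longrightarrow> region R \<Longrightarrow>
          ad_op (U g) ` \<AA> R = \<AA> (poinc_act g ` R)"

locale positive_energy = local_net \<AA> U
  for \<AA> :: "'s::finite mink set \<Rightarrow> 'h::chilbert_space oper set"
    and U :: "'s poinc \<Rightarrow> 'h oper" +
  fixes \<Omega> :: 'h
  assumes spectrum_condition:
      "\<exists>E. spectral_resolution E (\<lambda>x. U (x, mat 1)) \<and> joint_spectrum E \<subseteq> forward_cone"
    and vacuum_normalized: "norm \<Omega> = 1"
    and vacuum_invariant: "g \<in> poincare \<Longrightarrow> blinfun_apply (U g) \<Omega> = \<Omega>"
    and vacuum_cyclic: "closure ((\<lambda>A. blinfun_apply A \<Omega>) ` quasilocal \<AA>) = UNIV"

locale vacuum_sector = positive_energy +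
  assumes vacuum_unique:
    "(\<And>x. blinfun_apply (U (x, mat 1)) v = v) \<Longrightarrow> \<exists>c. v = c *\<^sub>C \<Omega>"

section \<open>The scaling algebra\<close>

text \<open>
  Functions on \<open>\<real>\<^sub>+\<close> are represented by functions on \<open>real\<close> that vanish on \<open>{..0}\<close>.
\<close>

type_synonym 'h sfun = "real \<Rightarrow> 'h oper"

definition sone :: "'h::chilbert_space sfun" where
  "sone = (\<lambda>l. if 0 < l then id_blinfun else 0)"

definition sadd :: "'h::chilbert_space sfun \<Rightarrow> 'h sfun \<Rightarrow> 'h sfun" where
  "sadd A B = (\<lambda>l. A l + B l)"

definition sscale :: "complex \<Rightarrow> 'h::chilbert_space sfun \<Rightarrow> 'h sfun" where
  "sscale c A = (\<lambda>l. scalar_op c o\<^sub>L A l)"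

definition sprod :: "'h::chilbert_space sfun \<Rightarrow> 'h sfun \<Rightarrow> 'h sfun" where
  "sprod A B = (\<lambda>l. A l o\<^sub>L B l)"

definition sadj :: "'h::chilbert_space sfun \<Rightarrow> 'h sfun" where
  "sadj A = (\<lambda>l. hadj (A l))"

definition snorm :: "'h::chilbert_space sfun \<Rightarrow> real" where
  "snorm A = (SUP l\<in>{0<..}. norm (A l))"

definition sbounded :: "'h::chilbert_space sfun set" where
  "sbounded = {B. (\<forall>l. B l \<in> bounded_ops) \<and> (\<forall>l\<le>0. B l = 0) \<and> bounded (range B)}"

text \<open>
  The element \<open>(\<mu>, x, \<Lambda>)\<close> is the transformation \<open>y \<mapsto> \<mu> (\<Lambda> y + x)\<close>; the group carries the
  topology inherited from the ambient Euclidean space.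
\<close>

definition dil_poincare :: "(real \<times> 's::finite poinc) set" where
  "dil_poincare = {0<..} \<times> poincare"

definition salpha ::
    "('s::finite poinc \<Rightarrow> 'h::chilbert_space oper) \<Rightarrow> real \<times> 's poinc \<Rightarrow> 'h sfun \<Rightarrow> 'h sfun" where
  "salpha U = (\<lambda>(\<mu>, x, L) B l. ad_op (U ((l * \<mu>) *\<^sub>R x, L)) (B (l * \<mu>)))"

definition slocal ::
    "('s::finite mink set \<Rightarrow> 'h::chilbert_space oper set) \<Rightarrow> ('s poinc \<Rightarrow> 'h oper) \<Rightarrow>
     's mink set \<Rightarrow> 'h sfun set" where
  "slocal \<AA> U R = {A \<in> sbounded.
     (\<forall>l>0. A l \<in> \<AA> ((\<lambda>x. l *\<^sub>R x) ` R)) \<and>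
     (\<forall>g\<in>dil_poincare.
        ((\<lambda>h. snorm (\<lambda>l. salpha U h A l - salpha U g A l)) \<longlongrightarrow> 0) (at g within dil_poincare))}"

definition scaling_algebra ::
    "('s::finite mink set \<Rightarrow> 'h::chilbert_space oper set) \<Rightarrow> ('s poinc \<Rightarrow> 'h oper) \<Rightarrow> 'h sfun set" where
  "scaling_algebra \<AA> U = {A \<in> sbounded.
     \<forall>e>0. \<exists>R. region R \<and> (\<exists>B\<in>slocal \<AA> U R. snorm (\<lambda>l. A l - B l) < e)}"

definition scaling_center ::
    "('s::finite mink set \<Rightarrow> 'h::chilbert_space oper set) \<Rightarrow> ('s poinc \<Rightarrow> 'h oper) \<Rightarrow> 'h sfun set" where
  "scaling_center \<AA> U =
     {C \<in> scaling_algebra \<AA> U. \<forall>A\<in>scaling_algebra \<AA> U. sprod C A = sprod A C}"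

section \<open>States, means, limit states\<close>

text \<open>Functionals on a set \<open>X\<close> of scaling functions matter only through their values on \<open>X\<close>.\<close>

definition sstate :: "'h::chilbert_space sfun set \<Rightarrow> ('h sfun \<Rightarrow> complex) \<Rightarrow> bool" where
  "sstate X m \<longleftrightarrow>
     (\<forall>A\<in>X. \<forall>B\<in>X. m (sadd A B) = m A + m B) \<and>
     (\<forall>c. \<forall>A\<in>X. m (sscale c A) = c * m A) \<and>
     (\<forall>A\<in>X. m (sprod (sadj A) A) \<in> \<real>\<^sub>\<ge>\<^sub>0) \<and>
     m sone = 1"

definition asymptotic_mean :: "'h::chilbert_space sfun set \<Rightarrow> ('h sfun \<Rightarrow> complex) \<Rightarrow> bool" where
  "asymptotic_mean Z m \<longleftrightarrow>
     sstate Z m \<and> (\<forall>C\<in>Z. (\<forall>\<^sub>F l in at_right 0. C l = 0) \<longrightarrow> m C = 0)"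

definition multiplicative_mean :: "'h::chilbert_space sfun set \<Rightarrow> ('h sfun \<Rightarrow> complex) \<Rightarrow> bool" where
  "multiplicative_mean Z m \<longleftrightarrow> (\<forall>C\<in>Z. \<forall>D\<in>Z. m (sprod C D) = m C * m D)"

definition vacuum_map :: "'h::chilbert_space \<Rightarrow> 'h sfun \<Rightarrow> 'h sfun" where
  "vacuum_map \<Omega> A = (\<lambda>l. scalar_op (cinner \<Omega> (blinfun_apply (A l) \<Omega>)))"

definition limit_state ::
    "('s::finite mink set \<Rightarrow> 'h::chilbert_space oper set) \<Rightarrow> ('s poinc \<Rightarrow> 'h oper) \<Rightarrow> 'h \<Rightarrow>
     ('h sfun \<Rightarrow> complex) \<Rightarrow> bool" where
  "limit_state \<AA> U \<Omega> w \<longleftrightarrow> sstate (scaling_algebra \<AA> U) w \<and>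
     (\<exists>m. asymptotic_mean (scaling_center \<AA> U) m \<and>
          (\<forall>A\<in>scaling_algebra \<AA> U. w A = m (vacuum_map \<Omega> A)))"

definition multiplicative_limit_state ::
    "('s::finite mink set \<Rightarrow> 'h::chilbert_space oper set) \<Rightarrow> ('s poinc \<Rightarrow> 'h oper) \<Rightarrow> 'h \<Rightarrow>
     ('h sfun \<Rightarrow> complex) \<Rightarrow> bool" where
  "multiplicative_limit_state \<AA> U \<Omega> w \<longleftrightarrow> sstate (scaling_algebra \<AA> U) w \<and>
     (\<exists>m. asymptotic_mean (scaling_center \<AA> U) m \<and> multiplicative_mean (scaling_center \<AA> U) m \<and>
          (\<forall>A\<in>scaling_algebra \<AA> U. w A = m (vacuum_map \<Omega> A)))"

section \<open>Hilbert spaces with explicit carriers\<close>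

text \<open>
  The GNS spaces form a family indexed by points and the direct integral is a quotient, so these
  spaces are structures with a carrier rather than types. The record extends the modules of
  HOL-Algebra, whose fields \<open>mult\<close> and \<open>one\<close> play no role in a vector space.
\<close>

record 'v hspace = "(complex, 'v) Module.module" +
  hinner :: "'v \<Rightarrow> 'v \<Rightarrow> complex"

definition complex_ring :: "complex ring" where
  "complex_ring = \<lparr>carrier = UNIV, mult = (*), one = 1, zero = 0, add = (+)\<rparr>"

definition hnorm :: "'v hspace \<Rightarrow> 'v \<Rightarrow> real" where
  "hnorm H x = sqrt (Re (hinner H x x))"

locale hilbert_space = Module.module complex_ring H
  for H :: "'v hspace" +
  assumes hinner_commute: "x \<in> carrier H \<Longrightarrow> y \<in> carrier H \<Longrightarrow> hinner H y x = cnj (hinner H x y)"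
    and hinner_add: "x \<in> carrier H \<Longrightarrow> y \<in> carrier H \<Longrightarrow> z \<in> carrier H \<Longrightarrow>
          hinner H x (y \<oplus>\<^bsub>H\<^esub> z) = hinner H x y + hinner H x z"
    and hinner_smult: "x \<in> carrier H \<Longrightarrow> y \<in> carrier H \<Longrightarrow>
          hinner H x (c \<odot>\<^bsub>H\<^esub> y) = c * hinner H x y"
    and hinner_nonneg: "x \<in> carrier H \<Longrightarrow> hinner H x x \<in> \<real>\<^sub>\<ge>\<^sub>0"
    and hinner_definite: "x \<in> carrier H \<Longrightarrow> hinner H x x = 0 \<Longrightarrow> x = \<zero>\<^bsub>H\<^esub>"
    and complete: "(\<And>n::nat. X n \<in> carrier H) \<Longrightarrow>
          (\<forall>e>0. \<exists>N. \<forall>m\<ge>N. \<forall>n\<ge>N. hnorm H (X m \<ominus>\<^bsub>H\<^esub> X n) < e) \<Longrightarrow>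
          \<exists>x\<in>carrier H. (\<lambda>n. hnorm H (X n \<ominus>\<^bsub>H\<^esub> x)) \<longlonglongrightarrow> 0"

definition hilbert_iso :: "('v \<Rightarrow> 'w) \<Rightarrow> 'v hspace \<Rightarrow> 'w hspace \<Rightarrow> bool" where
  "hilbert_iso V H K \<longleftrightarrow> hilbert_space H \<and> hilbert_space K \<and>
     bij_betw V (carrier H) (carrier K) \<and>
     (\<forall>x\<in>carrier H. \<forall>y\<in>carrier H. V (x \<oplus>\<^bsub>H\<^esub> y) = V x \<oplus>\<^bsub>K\<^esub> V y) \<and>
     (\<forall>c. \<forall>x\<in>carrier H. V (c \<odot>\<^bsub>H\<^esub> x) = c \<odot>\<^bsub>K\<^esub> V x) \<and>
     (\<forall>x\<in>carrier H. \<forall>y\<in>carrier H. hinner K (V x) (V y) = hinner H x y)"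

definition star_representation ::
    "'h::chilbert_space sfun set \<Rightarrow> 'v hspace \<Rightarrow> ('h sfun \<Rightarrow> 'v \<Rightarrow> 'v) \<Rightarrow> bool" where
  "star_representation X H \<pi> \<longleftrightarrow> hilbert_space H \<and>
     (\<forall>A\<in>X. \<pi> A \<in> carrier H \<rightarrow> carrier H \<and>
        (\<forall>x\<in>carrier H. \<forall>y\<in>carrier H. \<pi> A (x \<oplus>\<^bsub>H\<^esub> y) = \<pi> A x \<oplus>\<^bsub>H\<^esub> \<pi> A y) \<and>
        (\<forall>c. \<forall>x\<in>carrier H. \<pi> A (c \<odot>\<^bsub>H\<^esub> x) = c \<odot>\<^bsub>H\<^esub> \<pi> A x) \<and>
        (\<exists>K. \<forall>x\<in>carrier H. hnorm H (\<pi> A x) \<le> K * hnorm H x)) \<and>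
     (\<forall>A\<in>X. \<forall>B\<in>X. \<forall>x\<in>carrier H. \<pi> (sadd A B) x = \<pi> A x \<oplus>\<^bsub>H\<^esub> \<pi> B x) \<and>
     (\<forall>c. \<forall>A\<in>X. \<forall>x\<in>carrier H. \<pi> (sscale c A) x = c \<odot>\<^bsub>H\<^esub> \<pi> A x) \<and>
     (\<forall>A\<in>X. \<forall>B\<in>X. \<forall>x\<in>carrier H. \<pi> (sprod A B) x = \<pi> A (\<pi> B x)) \<and>
     (\<forall>A\<in>X. \<forall>x\<in>carrier H. \<forall>y\<in>carrier H. hinner H (\<pi> (sadj A) x) y = hinner H x (\<pi> A y)) \<and>
     (\<forall>x\<in>carrier H. \<pi> sone x = x)"

definition gns_triple ::
    "'h::chilbert_space sfun set \<Rightarrow> ('h sfun \<Rightarrow> complex) \<Rightarrow>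
     'v hspace \<Rightarrow> ('h sfun \<Rightarrow> 'v \<Rightarrow> 'v) \<Rightarrow> 'v \<Rightarrow> bool" where
  "gns_triple X w H \<pi> \<Omega> \<longleftrightarrow> star_representation X H \<pi> \<and> \<Omega> \<in> carrier H \<and>
     (\<forall>A\<in>X. w A = hinner H \<Omega> (\<pi> A \<Omega>)) \<and>
     (\<forall>x\<in>carrier H. \<forall>e>0. \<exists>A\<in>X. hnorm H (x \<ominus>\<^bsub>H\<^esub> \<pi> A \<Omega>) < e)"

section \<open>Direct integrals\<close>

definition regular_borel :: "'z::topological_space measure \<Rightarrow> bool" where
  "regular_borel \<nu> \<longleftrightarrow> sets \<nu> = sets borel \<and>
     (\<forall>B\<in>sets borel.
        emeasure \<nu> B = (INF W\<in>{W. open W \<and> B \<subseteq> W}. emeasure \<nu> W) \<and>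
        emeasure \<nu> B = (SUP K\<in>{K. compact K \<and> K \<in> sets borel \<and> K \<subseteq> B}. emeasure \<nu> K))"

text \<open>
  Integrability and measurability refer to the completion of the Borel measure \<open>\<nu>\<close>;
  otherwise closure under modification on arbitrary null sets would be contradictory.
\<close>

definition product_subspace :: "('z \<Rightarrow> 'v hspace) \<Rightarrow> ('z \<Rightarrow> 'v) set \<Rightarrow> bool" where
  "product_subspace H G \<longleftrightarrow>
     G \<subseteq> (\<Pi> z\<in>UNIV. carrier (H z)) \<and>
     (\<lambda>z. \<zero>\<^bsub>H z\<^esub>) \<in> G \<and>
     (\<forall>\<eta>\<in>G. \<forall>\<xi>\<in>G. (\<lambda>z. \<eta> z \<oplus>\<^bsub>H z\<^esub> \<xi> z) \<in> G) \<and>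
     (\<forall>c. \<forall>\<eta>\<in>G. (\<lambda>z. c \<odot>\<^bsub>H z\<^esub> \<eta> z) \<in> G)"

definition fundamental_family ::
    "'z measure \<Rightarrow> ('z \<Rightarrow> 'v hspace) \<Rightarrow> ('z \<Rightarrow> 'v) set \<Rightarrow> bool" where
  "fundamental_family \<nu> H G \<longleftrightarrow> product_subspace H G \<and>
     (\<forall>\<eta>\<in>G. integrable (completion \<nu>) (\<lambda>z. (hnorm (H z) (\<eta> z))\<^sup>2))"

definition di_seminorm :: "'z measure \<Rightarrow> ('z \<Rightarrow> 'v hspace) \<Rightarrow> ('z \<Rightarrow> 'v) \<Rightarrow> real" where
  "di_seminorm \<nu> H \<eta> = sqrt (\<integral>z. (hnorm (H z) (\<eta> z))\<^sup>2 \<partial>completion \<nu>)"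

definition di_dist :: "'z measure \<Rightarrow> ('z \<Rightarrow> 'v hspace) \<Rightarrow> ('z \<Rightarrow> 'v) \<Rightarrow> ('z \<Rightarrow> 'v) \<Rightarrow> real" where
  "di_dist \<nu> H \<eta> \<xi> = di_seminorm \<nu> H (\<lambda>z. \<eta> z \<ominus>\<^bsub>H z\<^esub> \<xi> z)"

definition saturated_family ::
    "'z measure \<Rightarrow> ('z \<Rightarrow> 'v hspace) \<Rightarrow> ('z \<Rightarrow> 'v) set \<Rightarrow> bool" where
  "saturated_family \<nu> H G \<longleftrightarrow> fundamental_family \<nu> H G \<and>
     (\<forall>\<eta>\<in>G. \<forall>\<xi>\<in>(\<Pi> z\<in>UNIV. carrier (H z)). (AE z in \<nu>. \<xi> z = \<eta> z) \<longrightarrow> \<xi> \<in> G) \<and>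
     (\<forall>f\<in>borel_measurable (completion \<nu>). (\<exists>K. AE z in \<nu>. cmod (f z) \<le> K) \<longrightarrow>
        (\<forall>\<eta>\<in>G. (\<lambda>z. f z \<odot>\<^bsub>H z\<^esub> \<eta> z) \<in> G)) \<and>
     (\<forall>X::nat \<Rightarrow> 'z \<Rightarrow> 'v. (\<forall>n. X n \<in> G) \<longrightarrow>
        (\<forall>e>0. \<exists>N. \<forall>m\<ge>N. \<forall>n\<ge>N. di_dist \<nu> H (X m) (X n) < e) \<longrightarrow>
        (\<exists>\<eta>\<in>G. (\<lambda>n. di_dist \<nu> H (X n) \<eta>) \<longlonglongrightarrow> 0))"

definition saturation ::
    "'z measure \<Rightarrow> ('z \<Rightarrow> 'v hspace) \<Rightarrow> ('z \<Rightarrow> 'v) set \<Rightarrow> ('z \<Rightarrow> 'v) set" where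
  "saturation \<nu> H G = saturated_family \<nu> H hull G"

definition di_rel ::
    "'z measure \<Rightarrow> ('z \<Rightarrow> 'v hspace) \<Rightarrow> ('z \<Rightarrow> 'v) set \<Rightarrow> (('z \<Rightarrow> 'v) \<times> ('z \<Rightarrow> 'v)) set" where
  "di_rel \<nu> H G =
     {(\<eta>, \<xi>). \<eta> \<in> saturation \<nu> H G \<and> \<xi> \<in> saturation \<nu> H G \<and> di_dist \<nu> H \<eta> \<xi> = 0}"

definition di_class ::
    "'z measure \<Rightarrow> ('z \<Rightarrow> 'v hspace) \<Rightarrow> ('z \<Rightarrow> 'v) set \<Rightarrow> ('z \<Rightarrow> 'v) \<Rightarrow> ('z \<Rightarrow> 'v) set" where
  "di_class \<nu> H G \<eta> = di_rel \<nu> H G `` {\<eta>}"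

definition di_rep :: "('z \<Rightarrow> 'v) set \<Rightarrow> 'z \<Rightarrow> 'v" where
  "di_rep X = (SOME \<eta>. \<eta> \<in> X)"

definition direct_integral ::
    "'z measure \<Rightarrow> ('z \<Rightarrow> 'v hspace) \<Rightarrow> ('z \<Rightarrow> 'v) set \<Rightarrow> ('z \<Rightarrow> 'v) set hspace" where
  "direct_integral \<nu> H G =
     \<lparr>carrier = saturation \<nu> H G // di_rel \<nu> H G,
      mult = undefined,
      one = undefined,
      zero = di_class \<nu> H G (\<lambda>z. \<zero>\<^bsub>H z\<^esub>),
      add = (\<lambda>X Y. di_class \<nu> H G (\<lambda>z. di_rep X z \<oplus>\<^bsub>H z\<^esub> di_rep Y z)),
      smult = (\<lambda>c X. di_class \<nu> H G (\<lambda>z. c \<odot>\<^bsub>H z\<^esub> di_rep X z)),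
      hinner = (\<lambda>X Y. \<integral>z. hinner (H z) (di_rep X z) (di_rep Y z) \<partial>completion \<nu>)\<rparr>"

end

theory Submission
  imports Defs
begin

text \<open>
  The pairs \<open>(\<pi>\<^sub>0(A) \<Omega>\<^sub>0, z \<mapsto> \<pi>\<^sub>z(A) \<Omega>\<^sub>z)\<close> form the graph of an isometry, because
  \<open>\<omega>\<^sub>0(A* A) = \<integral> \<omega>\<^sub>z(A* A) d\<nu>(z)\<close>. Its closure relates \<open>x \<in> \<H>\<^sub>0\<close> to the fields \<open>\<eta>\<close> that are
  almost everywhere pointwise limits along a sequence of the graph converging to \<open>x\<close>. The usual
  completeness proof for \<open>L\<^sup>2\<close> shows that every \<open>x\<close> is related to exactly one class of fields, so it
  remains to see that the fields which occur form the saturation of \<open>\<Gamma>\<close>. The only point that is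
  not formal is closure under multiplication by \<open>L\<^sup>\<infinity>\<close>: a continuous function on \<open>\<Z>\<close> is
  \<open>z \<mapsto> \<omega>\<^sub>z(C)\<close> for a central \<open>C\<close>, which may be taken to be a scalar function, and by
  multiplicativity \<open>\<pi>\<^sub>z(C) \<Omega>\<^sub>z = \<omega>\<^sub>z(C) \<Omega>\<^sub>z\<close>; regularity of \<open>\<nu>\<close> then gives bounded measurable
  functions as bounded almost everywhere limits.
\<close>

section \<open>Complex Hilbert spaces and adjoints\<close>

text \<open>Nothing is separable, and a field of vectors has no measurable structure of its own:
  only squared norms of suitable fields are integrable. Hence every estimate uses squared norms of
  linear combinations of related fields, and inner products of fields become integrable only
  afterwards, by polarization. For an arbitrary field the integral in the seminorm may be a
  meaningless default value. So the graph is closed with almost everywhere limits in the second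
  component, and the completed measure makes the squared norm of such a limit measurable whatever
  its values on the exceptional null set. Fatou then yields only one half of the isometry; the other
  half comes from applying the first to differences. The saturation is a hull, so minimality among
  saturated families has to be shown besides saturation. The long preparation on operators serves
  the algebra: the vectors given by algebra elements must be closed under sums and under
  multiplication by scalar functions, and their squared norms are values of the states on products
  with adjoints. Since \<open>hadj\<close> is a definite description, even the existence of adjoints
  has to be supplied.\<close>

lemma cinner_add_left: "cinner (x + y) z = cinner x z + cinner y (z::'h::chilbert_space)"
  by (metis cinner_add_right cinner_commute complex_cnj_add)

lemma cinner_scaleC_left: "cinner (a *\<^sub>C x) y = cnj a * cinner x (y::'h::chilbert_space)"
  by (metis cinner_scaleC_right cinner_commute complex_cnj_mult)

lemma scaleC_one [simp]: "1 *\<^sub>C x = (x::'h::chilbert_space)"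
  by (metis of_real_1 scaleR_one scaleR_scaleC)

lemma scaleC_zero_left [simp]: "0 *\<^sub>C x = (0::'h::chilbert_space)"
  by (metis of_real_0 scaleR_zero_left scaleR_scaleC)

lemma scaleC_zero_right [simp]: "a *\<^sub>C 0 = (0::'h::chilbert_space)"
  by (metis mult_zero_right scaleC_scaleC scaleC_zero_left)

lemma cinner_zero_right [simp]: "cinner x (0::'h::chilbert_space) = 0"
  by (metis cinner_scaleC_right mult_zero_left scaleC_zero_left)

lemma cinner_zero_left [simp]: "cinner (0::'h::chilbert_space) x = 0"
  by (metis cinner_commute cinner_zero_right complex_cnj_zero)

lemma uminus_scaleC: "- x = (-1) *\<^sub>C (x::'h::chilbert_space)"
  by (metis of_real_1 of_real_minus scaleR_minus1_left scaleR_scaleC)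

lemma scaleC_minus_right: "a *\<^sub>C (- x) = - (a *\<^sub>C (x::'h::chilbert_space))"
  by (metis mult.commute scaleC_scaleC uminus_scaleC)

lemma scaleC_diff_right: "a *\<^sub>C (x - y) = a *\<^sub>C x - a *\<^sub>C (y::'h::chilbert_space)"
  by (metis diff_conv_add_uminus scaleC_add_right scaleC_minus_right)

lemma cinner_minus_right: "cinner x (- y) = - cinner x (y::'h::chilbert_space)"
  by (metis cinner_scaleC_right mult_minus1 uminus_scaleC)

lemma cinner_minus_left: "cinner (- x) y = - cinner x (y::'h::chilbert_space)"
  by (metis cinner_commute cinner_minus_right complex_cnj_minus)

lemma cinner_diff_right: "cinner x (y - z) = cinner x y - cinner x (z::'h::chilbert_space)"
  by (metis cinner_add_right cinner_minus_right diff_conv_add_uminus)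

lemma cinner_diff_left: "cinner (x - y) z = cinner x z - cinner y (z::'h::chilbert_space)"
  by (metis cinner_add_left cinner_minus_left diff_conv_add_uminus)

lemmas cinner_simps = cinner_add_left cinner_add_right cinner_diff_left cinner_diff_right
  cinner_scaleC_left cinner_scaleC_right cinner_minus_left cinner_minus_right

lemma norm_sq_cinner: "(norm (x::'h::chilbert_space))\<^sup>2 = Re (cinner x x)"
  by (simp add: cinner_self)

lemma norm_scaleC: "norm (a *\<^sub>C (x::'h::chilbert_space)) = cmod a * norm x"
proof -
  have "cinner (a *\<^sub>C x) (a *\<^sub>C x) = (a * cnj a) * cinner x x"
    by (simp add: cinner_simps mult_ac)
  also have "\<dots> = complex_of_real ((cmod a)\<^sup>2 * (norm x)\<^sup>2)"
    by (simp only: complex_norm_square[symmetric] cinner_self of_real_mult)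
  finally have "(norm (a *\<^sub>C x))\<^sup>2 = (cmod a * norm x)\<^sup>2"
    by (simp only: norm_sq_cinner Re_complex_of_real power_mult_distrib)
  then show ?thesis
    by (simp add: power2_eq_iff_nonneg)
qed

text \<open>Both Cauchy-Schwarz and the orthogonality step of the Riesz theorem insert the
  \<open>c\<close> that minimises the right-hand side, namely \<open>cnj (cinner x y)\<close>
  divided by the squared norm of \<open>y\<close>.\<close>

lemma norm_sq_diff_scaleC:
  fixes x y :: "'h::chilbert_space"
  shows "(norm (x - c *\<^sub>C y))\<^sup>2 = (norm x)\<^sup>2 - 2 * Re (c * cinner x y) + (cmod c)\<^sup>2 * (norm y)\<^sup>2"
proof -
  have "cinner (c *\<^sub>C y) x = cnj (c * cinner x y)"
    by (metis cinner_commute cinner_scaleC_right)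
  then have "Re (cinner (c *\<^sub>C y) x) = Re (c * cinner x y)"
    by simp
  moreover have "cinner (x - c *\<^sub>C y) (x - c *\<^sub>C y)
      = cinner x x - c * cinner x y - cinner (c *\<^sub>C y) x + cinner (c *\<^sub>C y) (c *\<^sub>C y)"
    by (simp only: cinner_diff_left cinner_diff_right cinner_scaleC_right) (simp add: algebra_simps)
  ultimately show ?thesis
    unfolding norm_sq_cinner[of "x - c *\<^sub>C y"]
    by (simp add: cinner_self norm_scaleC power_mult_distrib)
qed

lemma norm_cinner_le: "cmod (cinner x y) \<le> norm x * norm (y::'h::chilbert_space)"
proof (cases "y = 0")
  case False
  define r where "r = (norm y)\<^sup>2"
  define c where "c = cnj (cinner x y) / complex_of_real r"
  have r: "r > 0"
    using False by (simp add: r_def)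
  have 1: "c * cinner x y = complex_of_real ((cmod (cinner x y))\<^sup>2 / r)"
    unfolding c_def of_real_divide complex_norm_square by simp
  have 2: "(cmod c)\<^sup>2 * r = (cmod (cinner x y))\<^sup>2 / r"
    using r by (simp add: c_def norm_divide power_divide power2_eq_square)
  have "0 \<le> (norm (x - c *\<^sub>C y))\<^sup>2"
    by simp
  also have "\<dots> = (norm x)\<^sup>2 - (cmod (cinner x y))\<^sup>2 / r"
    unfolding norm_sq_diff_scaleC 1 r_def[symmetric] 2 by simp
  finally have "(cmod (cinner x y))\<^sup>2 \<le> (norm x)\<^sup>2 * r"
    using r by (simp add: pos_divide_le_eq)
  then have "(cmod (cinner x y))\<^sup>2 \<le> (norm x * norm y)\<^sup>2"
    by (simp add: r_def power_mult_distrib)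
  then show ?thesis
    by (rule power2_le_imp_le) simp
qed simp

lemma cinner_eqI: "(\<And>y. cinner x y = cinner x' y) \<Longrightarrow> x = (x'::'h::chilbert_space)"
proof -
  assume *: "\<And>y. cinner x y = cinner x' y"
  have "cinner (x - x') (x - x') = 0"
    by (simp add: cinner_diff_left *)
  then show "x = x'"
    using cinner_self[of "x - x'"] by simp
qed

lemma parallelogram:
  fixes x y :: "'h::chilbert_space"
  shows "(norm (x - y))\<^sup>2 = 2 * (norm x)\<^sup>2 + 2 * (norm y)\<^sup>2 - (norm (x + y))\<^sup>2"
  unfolding norm_sq_cinner by (simp add: cinner_simps)

text \<open>The representing vector is a multiple of the point of least norm in the affine
  hyperplane where \<open>f\<close> equals 1. The parallelogram law makes a minimising sequence
  Cauchy.\<close>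

lemma riesz_representation:
  fixes f :: "'h::chilbert_space \<Rightarrow> complex"
  assumes add: "\<And>x y. f (x + y) = f x + f y"
    and scale: "\<And>c x. f (c *\<^sub>C x) = c * f x"
    and bound: "\<And>x. cmod (f x) \<le> K * norm x"
  shows "\<exists>y. \<forall>x. f x = cinner y x"
proof (cases "\<forall>x. f x = 0")
  case True
  then show ?thesis
    by (intro exI[of _ 0]) simp
next
  case False
  then obtain x0 where x0: "f x0 \<noteq> 0"
    by blast
  define P where "P = {x. f x = 1}"
  have x1: "(1 / f x0) *\<^sub>C x0 \<in> P"
    using x0 by (simp add: P_def scale)
  define d where "d = (INF x\<in>P. (norm x)\<^sup>2)"
  have bdd: "bdd_below ((\<lambda>x. (norm x)\<^sup>2) ` P)"
    by (rule bdd_belowI2[of _ 0]) simp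
  have d: "d \<le> (norm x)\<^sup>2" if "x \<in> P" for x
    unfolding d_def using that bdd by (rule cINF_lower[rotated])
  have "\<exists>x\<in>P. (norm x)\<^sup>2 < d + 1 / real (Suc n)" for n
  proof -
    have "(INF x\<in>P. (norm x)\<^sup>2) < d + 1 / real (Suc n)"
      unfolding d_def[symmetric] by simp
    then show ?thesis
      using cINF_less_iff[OF _ bdd] x1 by blast
  qed
  then obtain X where X: "\<And>n. X n \<in> P" "\<And>n. (norm (X n))\<^sup>2 < d + 1 / real (Suc n)"
    by metis
  have est: "(norm (X m - X n))\<^sup>2 \<le> 2 / real (Suc m) + 2 / real (Suc n)" for m n
  proof -
    \<comment> \<open>The midpoint stays in \<open>P\<close>, so its norm is bounded below by
      \<open>d\<close>. The parallelogram law turns this and the near-minimality of both points into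
      a bound on their distance.\<close>
    have "(1/2) *\<^sub>C (X m + X n) \<in> P"
      using X(1)[of m] X(1)[of n] by (simp add: P_def scale add)
    from d[OF this] have "4 * d \<le> (norm (X m + X n))\<^sup>2"
      by (simp add: norm_scaleC power_mult_distrib power_divide)
    then show ?thesis
      using X(2)[of m] X(2)[of n] unfolding parallelogram[of "X m"] by simp
  qed
  have "Cauchy X"
  proof (rule metric_CauchyI)
    fix e :: real assume e: "e > 0"
    obtain N where N: "inverse (real (Suc N)) < e\<^sup>2 / 4"
      using reals_Archimedean[of "e\<^sup>2/4"] e by auto
    have "dist (X m) (X n) < e" if "m \<ge> N" "n \<ge> N" for m n
    proof -
      have "2 / real (Suc k) < e\<^sup>2 / 2" if "k \<ge> N" for k
      proof -
        have "inverse (real (Suc k)) \<le> inverse (real (Suc N))"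
          using that by (intro le_imp_inverse_le) auto
        then have "inverse (real (Suc k)) < e\<^sup>2 / 4"
          using N by linarith
        moreover have "2 / real (Suc k) = 2 * inverse (real (Suc k))"
          by (rule divide_inverse)
        ultimately show ?thesis
          by linarith
      qed
      from this[OF that(1)] this[OF that(2)] have "(norm (X m - X n))\<^sup>2 < e\<^sup>2"
        using est[of m n] by linarith
      then show ?thesis
        using e unfolding dist_norm by (intro power_less_imp_less_base[of _ 2 e]) simp_all
    qed
    then show "\<exists>M. \<forall>m\<ge>M. \<forall>n\<ge>M. dist (X m) (X n) < e"
      by blast
  qed
  then obtain u where u: "X \<longlonglongrightarrow> u"
    using Cauchy_convergent_iff convergent_def by blast
  have diff: "f (x - y) = f x - f y" for x y
    using add[of x "- y"] scale[of "-1" y] by (simp add: uminus_scaleC[symmetric])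
  have fu: "f u = 1"
  proof -
    have "(\<lambda>n. f (X n)) \<longlonglongrightarrow> f u"
    proof (rule Lim_null[THEN iffD2], rule Lim_null_comparison)
      show "\<forall>\<^sub>F n in sequentially. norm (f (X n) - f u) \<le> K * norm (X n - u)"
        unfolding diff[symmetric] by (intro always_eventually allI bound)
      show "(\<lambda>n. K * norm (X n - u)) \<longlonglongrightarrow> 0"
        by (intro tendsto_mult_right_zero tendsto_norm_zero LIM_zero u)
    qed
    moreover have "f (X n) = 1" for n
      using X(1) by (simp add: P_def)
    ultimately show ?thesis
      by (simp add: LIMSEQ_const_iff)
  qed
  have nu: "(norm u)\<^sup>2 \<le> d"
  proof (rule LIMSEQ_le)
    show "(\<lambda>n. (norm (X n))\<^sup>2) \<longlonglongrightarrow> (norm u)\<^sup>2"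
      by (intro tendsto_intros u)
    show "(\<lambda>n. d + 1 / real (Suc n)) \<longlonglongrightarrow> d"
      using tendsto_add[OF tendsto_const[of d] LIMSEQ_inverse_real_of_nat]
      by (simp add: inverse_eq_divide)
    show "\<exists>N. \<forall>n\<ge>N. (norm (X n))\<^sup>2 \<le> d + 1 / real (Suc n)"
      using X(2) less_imp_le by blast
  qed
  \<comment> \<open>Moving \<open>u\<close> along the kernel of \<open>f\<close> stays inside
    \<open>P\<close>, so it cannot shorten \<open>u\<close>. The optimal step would shorten the
    square of its norm by the quotient on the left of the last estimate, which must therefore
    vanish.\<close>
  have orth: "cinner u v = 0" if v: "f v = 0" for v
  proof (cases "v = 0")
    case False
    define c where "c = cnj (cinner u v) / complex_of_real ((norm v)\<^sup>2)"
    have "u - c *\<^sub>C v \<in> P"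
      by (simp add: P_def diff fu scale v)
    then have "(norm u)\<^sup>2 \<le> (norm (u - c *\<^sub>C v))\<^sup>2"
      by (rule order.trans[OF nu d])
    then have 1: "2 * Re (c * cinner u v) \<le> (cmod c)\<^sup>2 * (norm v)\<^sup>2"
      by (simp add: norm_sq_diff_scaleC)
    have 2: "c * cinner u v = complex_of_real ((cmod (cinner u v))\<^sup>2 / (norm v)\<^sup>2)"
      unfolding c_def of_real_divide complex_norm_square by simp
    have 3: "(cmod c)\<^sup>2 * (norm v)\<^sup>2 = (cmod (cinner u v))\<^sup>2 / (norm v)\<^sup>2"
      using False by (simp add: c_def norm_divide norm_mult power_divide power2_eq_square)
    have "(cmod (cinner u v))\<^sup>2 / (norm v)\<^sup>2 \<le> 0"
      using 1 unfolding 2 3 by simp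
    then show ?thesis
      using False by (simp add: divide_le_0_iff)
  qed simp
  have u0: "cinner u u \<noteq> 0"
    using fu scale[of 0 u] by (auto simp: cinner_self)
  show ?thesis
  proof (intro exI allI)
    fix x
    \<comment> \<open>Since \<open>f u = 1\<close>, subtracting \<open>f x\<close> times
      \<open>u\<close> from \<open>x\<close> lands in the kernel. The conjugate in the witness below
      compensates for antilinearity in the first argument.\<close>
    have "cinner u (x - f x *\<^sub>C u) = 0"
      by (rule orth) (simp add: diff scale fu)
    then have "cinner u x = f x * cinner u u"
      by (simp add: cinner_simps)
    then show "f x = cinner ((1 / cnj (cinner u u)) *\<^sub>C u) x"
      using u0 by (simp add: cinner_simps)
  qed
qed

section \<open>Complex linear operators, scalars and adjoints\<close>

lemma bounded_ops_scaleC: "T \<in> bounded_ops \<Longrightarrow> blinfun_apply T (c *\<^sub>C x) = c *\<^sub>C blinfun_apply T x"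
  by (simp add: bounded_ops_def)

lemma bounded_ops_closed [simp, intro]:
  "0 \<in> bounded_ops" "id_blinfun \<in> bounded_ops"
  "S \<in> bounded_ops \<Longrightarrow> T \<in> bounded_ops \<Longrightarrow> S + T \<in> bounded_ops"
  "S \<in> bounded_ops \<Longrightarrow> T \<in> bounded_ops \<Longrightarrow> S - T \<in> bounded_ops"
  "S \<in> bounded_ops \<Longrightarrow> T \<in> bounded_ops \<Longrightarrow> S o\<^sub>L T \<in> bounded_ops"
  by (simp_all add: bounded_ops_def blinfun.add_left blinfun.diff_left scaleC_add_right scaleC_diff_right)

lemma bounded_linear_scaleC: "bounded_linear (\<lambda>x::'h::chilbert_space. c *\<^sub>C x)"
proof (rule bounded_linear_intro[of _ "cmod c"])
  fix r and x :: 'h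
  show "c *\<^sub>C (r *\<^sub>R x) = r *\<^sub>R (c *\<^sub>C x)"
    by (simp add: scaleR_scaleC scaleC_scaleC mult.commute)
qed (simp_all add: scaleC_add_right norm_scaleC mult.commute)

lemma scalar_op_apply [simp]: "blinfun_apply (scalar_op c) x = c *\<^sub>C x"
  by (simp add: scalar_op_def bounded_linear_Blinfun_apply bounded_linear_scaleC)

lemma scalar_op_bounded_ops [simp, intro]: "scalar_op c \<in> bounded_ops"
  by (simp add: bounded_ops_def scaleC_scaleC mult.commute)

lemma scalar_op_0 [simp]: "scalar_op 0 = (0::'h::chilbert_space oper)"
  by (rule blinfun_eqI) simp

lemma scalar_op_1 [simp]: "scalar_op 1 = (id_blinfun::'h::chilbert_space oper)"
  by (rule blinfun_eqI) simp

lemma scalar_op_compose: "scalar_op c o\<^sub>L scalar_op d = (scalar_op (c * d) :: 'h::chilbert_space oper)"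
  by (rule blinfun_eqI) (simp add: scaleC_scaleC)

lemma scalar_op_diff: "scalar_op c - scalar_op d = (scalar_op (c - d) :: 'h::chilbert_space oper)"
proof (rule blinfun_eqI)
  fix x :: 'h
  have "c *\<^sub>C x = (c - d) *\<^sub>C x + d *\<^sub>C x"
    by (simp add: scaleC_add_left[symmetric])
  then show "blinfun_apply (scalar_op c - scalar_op d) x = blinfun_apply (scalar_op (c - d)) x"
    by (simp add: blinfun.diff_left)
qed

lemma scalar_op_commute: "T \<in> bounded_ops \<Longrightarrow> T o\<^sub>L scalar_op c = scalar_op c o\<^sub>L T"
  by (rule blinfun_eqI) (simp add: bounded_ops_scaleC)

lemma norm_scalar_op_le: "norm (scalar_op c :: 'h::chilbert_space oper) \<le> cmod c"
  by (rule norm_blinfun_bound) (simp_all add: norm_scaleC)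

text \<open>This is what gives the description \<open>hadj\<close> a meaning: Riesz is applied, for
  each \<open>x\<close>, to the functional sending \<open>y\<close> to
  \<open>cinner x (T y)\<close>, and uniqueness is nondegeneracy of the inner product.\<close>

lemma hadj_ex1:
  assumes T: "T \<in> bounded_ops"
  shows "\<exists>!S. S \<in> bounded_ops \<and>
     (\<forall>x y. cinner (blinfun_apply S x) y = cinner x (blinfun_apply T (y::'h::chilbert_space)))"
proof -
  have "\<exists>z. \<forall>y. cinner x (blinfun_apply T y) = cinner z y" for x
  proof (rule riesz_representation)
    show "cmod (cinner x (blinfun_apply T y)) \<le> (norm x * norm T) * norm y" for y
      by (rule order.trans[OF norm_cinner_le]) (simp add: mult.assoc mult_left_mono norm_blinfun)
  qed (simp_all add: blinfun.add_right cinner_add_right bounded_ops_scaleC[OF T] cinner_scaleC_right)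
  then obtain s where s: "\<And>x y. cinner x (blinfun_apply T y) = cinner (s x) y"
    by metis
  have s_add: "s (x + y) = s x + s y" for x y
    by (rule cinner_eqI) (simp add: s[symmetric] cinner_add_left)
  have s_scale: "s (c *\<^sub>C x) = c *\<^sub>C s x" for c x
    by (rule cinner_eqI) (simp add: s[symmetric] cinner_scaleC_left)
  have s_bound: "norm (s x) \<le> norm x * norm T" for x
  proof (cases "s x = 0")
    case False
    have "(norm (s x))\<^sup>2 = cmod (cinner (s x) (s x))"
      by (simp only: cinner_self norm_of_real) simp
    also have "\<dots> = cmod (cinner x (blinfun_apply T (s x)))"
      by (simp add: s)
    also have "\<dots> \<le> norm x * (norm T * norm (s x))"
      by (rule order.trans[OF norm_cinner_le]) (simp add: mult_left_mono norm_blinfun)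
    finally have "norm (s x) * norm (s x) \<le> (norm x * norm T) * norm (s x)"
      by (simp only: power2_eq_square mult_ac)
    then show ?thesis
      using False by (simp only: mult_le_cancel_right) simp
  qed simp
  have "bounded_linear s"
    by (rule bounded_linear_intro[of _ "norm T"]) (simp_all add: s_add scaleR_scaleC s_scale s_bound)
  then have S: "blinfun_apply (Blinfun s) = s"
    by (simp add: bounded_linear_Blinfun_apply)
  show ?thesis
  proof (rule ex1I[of _ "Blinfun s"])
    show "Blinfun s \<in> bounded_ops \<and>
        (\<forall>x y. cinner (blinfun_apply (Blinfun s) x) y = cinner x (blinfun_apply T y))"
      by (simp add: S s s_scale bounded_ops_def)
    fix S' assume "S' \<in> bounded_ops \<and>
        (\<forall>x y. cinner (blinfun_apply S' x) y = cinner x (blinfun_apply T y))"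
    then show "S' = Blinfun s"
      by (intro blinfun_eqI cinner_eqI) (simp add: S s)
  qed
qed

lemma
  assumes "T \<in> bounded_ops"
  shows hadj_bounded_ops [simp, intro]: "hadj T \<in> bounded_ops"
    and cinner_hadj_left: "cinner (blinfun_apply (hadj T) x) y = cinner x (blinfun_apply T y)"
  using theI'[OF hadj_ex1[OF assms]] unfolding hadj_def by auto

lemma cinner_hadj_right:
  "T \<in> bounded_ops \<Longrightarrow> cinner x (blinfun_apply (hadj T) y) = cinner (blinfun_apply T x) y"
  by (metis cinner_commute cinner_hadj_left)

lemma hadj_eqI:
  assumes "T \<in> bounded_ops"
    and "\<And>x y. cinner (blinfun_apply S x) y = cinner x (blinfun_apply T y)"
  shows "hadj T = S"
  by (intro blinfun_eqI cinner_eqI) (simp add: assms cinner_hadj_left)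

lemma hadj_0 [simp]: "hadj 0 = (0::'h::chilbert_space oper)"
  by (rule hadj_eqI) auto

lemma hadj_scalar_op [simp]: "hadj (scalar_op c) = (scalar_op (cnj c)::'h::chilbert_space oper)"
  by (rule hadj_eqI) (auto simp: cinner_simps)

lemma hadj_hadj: "T \<in> bounded_ops \<Longrightarrow> hadj (hadj T) = T"
  by (rule hadj_eqI) (auto simp: cinner_hadj_right)

lemma hadj_diff: "S \<in> bounded_ops \<Longrightarrow> T \<in> bounded_ops \<Longrightarrow> hadj (S - T) = hadj S - hadj T"
  by (rule hadj_eqI) (auto simp: cinner_simps blinfun.diff_left cinner_hadj_left)

lemma hadj_compose: "S \<in> bounded_ops \<Longrightarrow> T \<in> bounded_ops \<Longrightarrow> hadj (S o\<^sub>L T) = hadj T o\<^sub>L hadj S"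
  by (rule hadj_eqI) (auto simp: cinner_hadj_left)

lemma norm_hadj_le:
  assumes "T \<in> bounded_ops"
  shows "norm (hadj T) \<le> norm T"
proof (rule norm_blinfun_bound)
  fix x
  let ?y = "blinfun_apply (hadj T) x"
  show "norm ?y \<le> norm T * norm x"
  proof (cases "?y = 0")
    case False
    have "(norm ?y)\<^sup>2 = cmod (cinner ?y ?y)"
      by (simp only: cinner_self norm_of_real) simp
    also have "\<dots> = cmod (cinner x (blinfun_apply T ?y))"
      by (simp add: cinner_hadj_left assms)
    also have "\<dots> \<le> norm x * (norm T * norm ?y)"
      by (rule order.trans[OF norm_cinner_le]) (simp add: mult_left_mono norm_blinfun)
    finally have "norm ?y * norm ?y \<le> (norm T * norm x) * norm ?y"
      by (simp only: power2_eq_square mult_ac)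
    then show ?thesis
      using False by (simp only: mult_le_cancel_right) simp
  qed simp
qed simp

text \<open>A von Neumann algebra is the commutant of its commutant, so its algebraic closure
  properties need only be checked for commutants.\<close>

lemma commutant_closed:
  assumes "S \<in> commutant M" "T \<in> commutant M" "M \<subseteq> bounded_ops"
  shows "S + T \<in> commutant M" "S o\<^sub>L T \<in> commutant M" "scalar_op c \<in> commutant M"
proof -
  note add = bounded_bilinear.add_left[OF bounded_bilinear_blinfun_compose]
    bounded_bilinear.add_right[OF bounded_bilinear_blinfun_compose]
  have S: "S o\<^sub>L A = A o\<^sub>L S" and T: "T o\<^sub>L A = A o\<^sub>L T" if "A \<in> M" for A
    using assms that by (auto simp: commutant_def)
  show "S + T \<in> commutant M"
    using assms by (simp add: commutant_def add)
  have "S o\<^sub>L T o\<^sub>L A = A o\<^sub>L (S o\<^sub>L T)" if "A \<in> M" for A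
  proof (rule blinfun_eqI)
    show "blinfun_apply (S o\<^sub>L T o\<^sub>L A) x = blinfun_apply (A o\<^sub>L (S o\<^sub>L T)) x" for x
      using arg_cong[OF S[OF that], of "\<lambda>F. blinfun_apply F (blinfun_apply T x)"]
        arg_cong[OF T[OF that], of "\<lambda>F. blinfun_apply F x"] by simp
  qed
  then show "S o\<^sub>L T \<in> commutant M"
    using assms by (simp add: commutant_def)
  show "scalar_op c \<in> commutant M"
    using assms by (auto simp: commutant_def scalar_op_commute)
qed

lemma von_neumann_algebra_closed:
  assumes M: "von_neumann_algebra M"
  shows "M \<subseteq> bounded_ops"
    and "S \<in> M \<Longrightarrow> T \<in> M \<Longrightarrow> S + T \<in> M"
    and "S \<in> M \<Longrightarrow> T \<in> M \<Longrightarrow> S o\<^sub>L T \<in> M"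
    and "S \<in> M \<Longrightarrow> hadj S \<in> M"
    and "scalar_op c \<in> M"
proof -
  have *: "commutant (commutant M) = M"
    using M by (simp add: von_neumann_algebra_def)
  have 1: "commutant M \<subseteq> bounded_ops"
    by (auto simp: commutant_def)
  show "M \<subseteq> bounded_ops" "S \<in> M \<Longrightarrow> hadj S \<in> M"
    using M by (simp_all add: von_neumann_algebra_def)
  show "S \<in> M \<Longrightarrow> T \<in> M \<Longrightarrow> S + T \<in> M" "S \<in> M \<Longrightarrow> T \<in> M \<Longrightarrow> S o\<^sub>L T \<in> M"
    using commutant_closed(1,2)[of S "commutant M" T] 1 * by auto
  \<comment> \<open>The lemma on commutants speaks about given elements of the commutant, so one
    element of the bicommutant has to be exhibited before the scalars can be read off.\<close>
  have "id_blinfun \<in> commutant (commutant M)"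
    by (auto simp: commutant_def intro!: blinfun_eqI)
  then show "scalar_op c \<in> M"
    using commutant_closed(3)[of _ "commutant M"] 1 * by auto
qed

section \<open>The scaling algebra is a unital *-algebra\<close>

lemma
  fixes V :: "'h::chilbert_space oper"
  assumes "unitary_op V"
  shows unitary_bounded_ops: "V \<in> bounded_ops"
    and unitary_left: "blinfun_apply (hadj V) (blinfun_apply V x) = x"
    and unitary_right: "blinfun_apply V (blinfun_apply (hadj V) x) = x"
    and unitary_norm_le: "norm V \<le> 1"
proof -
  show V: "V \<in> bounded_ops"
    using assms by (simp add: unitary_op_def)
  have 1: "hadj V o\<^sub>L V = id_blinfun" "V o\<^sub>L hadj V = id_blinfun"
    using assms by (simp_all add: unitary_op_def)
  show left: "blinfun_apply (hadj V) (blinfun_apply V x) = x" for x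
    using arg_cong[OF 1(1), of "\<lambda>F. blinfun_apply F x"] by simp
  show "blinfun_apply V (blinfun_apply (hadj V) x) = x"
    using arg_cong[OF 1(2), of "\<lambda>F. blinfun_apply F x"] by simp
  show "norm V \<le> 1"
  proof (rule norm_blinfun_bound)
    fix x
    have "(norm (blinfun_apply V x))\<^sup>2 = (norm x)\<^sup>2"
      unfolding norm_sq_cinner using cinner_hadj_left[OF V, of "blinfun_apply V x" x] by (simp add: left)
    then show "norm (blinfun_apply V x) \<le> 1 * norm x"
      by (simp add: power2_eq_iff_nonneg)
  qed simp
qed

lemma ad_op_bounded_ops [simp, intro]: "unitary_op V \<Longrightarrow> T \<in> bounded_ops \<Longrightarrow> ad_op V T \<in> bounded_ops"
  by (simp add: ad_op_def unitary_bounded_ops)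

lemma ad_op_apply [simp]: "blinfun_apply (ad_op V T) x = blinfun_apply V (blinfun_apply T (blinfun_apply (hadj V) x))"
  by (simp add: ad_op_def)

lemma norm_ad_op_le:
  assumes V: "unitary_op V"
  shows "norm (ad_op V T) \<le> norm T"
proof -
  have "norm (hadj V) \<le> 1"
    using norm_hadj_le[OF unitary_bounded_ops[OF V]] unitary_norm_le[OF V] by linarith
  have "norm (ad_op V T) \<le> norm (V o\<^sub>L T) * norm (hadj V)"
    unfolding ad_op_def by (rule norm_blinfun_compose)
  also have "\<dots> \<le> norm (V o\<^sub>L T) * 1"
    by (intro mult_left_mono) (use \<open>norm (hadj V) \<le> 1\<close> in simp_all)
  also have "\<dots> \<le> norm V * norm T"
    by (simp add: norm_blinfun_compose)
  also have "\<dots> \<le> 1 * norm T"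
    by (intro mult_right_mono unitary_norm_le[OF V]) simp
  finally show ?thesis
    by simp
qed

lemma ad_op_add: "ad_op V (S + T) = ad_op V S + ad_op V T"
  by (rule blinfun_eqI) (simp add: blinfun.add_left blinfun.add_right)

lemma ad_op_compose: "unitary_op V \<Longrightarrow> ad_op V (S o\<^sub>L T) = ad_op V S o\<^sub>L ad_op V T"
  by (rule blinfun_eqI) (simp add: unitary_left)

lemma ad_op_hadj: "unitary_op V \<Longrightarrow> T \<in> bounded_ops \<Longrightarrow> ad_op V (hadj T) = hadj (ad_op V T)"
  by (rule blinfun_eqI) (simp add: ad_op_def hadj_compose hadj_hadj unitary_bounded_ops)

lemma ad_op_scalar_op: "unitary_op V \<Longrightarrow> ad_op V (scalar_op c) = scalar_op c"
  by (rule blinfun_eqI) (simp add: bounded_ops_scaleC unitary_bounded_ops unitary_right)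

lemma cinner_ad_op_fixed:
  assumes V: "unitary_op V" and x: "blinfun_apply V x = x"
  shows "cinner x (blinfun_apply (ad_op V T) x) = cinner x (blinfun_apply T x)"
proof -
  have "blinfun_apply (hadj V) x = x"
    using unitary_left[OF V, of x] by (simp add: x)
  then show ?thesis
    using cinner_hadj_left[OF unitary_bounded_ops[OF V], of x "blinfun_apply T x"] by simp
qed

section \<open>Bounded functions of the scale\<close>

lemma sboundedE:
  assumes "A \<in> sbounded"
  obtains K where "\<And>l. norm (A l) \<le> K" "0 \<le> K"
proof -
  from assms obtain K where "\<And>l. norm (A l) \<le> K"
    by (auto simp: sbounded_def bounded_iff)
  then show ?thesis
    using that order.trans[OF norm_ge_zero] by blast
qed

lemma sboundedD:
  "A \<in> sbounded \<Longrightarrow> A l \<in> bounded_ops" "A \<in> sbounded \<Longrightarrow> l \<le> 0 \<Longrightarrow> A l = 0"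
  by (auto simp: sbounded_def)

lemma sboundedI:
  assumes "\<And>l. A l \<in> bounded_ops" "\<And>l. l \<le> 0 \<Longrightarrow> A l = 0" "\<And>l. norm (A l) \<le> K"
  shows "A \<in> sbounded"
  using assms by (auto simp: sbounded_def bounded_iff)

lemma sbounded_sadd:
  assumes "A \<in> sbounded" "B \<in> sbounded"
  shows "sadd A B \<in> sbounded"
proof -
  obtain K where K: "\<And>l. norm (A l) \<le> K"
    using assms(1) by (rule sboundedE) blast
  obtain L where L: "\<And>l. norm (B l) \<le> L"
    using assms(2) by (rule sboundedE) blast
  have "norm (sadd A B l) \<le> K + L" for l
    unfolding sadd_def using norm_triangle_ineq[of "A l" "B l"] K[of l] L[of l] by linarith
  then show ?thesis
    by (rule sboundedI[rotated 2]) (simp_all add: sadd_def sboundedD assms bounded_ops_closed)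
qed

lemma sbounded_sprod:
  assumes "A \<in> sbounded" "B \<in> sbounded"
  shows "sprod A B \<in> sbounded"
proof -
  obtain K where K: "\<And>l. norm (A l) \<le> K" "0 \<le> K"
    using assms(1) by (rule sboundedE) blast
  obtain L where L: "\<And>l. norm (B l) \<le> L" "0 \<le> L"
    using assms(2) by (rule sboundedE) blast
  have "norm (sprod A B l) \<le> K * L" for l
    unfolding sprod_def using norm_blinfun_compose[of "A l" "B l"] mult_mono[OF K(1) L(1) K(2) norm_ge_zero, of l l]
    by linarith
  then show ?thesis
    by (rule sboundedI[rotated 2]) (simp_all add: sprod_def sboundedD assms bounded_ops_closed)
qed

lemma sbounded_sadj:
  assumes "A \<in> sbounded"
  shows "sadj A \<in> sbounded"
proof -
  obtain K where K: "\<And>l. norm (A l) \<le> K"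
    using assms by (rule sboundedE) blast
  have "norm (sadj A l) \<le> K" for l
    unfolding sadj_def using norm_hadj_le[OF sboundedD(1)[OF assms], of l] K[of l] by linarith
  then show ?thesis
    by (rule sboundedI[rotated 2]) (simp_all add: sadj_def sboundedD assms)
qed

lemma sbounded_scalar:
  assumes "\<And>l. cmod (f l) \<le> K" "\<And>l. l \<le> 0 \<Longrightarrow> f l = 0"
  shows "(\<lambda>l. scalar_op (f l)) \<in> sbounded"
  by (rule sboundedI[of _ K]) (auto simp: assms intro: order.trans[OF norm_scalar_op_le])

lemma region_scaling: "region R \<Longrightarrow> 0 < l \<Longrightarrow> region ((\<lambda>x. l *\<^sub>R x) ` R)"
  by (auto simp: region_def intro!: open_scaling bounded_scaling)

lemma region_Un: "region R1 \<Longrightarrow> region R2 \<Longrightarrow> region (R1 \<union> R2)"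
  by (auto simp: region_def)

section \<open>The action of dilations and Poincare transformations, and its norm continuity\<close>

context positive_energy
begin

text \<open>At fixed \<open>l\<close> the action is conjugation by one unitary after a shift of the
  scale. The unitary does not depend on \<open>A\<close>, which gives the compatibility with sums,
  products and adjoints, and it fixes the vacuum.\<close>

lemma salpha_ad_op:
  assumes "g \<in> dil_poincare"
  obtains V where "unitary_op V" "blinfun_apply V \<Omega> = \<Omega>" "\<And>A. salpha U g A l = ad_op V (A (l * fst g))"
proof -
  obtain \<mu> x L where g: "g = (\<mu>, x, L)"
    by (cases g) auto
  then have "((l * \<mu>) *\<^sub>R x, L) \<in> poincare"
    using assms by (auto simp: dil_poincare_def poincare_def)
  then show ?thesis
    by (intro that[of "U ((l * \<mu>) *\<^sub>R x, L)"] unitary vacuum_invariant) (simp_all add: g salpha_def)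
qed

lemma salpha_sadd: "g \<in> dil_poincare \<Longrightarrow> salpha U g (sadd A B) l = salpha U g A l + salpha U g B l"
  by (erule salpha_ad_op[of _ l]) (simp add: sadd_def ad_op_add)

lemma salpha_sprod: "g \<in> dil_poincare \<Longrightarrow> salpha U g (sprod A B) l = salpha U g A l o\<^sub>L salpha U g B l"
  by (erule salpha_ad_op[of _ l]) (simp add: sprod_def ad_op_compose)

lemma salpha_sadj: "g \<in> dil_poincare \<Longrightarrow> A \<in> sbounded \<Longrightarrow> salpha U g (sadj A) l = hadj (salpha U g A l)"
  by (erule salpha_ad_op[of _ l]) (simp add: sadj_def ad_op_hadj sboundedD)

lemma salpha_scalar: "g \<in> dil_poincare \<Longrightarrow> salpha U g (\<lambda>l. scalar_op (f l)) l = scalar_op (f (l * fst g))"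
  by (erule salpha_ad_op[of _ l]) (simp add: ad_op_scalar_op)

lemma salpha_bounded_ops: "g \<in> dil_poincare \<Longrightarrow> A \<in> sbounded \<Longrightarrow> salpha U g A l \<in> bounded_ops"
  by (erule salpha_ad_op[of _ l]) (simp add: sboundedD)

text \<open>Poincare invariance of the vacuum removes the unitary, so a vacuum expectation sees only
  the dilation factor of \<open>g\<close>.\<close>

lemma cinner_salpha:
  "g \<in> dil_poincare \<Longrightarrow> cinner \<Omega> (blinfun_apply (salpha U g A l) \<Omega>) = cinner \<Omega> (blinfun_apply (A (l * fst g)) \<Omega>)"
  by (erule salpha_ad_op[of _ l]) (simp add: cinner_ad_op_fixed del: ad_op_apply)

lemma norm_salpha_le:
  assumes "g \<in> dil_poincare" "\<And>l. norm (A l) \<le> K"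
  shows "norm (salpha U g A l) \<le> K"
  by (rule salpha_ad_op[OF assms(1), of l]) (use assms(2) in \<open>auto intro: order.trans[OF norm_ad_op_le]\<close>)

lemma eventually_dil_poincare: "\<forall>\<^sub>F h in at g within dil_poincare. h \<in> dil_poincare"
  by (simp add: eventually_at_filter)

text \<open>A supremum of reals such as \<open>snorm\<close> is only meaningful for bounded
  families. Uniform convergence in the scale expresses the same continuity without that side
  condition and passes directly to sums and products.\<close>

definition alpha_continuous :: "'h sfun \<Rightarrow> bool" where
  "alpha_continuous A \<longleftrightarrow> (\<forall>g\<in>dil_poincare.
     uniform_limit {0<..} (\<lambda>h. salpha U h A) (salpha U g A) (at g within dil_poincare))"

text \<open>The bound \<open>K + K\<close> makes the supremum dominate each of its terms. In the
  other direction a strict bound on all terms gives only a weak one on the supremum, hence the use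
  of \<open>e / 2\<close>.\<close>

lemma tendsto_snorm_iff_uniform_limit:
  assumes A: "A \<in> sbounded" and g: "g \<in> dil_poincare"
  shows "((\<lambda>h. snorm (\<lambda>l. salpha U h A l - salpha U g A l)) \<longlongrightarrow> 0) (at g within dil_poincare) \<longleftrightarrow>
    uniform_limit {0<..} (\<lambda>h. salpha U h A) (salpha U g A) (at g within dil_poincare)"
proof -
  let ?n = "\<lambda>h l. norm (salpha U h A l - salpha U g A l)"
  obtain K where K: "\<And>l. norm (A l) \<le> K"
    using A by (rule sboundedE) blast
  have bdd: "bdd_above (?n h ` {0<..})" if "h \<in> dil_poincare" for h
  proof (rule bdd_aboveI2)
    fix l
    show "?n h l \<le> K + K"
      using norm_triangle_ineq4[of "salpha U h A l" "salpha U g A l"]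
        norm_salpha_le[where A = A and l = l, OF that K] norm_salpha_le[where A = A and l = l, OF g K] by linarith
  qed
  have upper: "?n h l \<le> snorm (\<lambda>l. salpha U h A l - salpha U g A l)" if "h \<in> dil_poincare" "0 < l" for h l
    unfolding snorm_def using bdd[OF that(1)] that(2) by (intro cSUP_upper) simp_all
  show ?thesis
  proof
    assume lim: "((\<lambda>h. snorm (\<lambda>l. salpha U h A l - salpha U g A l)) \<longlongrightarrow> 0) (at g within dil_poincare)"
    show "uniform_limit {0<..} (\<lambda>h. salpha U h A) (salpha U g A) (at g within dil_poincare)"
    proof (rule uniform_limitI)
      fix e :: real assume "e > 0"
      show "\<forall>\<^sub>F h in at g within dil_poincare. \<forall>l\<in>{0<..}. dist (salpha U h A l) (salpha U g A l) < e"
        using order_tendstoD(2)[OF lim \<open>e > 0\<close>] eventually_dil_poincare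
        by eventually_elim (use upper in \<open>force simp: dist_norm\<close>)
    qed
  next
    assume lim: "uniform_limit {0<..} (\<lambda>h. salpha U h A) (salpha U g A) (at g within dil_poincare)"
    show "((\<lambda>h. snorm (\<lambda>l. salpha U h A l - salpha U g A l)) \<longlongrightarrow> 0) (at g within dil_poincare)"
    proof (rule tendstoI)
      fix e :: real assume e: "e > 0"
      then have "e / 2 > 0"
        by simp
      from uniform_limitD[OF lim this] eventually_dil_poincare
      show "\<forall>\<^sub>F h in at g within dil_poincare. dist (snorm (\<lambda>l. salpha U h A l - salpha U g A l)) 0 < e"
      proof eventually_elim
        fix h assume le: "\<forall>l\<in>{0<..}. dist (salpha U h A l) (salpha U g A l) < e / 2" and h: "h \<in> dil_poincare"
        have "snorm (\<lambda>l. salpha U h A l - salpha U g A l) \<le> e / 2"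
          unfolding snorm_def using le by (intro cSUP_least) (auto simp: dist_norm less_imp_le)
        moreover have "0 \<le> snorm (\<lambda>l. salpha U h A l - salpha U g A l)"
          by (rule order.trans[OF norm_ge_zero upper[OF h zero_less_one]])
        ultimately show "dist (snorm (\<lambda>l. salpha U h A l - salpha U g A l)) 0 < e"
          using e by (simp add: dist_norm)
      qed
    qed
  qed
qed

lemma slocal_iff:
  "A \<in> slocal \<AA> U R \<longleftrightarrow> A \<in> sbounded \<and> (\<forall>l>0. A l \<in> \<AA> ((\<lambda>x. l *\<^sub>R x) ` R)) \<and> alpha_continuous A"
  unfolding slocal_def alpha_continuous_def using tendsto_snorm_iff_uniform_limit by blast

text \<open>The formulas for \<open>salpha\<close> hold for group elements only. The filter is
  restricted to the group, so they may be substituted under the limit.\<close>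

lemma alpha_continuous_cong:
  assumes "\<And>g l. g \<in> dil_poincare \<Longrightarrow> 0 < l \<Longrightarrow> salpha U g A l = F g l"
    and "\<And>g. g \<in> dil_poincare \<Longrightarrow> uniform_limit {0<..} F (F g) (at g within dil_poincare)"
  shows "alpha_continuous A"
  unfolding alpha_continuous_def
proof
  fix g :: "real \<times> 's poinc" assume g: "g \<in> dil_poincare"
  have "\<forall>\<^sub>F h in at g within dil_poincare. \<forall>l\<in>{0<..}. salpha U h A l = F h l"
    using eventually_dil_poincare by eventually_elim (simp add: assms(1))
  then show "uniform_limit {0<..} (\<lambda>h. salpha U h A) (salpha U g A) (at g within dil_poincare)"
    using assms(2)[OF g] uniform_limit_cong[where F = "at g within dil_poincare" and X = "{0<..}"
      and f = "\<lambda>h. salpha U h A" and g = F and h = "salpha U g A" and i = "F g"] assms(1)[OF g] by simp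
qed

lemma alpha_continuous_sadd:
  assumes "alpha_continuous A" "alpha_continuous B"
  shows "alpha_continuous (sadd A B)"
  by (rule alpha_continuous_cong[OF salpha_sadd])
    (use assms in \<open>auto simp: alpha_continuous_def intro: uniform_limit_add\<close>)

lemma alpha_continuous_sprod:
  assumes A: "A \<in> sbounded" "alpha_continuous A" and B: "B \<in> sbounded" "alpha_continuous B"
  shows "alpha_continuous (sprod A B)"
proof (rule alpha_continuous_cong[OF salpha_sprod])
  fix g :: "real \<times> 's poinc" assume g: "g \<in> dil_poincare"
  have bdd: "bounded (salpha U g C ` {0<..})" if "C \<in> sbounded" for C
  proof -
    obtain K where "\<And>l. norm (C l) \<le> K"
      using \<open>C \<in> sbounded\<close> by (rule sboundedE) blast
    then have "norm (salpha U g C l) \<le> K" for l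
      by (rule norm_salpha_le[OF g])
    then show ?thesis
      unfolding bounded_iff by blast
  qed
  show "uniform_limit {0<..} (\<lambda>g l. salpha U g A l o\<^sub>L salpha U g B l) (\<lambda>l. salpha U g A l o\<^sub>L salpha U g B l)
      (at g within dil_poincare)"
    by (rule bounded_bilinear.bounded_uniform_limit[OF bounded_bilinear_blinfun_compose])
      (use assms g bdd in \<open>auto simp: alpha_continuous_def\<close>)
qed

text \<open>\<open>hadj\<close> is controlled on \<open>bounded_ops\<close> only and is therefore
  not treated as a bounded linear map; the estimate uses that it is subtractive and contractive
  there.\<close>

lemma alpha_continuous_sadj:
  assumes A: "A \<in> sbounded" "alpha_continuous A"
  shows "alpha_continuous (sadj A)"
proof (rule alpha_continuous_cong[OF salpha_sadj[OF _ A(1)]])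
  fix g :: "real \<times> 's poinc" assume g: "g \<in> dil_poincare"
  show "uniform_limit {0<..} (\<lambda>g l. hadj (salpha U g A l)) (\<lambda>l. hadj (salpha U g A l)) (at g within dil_poincare)"
  proof (rule uniform_limitI)
    fix e :: real assume "e > 0"
    with A(2) g have "\<forall>\<^sub>F h in at g within dil_poincare. \<forall>l\<in>{0<..}. dist (salpha U h A l) (salpha U g A l) < e"
      by (auto simp: alpha_continuous_def dest!: uniform_limitD)
    then show "\<forall>\<^sub>F h in at g within dil_poincare. \<forall>l\<in>{0<..}. dist (hadj (salpha U h A l)) (hadj (salpha U g A l)) < e"
      using eventually_dil_poincare
    proof eventually_elim
      fix h assume le: "\<forall>l\<in>{0<..}. dist (salpha U h A l) (salpha U g A l) < e" and h: "h \<in> dil_poincare"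
      show "\<forall>l\<in>{0<..}. dist (hadj (salpha U h A l)) (hadj (salpha U g A l)) < e"
      proof
        fix l :: real assume "l \<in> {0<..}"
        with le have "norm (salpha U h A l - salpha U g A l) < e"
          by (simp add: dist_norm)
        moreover have "hadj (salpha U h A l) - hadj (salpha U g A l) = hadj (salpha U h A l - salpha U g A l)"
          by (simp add: hadj_diff salpha_bounded_ops A g h)
        ultimately show "dist (hadj (salpha U h A l)) (hadj (salpha U g A l)) < e"
          using norm_hadj_le[of "salpha U h A l - salpha U g A l"] A g h
          by (simp add: dist_norm salpha_bounded_ops bounded_ops_closed)
      qed
    qed
  qed
qed

lemma alpha_continuous_scalar:
  assumes "\<And>g :: real \<times> 's poinc. g \<in> dil_poincare \<Longrightarrow>
    uniform_limit {0<..} (\<lambda>h l. f (l * fst h)) (\<lambda>l. f (l * fst g)) (at g within dil_poincare)"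
  shows "alpha_continuous (\<lambda>l. scalar_op (f l))"
proof (rule alpha_continuous_cong[OF salpha_scalar])
  fix g :: "real \<times> 's poinc" assume g: "g \<in> dil_poincare"
  show "uniform_limit {0<..} (\<lambda>g l. scalar_op (f (l * fst g)) :: 'h oper) (\<lambda>l. scalar_op (f (l * fst g)))
      (at g within dil_poincare)"
  proof (rule uniform_limitI)
    fix e :: real assume "e > 0"
    from uniform_limitD[OF assms[OF g] this]
    show "\<forall>\<^sub>F h in at g within dil_poincare. \<forall>l\<in>{0<..}.
        dist (scalar_op (f (l * fst h)) :: 'h oper) (scalar_op (f (l * fst g))) < e"
    proof eventually_elim
      fix h :: "real \<times> 's poinc" assume le: "\<forall>l\<in>{0<..}. dist (f (l * fst h)) (f (l * fst g)) < e"
      show "\<forall>l\<in>{0<..}. dist (scalar_op (f (l * fst h)) :: 'h oper) (scalar_op (f (l * fst g))) < e"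
        using le by (auto simp: dist_norm scalar_op_diff intro: order_le_less_trans[OF norm_scalar_op_le])
    qed
  qed
qed

section \<open>Local algebras of scaling functions\<close>

lemma algebra_scaled:
  assumes "region R" "0 < l"
  shows "von_neumann_algebra (\<AA> ((\<lambda>x. l *\<^sub>R x) ` R))"
  by (rule algebra[OF region_scaling[OF assms]])

lemma slocal_mono:
  assumes "region R1" "region R2" "R1 \<subseteq> R2"
  shows "slocal \<AA> U R1 \<subseteq> slocal \<AA> U R2"
proof
  fix A assume A: "A \<in> slocal \<AA> U R1"
  have "\<AA> ((\<lambda>x. l *\<^sub>R x) ` R1) \<subseteq> \<AA> ((\<lambda>x. l *\<^sub>R x) ` R2)" if "0 < l" for l
    using assms that by (intro isotony region_scaling image_mono)
  with A show "A \<in> slocal \<AA> U R2"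
    unfolding slocal_iff by blast
qed

lemma slocal_closed:
  assumes R: "region R" and A: "A \<in> slocal \<AA> U R"
  shows slocal_sadj: "sadj A \<in> slocal \<AA> U R"
    and slocal_sadd: "B \<in> slocal \<AA> U R \<Longrightarrow> sadd A B \<in> slocal \<AA> U R"
    and slocal_sprod: "B \<in> slocal \<AA> U R \<Longrightarrow> sprod A B \<in> slocal \<AA> U R"
proof -
  note vN = von_neumann_algebra_closed[OF algebra_scaled[OF R]]
  show "sadj A \<in> slocal \<AA> U R"
    using A unfolding slocal_iff by (auto simp: sbounded_sadj alpha_continuous_sadj) (simp add: sadj_def vN)
  show "sadd A B \<in> slocal \<AA> U R" if "B \<in> slocal \<AA> U R"
    using A that unfolding slocal_iff by (auto simp: sbounded_sadd alpha_continuous_sadd) (simp add: sadd_def vN)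
  show "sprod A B \<in> slocal \<AA> U R" if "B \<in> slocal \<AA> U R"
    using A that unfolding slocal_iff by (auto simp: sbounded_sprod alpha_continuous_sprod) (simp add: sprod_def vN)
qed

text \<open>Scalars lie in every von Neumann algebra, so locality is automatic in any region.
  Conjugation by a unitary fixes them, so continuity concerns the dilation factor alone.\<close>

lemma slocal_scalar:
  assumes "region R" "\<And>l. cmod (f l) \<le> K" "\<And>l. l \<le> 0 \<Longrightarrow> f l = 0"
    and "\<And>g :: real \<times> 's poinc. g \<in> dil_poincare \<Longrightarrow>
      uniform_limit {0<..} (\<lambda>h l. f (l * fst h)) (\<lambda>l. f (l * fst g)) (at g within dil_poincare)"
  shows "(\<lambda>l. scalar_op (f l)) \<in> slocal \<AA> U R"
  unfolding slocal_iff
  using sbounded_scalar[of f K] alpha_continuous_scalar[of f] assms(2-4)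
    von_neumann_algebra_closed(5)[OF algebra_scaled[OF assms(1)]] by blast

lemma norm_vacuum_cinner_le: "cmod (cinner \<Omega> (blinfun_apply T \<Omega>)) \<le> norm T"
  using norm_cinner_le[of \<Omega> "blinfun_apply T \<Omega>"] norm_blinfun[of T \<Omega>] by (simp add: vacuum_normalized)

text \<open>The vacuum expectation is a contraction and, by invariance of the vacuum, intertwines
  the action on \<open>A\<close> with the shift of the scale. It thus inherits norm continuity from
  \<open>A\<close>.\<close>

lemma slocal_vacuum_map:
  assumes R: "region R" and A: "A \<in> slocal \<AA> U R"
  shows "vacuum_map \<Omega> A \<in> slocal \<AA> U R"
  unfolding vacuum_map_def
proof -
  let ?f = "\<lambda>l. cinner \<Omega> (blinfun_apply (A l) \<Omega>)"
  note A = A[unfolded slocal_iff]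
  obtain K where K: "\<And>l. norm (A l) \<le> K"
    by (rule sboundedE[of A]) (use A in auto)
  show "(\<lambda>l. scalar_op (?f l)) \<in> slocal \<AA> U R"
  proof (rule slocal_scalar[OF R])
    show "cmod (?f l) \<le> K" for l
      by (rule order.trans[OF norm_vacuum_cinner_le K])
    show "?f l = 0" if "l \<le> 0" for l
      using A that by (simp add: sboundedD)
    fix g :: "real \<times> 's poinc" assume g: "g \<in> dil_poincare"
    show "uniform_limit {0<..} (\<lambda>h l. ?f (l * fst h)) (\<lambda>l. ?f (l * fst g)) (at g within dil_poincare)"
    proof (rule uniform_limitI)
      fix e :: real assume "e > 0"
      with A g have "\<forall>\<^sub>F h in at g within dil_poincare. \<forall>l\<in>{0<..}. dist (salpha U h A l) (salpha U g A l) < e"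
        by (auto simp: alpha_continuous_def dest!: uniform_limitD)
      then show "\<forall>\<^sub>F h in at g within dil_poincare. \<forall>l\<in>{0<..}. dist (?f (l * fst h)) (?f (l * fst g)) < e"
        using eventually_dil_poincare
      proof eventually_elim
        fix h assume le: "\<forall>l\<in>{0<..}. dist (salpha U h A l) (salpha U g A l) < e" and h: "h \<in> dil_poincare"
        show "\<forall>l\<in>{0<..}. dist (?f (l * fst h)) (?f (l * fst g)) < e"
        proof
          fix l :: real assume "l \<in> {0<..}"
          with le have "norm (salpha U h A l - salpha U g A l) < e"
            by (simp add: dist_norm)
          moreover have "?f (l * fst h) - ?f (l * fst g) = cinner \<Omega> (blinfun_apply (salpha U h A l - salpha U g A l) \<Omega>)"
            by (simp add: cinner_salpha[symmetric] g h blinfun.diff_left cinner_diff_right)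
          ultimately show "dist (?f (l * fst h)) (?f (l * fst g)) < e"
            using norm_vacuum_cinner_le[of "salpha U h A l - salpha U g A l"] by (simp add: dist_norm)
        qed
      qed
    qed
  qed
qed

section \<open>The quasilocal scaling algebra and its scalar elements\<close>

abbreviation X :: "'h sfun set" where "X \<equiv> scaling_algebra \<AA> U"

text \<open>Pointwise bounds replace the supremum. They may be demanded at every real
  \<open>l\<close> because scaling functions vanish at nonpositive scales.\<close>

lemma scaling_algebra_iff:
  "A \<in> X \<longleftrightarrow> A \<in> sbounded \<and> (\<forall>e>0. \<exists>R. region R \<and> (\<exists>B\<in>slocal \<AA> U R. \<forall>l. norm (A l - B l) \<le> e))"
proof (cases "A \<in> sbounded")
  case A: True
  have "(\<exists>R. region R \<and> (\<exists>B\<in>slocal \<AA> U R. snorm (\<lambda>l. A l - B l) < e))"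
    if "\<forall>e>0. \<exists>R. region R \<and> (\<exists>B\<in>slocal \<AA> U R. \<forall>l. norm (A l - B l) \<le> e)" "e > 0" for e
  proof -
    from that(2) have "e / 2 > 0"
      by simp
    with that(1) obtain R B where RB: "region R" "B \<in> slocal \<AA> U R" "\<And>l. norm (A l - B l) \<le> e / 2"
      by blast
    have "snorm (\<lambda>l. A l - B l) \<le> e / 2"
      unfolding snorm_def using RB(3) by (intro cSUP_least) auto
    then have "snorm (\<lambda>l. A l - B l) < e"
      using that(2) by linarith
    then show ?thesis
      using RB by blast
  qed
  moreover have "\<exists>R. region R \<and> (\<exists>B\<in>slocal \<AA> U R. \<forall>l. norm (A l - B l) \<le> e)"
    if "\<forall>e>0. \<exists>R. region R \<and> (\<exists>B\<in>slocal \<AA> U R. snorm (\<lambda>l. A l - B l) < e)" "e > 0" for e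
  proof -
    from that obtain R B where RB: "region R" "B \<in> slocal \<AA> U R" "snorm (\<lambda>l. A l - B l) < e"
      by blast
    then have B: "B \<in> sbounded"
      by (simp add: slocal_iff)
    obtain K where K: "\<And>l. norm (A l) \<le> K"
      using A by (rule sboundedE) blast
    obtain L where L: "\<And>l. norm (B l) \<le> L"
      using B by (rule sboundedE) blast
    have "norm (A l - B l) \<le> e" for l
    proof (cases "0 < l")
      case True
      have "bdd_above ((\<lambda>l. norm (A l - B l)) ` {0<..})"
      proof (rule bdd_aboveI2)
        show "norm (A l - B l) \<le> K + L" for l
          using norm_triangle_ineq4[of "A l" "B l"] K[of l] L[of l] by linarith
      qed
      then have "norm (A l - B l) \<le> snorm (\<lambda>l. A l - B l)"
        unfolding snorm_def using True by (intro cSUP_upper) simp_all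
      then show ?thesis
        using RB(3) by linarith
    next
      case False
      then show ?thesis
        using A B that(2) by (simp add: sboundedD)
    qed
    then show ?thesis
      using RB by blast
  qed
  ultimately show ?thesis
    using A unfolding scaling_algebra_def by blast
qed (simp add: scaling_algebra_def)

lemma scaling_algebra_sbounded: "A \<in> X \<Longrightarrow> A \<in> sbounded"
  by (simp add: scaling_algebra_iff)

text \<open>Regions have no prescribed shape, so the union of two is again a region, and isotony
  moves both approximants into it.\<close>

lemma scaling_algebra_approx2:
  assumes "A \<in> X" "B \<in> X" "e > 0"
  obtains R A' B' where "region R" "A' \<in> slocal \<AA> U R" "B' \<in> slocal \<AA> U R"
    "\<And>l. norm (A l - A' l) \<le> e" "\<And>l. norm (B l - B' l) \<le> e"
proof -
  obtain R1 A' where A': "region R1" "A' \<in> slocal \<AA> U R1" "\<And>l. norm (A l - A' l) \<le> e"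
    using assms(1,3) unfolding scaling_algebra_iff by blast
  obtain R2 B' where B': "region R2" "B' \<in> slocal \<AA> U R2" "\<And>l. norm (B l - B' l) \<le> e"
    using assms(2,3) unfolding scaling_algebra_iff by blast
  show ?thesis
    using slocal_mono[OF A'(1) region_Un[OF A'(1) B'(1)]] slocal_mono[OF B'(1) region_Un[OF A'(1) B'(1)]] A' B'
    by (intro that[of "R1 \<union> R2" A' B'] region_Un) auto
qed

lemma slocal_subset_scaling_algebra:
  assumes "region R" "A \<in> slocal \<AA> U R"
  shows "A \<in> X"
  unfolding scaling_algebra_iff
proof (intro conjI allI impI)
  show "A \<in> sbounded"
    using assms by (simp add: slocal_iff)
  fix e :: real assume "e > 0"
  then show "\<exists>R. region R \<and> (\<exists>B\<in>slocal \<AA> U R. \<forall>l. norm (A l - B l) \<le> e)"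
    using assms by (intro exI[of _ R]) (auto intro!: bexI[of _ A])
qed

lemma scaling_algebra_sadd:
  assumes "A \<in> X" "B \<in> X"
  shows "sadd A B \<in> X"
  unfolding scaling_algebra_iff
proof (intro conjI allI impI)
  show "sadd A B \<in> sbounded"
    using assms by (intro sbounded_sadd scaling_algebra_sbounded)
  fix e :: real assume "e > 0"
  then have "e / 2 > 0"
    by simp
  then obtain R A' B' where R: "region R" and slocal: "A' \<in> slocal \<AA> U R" "B' \<in> slocal \<AA> U R"
    and le: "\<And>l. norm (A l - A' l) \<le> e / 2" "\<And>l. norm (B l - B' l) \<le> e / 2"
    by (rule scaling_algebra_approx2[OF assms]) blast
  have "norm (sadd A B l - sadd A' B' l) \<le> e" for l
    using norm_triangle_ineq[of "A l - A' l" "B l - B' l"] le[of l] by (simp add: sadd_def algebra_simps)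
  then show "\<exists>R. region R \<and> (\<exists>C\<in>slocal \<AA> U R. \<forall>l. norm (sadd A B l - C l) \<le> e)"
    using R slocal_sadd[OF R slocal] by blast
qed

lemma scaling_algebra_sprod:
  assumes "A \<in> X" "B \<in> X"
  shows "sprod A B \<in> X"
  unfolding scaling_algebra_iff
proof (intro conjI allI impI)
  show "sprod A B \<in> sbounded"
    using assms by (intro sbounded_sprod scaling_algebra_sbounded)
  obtain K where K: "\<And>l. norm (A l) \<le> K" "0 \<le> K"
    using scaling_algebra_sbounded[OF assms(1)] by (rule sboundedE) blast
  obtain L where L: "\<And>l. norm (B l) \<le> L" "0 \<le> L"
    using scaling_algebra_sbounded[OF assms(2)] by (rule sboundedE) blast
  fix e :: real assume e: "e > 0"
  \<comment> \<open>The quotient makes the final bound \<open>K * d + d * (L + 1)\<close> at most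
    \<open>e\<close>; the minimum with 1 ensures that the approximant \<open>B'\<close> is bounded
    by \<open>L + 1\<close>.\<close>
  define d where "d = min 1 (e / (K + L + 1))"
  have d: "d > 0" "d \<le> 1" "d * (K + L + 1) \<le> e"
  proof -
    have "d \<le> e / (K + L + 1)"
      by (simp add: d_def)
    then show "d * (K + L + 1) \<le> e"
      using K L by (simp add: pos_le_divide_eq)
  qed (use e K L in \<open>auto simp: d_def\<close>)
  obtain R A' B' where R: "region R" and slocal: "A' \<in> slocal \<AA> U R" "B' \<in> slocal \<AA> U R"
    and le: "\<And>l. norm (A l - A' l) \<le> d" "\<And>l. norm (B l - B' l) \<le> d"
    by (rule scaling_algebra_approx2[OF assms d(1)]) blast
  have "norm (sprod A B l - sprod A' B' l) \<le> e" for l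
  proof -
    have "norm (B' l) \<le> L + d"
      using norm_triangle_ineq4[of "B l" "B l - B' l"] L(1)[of l] le(2)[of l] by simp
    then have B': "norm (B' l) \<le> L + 1"
      using d(2) by linarith
    have "sprod A B l - sprod A' B' l = (A l o\<^sub>L (B l - B' l)) + ((A l - A' l) o\<^sub>L B' l)"
      unfolding sprod_def by (rule blinfun_eqI) (simp add: blinfun.diff_left blinfun.add_left blinfun.diff_right)
    then have "norm (sprod A B l - sprod A' B' l) \<le> norm (A l o\<^sub>L (B l - B' l)) + norm ((A l - A' l) o\<^sub>L B' l)"
      by (simp add: norm_triangle_ineq)
    also have "\<dots> \<le> norm (A l) * norm (B l - B' l) + norm (A l - A' l) * norm (B' l)"
      by (intro add_mono norm_blinfun_compose)
    also have "\<dots> \<le> K * d + d * (L + 1)"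
      using K L d le B' by (intro add_mono mult_mono) simp_all
    also have "\<dots> \<le> e"
      using d(3) by (simp add: algebra_simps)
    finally show ?thesis .
  qed
  then show "\<exists>R. region R \<and> (\<exists>C\<in>slocal \<AA> U R. \<forall>l. norm (sprod A B l - C l) \<le> e)"
    using R slocal_sprod[OF R slocal] by blast
qed

lemma scaling_algebra_sadj:
  assumes "A \<in> X"
  shows "sadj A \<in> X"
  unfolding scaling_algebra_iff
proof (intro conjI allI impI)
  show "sadj A \<in> sbounded"
    using assms by (intro sbounded_sadj scaling_algebra_sbounded)
  fix e :: real assume e: "e > 0"
  obtain R B where R: "region R" "B \<in> slocal \<AA> U R" and le: "\<And>l. norm (A l - B l) \<le> e"
    using assms e unfolding scaling_algebra_iff by blast
  have "norm (sadj A l - sadj B l) \<le> e" for l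
  proof -
    have AB: "A l \<in> bounded_ops" "B l \<in> bounded_ops"
      using assms R(2) by (auto simp: scaling_algebra_iff slocal_iff sboundedD)
    then have "sadj A l - sadj B l = hadj (A l - B l)"
      by (simp add: sadj_def hadj_diff)
    then show ?thesis
      using norm_hadj_le[of "A l - B l"] AB le[of l] by (simp add: bounded_ops_closed)
  qed
  then show "\<exists>R. region R \<and> (\<exists>C\<in>slocal \<AA> U R. \<forall>l. norm (sadj A l - C l) \<le> e)"
    using R slocal_sadj[OF R] by blast
qed

lemma scaling_algebra_vacuum_map:
  assumes "A \<in> X"
  shows "vacuum_map \<Omega> A \<in> X"
  unfolding scaling_algebra_iff
proof (intro conjI allI impI)
  obtain K where K: "\<And>l. norm (A l) \<le> K"
    using scaling_algebra_sbounded[OF assms] by (rule sboundedE) blast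
  show "vacuum_map \<Omega> A \<in> sbounded"
    unfolding vacuum_map_def
    by (rule sbounded_scalar[of _ K])
      (use scaling_algebra_sbounded[OF assms] in \<open>auto simp: sboundedD intro: order.trans[OF norm_vacuum_cinner_le K]\<close>)
  fix e :: real assume e: "e > 0"
  obtain R B where R: "region R" "B \<in> slocal \<AA> U R" and le: "\<And>l. norm (A l - B l) \<le> e"
    using assms e unfolding scaling_algebra_iff by blast
  have "norm (vacuum_map \<Omega> A l - vacuum_map \<Omega> B l) \<le> e" for l
  proof -
    have "vacuum_map \<Omega> A l - vacuum_map \<Omega> B l = scalar_op (cinner \<Omega> (blinfun_apply (A l - B l) \<Omega>))"
      by (simp add: vacuum_map_def scalar_op_diff blinfun.diff_left cinner_diff_right)
    also have "norm \<dots> \<le> norm (A l - B l)"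
      by (rule order.trans[OF norm_scalar_op_le norm_vacuum_cinner_le])
    finally show ?thesis
      using le[of l] by linarith
  qed
  then show "\<exists>R. region R \<and> (\<exists>C\<in>slocal \<AA> U R. \<forall>l. norm (vacuum_map \<Omega> A l - C l) \<le> e)"
    using R slocal_vacuum_map[OF R] by blast
qed

text \<open>The cut at nonpositive scales is forced by the representation of functions on the
  positive half-line. Dilation factors are positive, so the action does not see it.\<close>

lemma scaling_algebra_const: "(\<lambda>l. scalar_op (if 0 < l then c else 0)) \<in> X"
proof (rule slocal_subset_scaling_algebra)
  show R: "region (ball 0 1 :: 's mink set)"
    by (simp add: region_def)
  show "(\<lambda>l. scalar_op (if 0 < l then c else 0)) \<in> slocal \<AA> U (ball 0 1)"
  proof (rule slocal_scalar[OF R, where K = "cmod c"])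
    fix g :: "real \<times> 's poinc" assume g: "g \<in> dil_poincare"
    have pos: "0 < fst h" if "h \<in> dil_poincare" for h :: "real \<times> 's poinc"
      using that by (auto simp: dil_poincare_def)
    show "uniform_limit {0<..} (\<lambda>h l. if 0 < l * fst h then c else 0) (\<lambda>l. if 0 < l * fst g then c else 0)
        (at g within dil_poincare)"
    proof (rule uniform_limitI)
      fix e :: real assume "e > 0"
      then show "\<forall>\<^sub>F h in at g within dil_poincare. \<forall>l\<in>{0<..}.
          dist (if 0 < l * fst h then c else 0) (if 0 < l * fst g then c else 0) < e"
        using eventually_dil_poincare[of g] by (elim eventually_mono) (simp add: pos g)
    qed
  qed simp_all
qed

lemma scaling_algebra_sone: "sone \<in> X"
proof -
  have *: "sone = (\<lambda>l. scalar_op (if 0 < l then 1 else 0) :: 'h oper)"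
    by (auto simp: sone_def)
  show ?thesis
    unfolding * by (rule scaling_algebra_const)
qed

lemma scaling_algebra_sscale:
  assumes "A \<in> X"
  shows "sscale c A \<in> X"
proof -
  \<comment> \<open>Scalar multiplication becomes a product inside the algebra; the cut-off constant
    does no harm because \<open>A\<close> vanishes at nonpositive scales.\<close>
  have *: "sscale c A = sprod (\<lambda>l. scalar_op (if 0 < l then c else 0)) A"
    using sboundedD(2)[OF scaling_algebra_sbounded[OF assms]] by (auto simp: sscale_def sprod_def)
  show ?thesis
    unfolding * by (rule scaling_algebra_sprod[OF scaling_algebra_const assms])
qed

lemma scalar_scaling_center:
  assumes "(\<lambda>l. scalar_op (f l)) \<in> X"
  shows "(\<lambda>l. scalar_op (f l)) \<in> scaling_center \<AA> U"
  using assms unfolding scaling_center_def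
  by (auto simp: sprod_def scalar_op_commute sboundedD scaling_algebra_sbounded)

text \<open>Normalisation of the vacuum makes \<open>vacuum_map\<close> a projection onto scalar
  functions. On those a limit state therefore coincides with its mean.\<close>

lemma vacuum_map_scalar: "vacuum_map \<Omega> (\<lambda>l. scalar_op (f l)) = (\<lambda>l. scalar_op (f l))"
  by (simp add: vacuum_map_def cinner_scaleC_right cinner_self vacuum_normalized)

text \<open>
  Instead of showing that central elements are multiples of \<open>1\<close>, replace any \<open>A\<close> by the
  scalar function \<open>vacuum_map \<Omega> A\<close>, on which a multiplicative limit state takes the same value.
\<close>

lemma multiplicative_limit_state_vacuum_map:
  assumes w: "multiplicative_limit_state \<AA> U \<Omega> w" and A: "A \<in> X"
  defines "D \<equiv> vacuum_map \<Omega> A"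
  shows "w D = w A" "w (sprod (sadj D) D) = w (sadj D) * w D"
proof -
  obtain m where mult: "multiplicative_mean (scaling_center \<AA> U) m"
    and m: "\<And>A. A \<in> X \<Longrightarrow> w A = m (vacuum_map \<Omega> A)"
    using w by (auto simp: multiplicative_limit_state_def)
  obtain f where f: "D = (\<lambda>l. scalar_op (f l))"
    by (simp add: D_def vacuum_map_def)
  have adj: "sadj D = (\<lambda>l. scalar_op (cnj (f l)))"
    by (simp add: f sadj_def)
  have prod: "sprod (sadj D) D = (\<lambda>l. scalar_op (cnj (f l) * f l))"
    unfolding adj unfolding f by (simp add: sprod_def scalar_op_compose)
  have DX: "D \<in> X"
    unfolding D_def by (rule scaling_algebra_vacuum_map[OF A])
  have adjX: "sadj D \<in> X" and prodX: "sprod (sadj D) D \<in> X"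
    by (intro scaling_algebra_sadj scaling_algebra_sprod DX)+
  have centre: "D \<in> scaling_center \<AA> U" "sadj D \<in> scaling_center \<AA> U"
    using scalar_scaling_center[of f] scalar_scaling_center[of "\<lambda>l. cnj (f l)"] DX adjX
    unfolding adj unfolding f by blast+
  have wD: "w D = m D"
    using m[OF DX] by (simp add: f vacuum_map_scalar)
  then show "w D = w A"
    using m[OF A] by (simp add: D_def)
  have "w (sprod (sadj D) D) = m (sprod (sadj D) D)"
    using m[OF prodX] by (simp add: prod vacuum_map_scalar)
  also have "\<dots> = m (sadj D) * m D"
    using mult centre unfolding multiplicative_mean_def by blast
  also have "m (sadj D) = w (sadj D)"
    using m[OF adjX] by (simp add: adj vacuum_map_scalar)
  finally show "w (sprod (sadj D) D) = w (sadj D) * w D"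
    by (simp add: wD)
qed

end

section \<open>Hilbert spaces with explicit carriers\<close>

lemma complex_ring_simps [simp]:
  "carrier complex_ring = UNIV" "mult complex_ring = (*)" "one complex_ring = 1"
  "zero complex_ring = 0" "add complex_ring = (+)"
  by (simp_all add: complex_ring_def)

context hilbert_space
begin

lemma smult_closed' [simp, intro]: "x \<in> carrier H \<Longrightarrow> c \<odot>\<^bsub>H\<^esub> x \<in> carrier H"
  by (rule smult_closed) simp_all

lemma smult_1 [simp]: "x \<in> carrier H \<Longrightarrow> 1 \<odot>\<^bsub>H\<^esub> x = x"
  using smult_one by simp

lemma smult_0 [simp]: "x \<in> carrier H \<Longrightarrow> 0 \<odot>\<^bsub>H\<^esub> x = \<zero>\<^bsub>H\<^esub>"
  using smult_l_null by simp

lemma smult_add_left: "x \<in> carrier H \<Longrightarrow> (a + b) \<odot>\<^bsub>H\<^esub> x = a \<odot>\<^bsub>H\<^esub> x \<oplus>\<^bsub>H\<^esub> b \<odot>\<^bsub>H\<^esub> x"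
  using smult_l_distr[of a b x] by simp

lemma smult_add_right:
  "x \<in> carrier H \<Longrightarrow> y \<in> carrier H \<Longrightarrow> a \<odot>\<^bsub>H\<^esub> (x \<oplus>\<^bsub>H\<^esub> y) = a \<odot>\<^bsub>H\<^esub> x \<oplus>\<^bsub>H\<^esub> a \<odot>\<^bsub>H\<^esub> y"
  using smult_r_distr[of a x y] by simp

lemma smult_smult: "x \<in> carrier H \<Longrightarrow> a \<odot>\<^bsub>H\<^esub> (b \<odot>\<^bsub>H\<^esub> x) = (a * b) \<odot>\<^bsub>H\<^esub> x"
  using smult_assoc1[of a b x] by simp

lemma minus_eq_smult:
  assumes "x \<in> carrier H" "y \<in> carrier H"
  shows "x \<ominus>\<^bsub>H\<^esub> y = x \<oplus>\<^bsub>H\<^esub> (-1) \<odot>\<^bsub>H\<^esub> y"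
proof -
  have "(-1) \<odot>\<^bsub>H\<^esub> y \<oplus>\<^bsub>H\<^esub> y = \<zero>\<^bsub>H\<^esub>"
    using smult_add_left[of y "-1" 1] assms by simp
  then have "\<ominus>\<^bsub>H\<^esub> y = (-1) \<odot>\<^bsub>H\<^esub> y"
    using assms by (intro M.minus_equality) auto
  then show ?thesis
    by (simp add: M.minus_eq)
qed

lemma minus_self [simp]: "x \<in> carrier H \<Longrightarrow> x \<ominus>\<^bsub>H\<^esub> x = \<zero>\<^bsub>H\<^esub>"
  by (simp add: M.minus_eq M.r_neg)

lemma eq_if_minus_zero:
  assumes "x \<in> carrier H" "y \<in> carrier H" "x \<ominus>\<^bsub>H\<^esub> y = \<zero>\<^bsub>H\<^esub>"
  shows "x = y"
  using assms by (metis M.minus_eq M.minus_equality M.minus_minus M.a_inv_closed)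

lemma minus_add_minus:
  assumes "x \<in> carrier H" "y \<in> carrier H" "z \<in> carrier H"
  shows "(x \<ominus>\<^bsub>H\<^esub> y) \<oplus>\<^bsub>H\<^esub> (y \<ominus>\<^bsub>H\<^esub> z) = x \<ominus>\<^bsub>H\<^esub> z"
  using assms by (simp add: M.minus_eq M.a_assoc M.r_neg2[of "y", symmetric] M.r_neg1)

lemma add_minus_add:
  assumes "x \<in> carrier H" "y \<in> carrier H" "x' \<in> carrier H" "y' \<in> carrier H"
  shows "(x \<oplus>\<^bsub>H\<^esub> y) \<ominus>\<^bsub>H\<^esub> (x' \<oplus>\<^bsub>H\<^esub> y') = (x \<ominus>\<^bsub>H\<^esub> x') \<oplus>\<^bsub>H\<^esub> (y \<ominus>\<^bsub>H\<^esub> y')"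
  using assms by (simp add: M.minus_eq M.minus_add M.a_ac)

lemma smult_minus_smult:
  assumes "x \<in> carrier H" "y \<in> carrier H"
  shows "c \<odot>\<^bsub>H\<^esub> x \<ominus>\<^bsub>H\<^esub> c \<odot>\<^bsub>H\<^esub> y = c \<odot>\<^bsub>H\<^esub> (x \<ominus>\<^bsub>H\<^esub> y)"
  using assms by (simp add: minus_eq_smult smult_add_right smult_smult mult.commute)

lemma smult_minus_left:
  assumes "x \<in> carrier H"
  shows "c \<odot>\<^bsub>H\<^esub> x \<ominus>\<^bsub>H\<^esub> d \<odot>\<^bsub>H\<^esub> x = (c - d) \<odot>\<^bsub>H\<^esub> x"
  using assms by (simp add: minus_eq_smult smult_smult flip: smult_add_left)

lemma hinner_add_left:
  assumes "x \<in> carrier H" "y \<in> carrier H" "z \<in> carrier H"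
  shows "hinner H (x \<oplus>\<^bsub>H\<^esub> y) z = hinner H x z + hinner H y z"
  using assms hinner_commute[of z "x \<oplus>\<^bsub>H\<^esub> y"] hinner_commute[of z x] hinner_commute[of z y]
  by (simp add: hinner_add)

lemma hinner_smult_left:
  assumes "x \<in> carrier H" "y \<in> carrier H"
  shows "hinner H (c \<odot>\<^bsub>H\<^esub> x) y = cnj c * hinner H x y"
  using assms hinner_commute[of y "c \<odot>\<^bsub>H\<^esub> x"] hinner_commute[of y x] by (simp add: hinner_smult)

lemma hnorm_nonneg [simp]: "x \<in> carrier H \<Longrightarrow> 0 \<le> hnorm H x"
  using hinner_nonneg[of x] by (simp add: hnorm_def complex_nonneg_Reals_iff)

lemma hnorm_sq: "x \<in> carrier H \<Longrightarrow> (hnorm H x)\<^sup>2 = Re (hinner H x x)"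
  using hinner_nonneg[of x] by (simp add: hnorm_def complex_nonneg_Reals_iff)

lemma hinner_self: "x \<in> carrier H \<Longrightarrow> hinner H x x = complex_of_real ((hnorm H x)\<^sup>2)"
  using hinner_nonneg[of x] unfolding hnorm_sq by (simp add: complex_nonneg_Reals_iff complex_eq_iff)

lemma hnorm_eq_0_iff: "x \<in> carrier H \<Longrightarrow> hnorm H x = 0 \<longleftrightarrow> x = \<zero>\<^bsub>H\<^esub>"
  using hinner_self[of x] hinner_definite[of x] hinner_smult[of "\<zero>\<^bsub>H\<^esub>" "\<zero>\<^bsub>H\<^esub>" 0]
  by (auto simp: hnorm_def)

lemma hnorm_zero [simp]: "hnorm H \<zero>\<^bsub>H\<^esub> = 0"
  by (simp add: hnorm_eq_0_iff)

lemma hnorm_smult: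
  assumes "x \<in> carrier H"
  shows "hnorm H (c \<odot>\<^bsub>H\<^esub> x) = cmod c * hnorm H x"
proof -
  have "complex_of_real ((hnorm H (c \<odot>\<^bsub>H\<^esub> x))\<^sup>2) = (c * cnj c) * complex_of_real ((hnorm H x)\<^sup>2)"
    using assms by (simp add: hinner_self[symmetric] hinner_smult hinner_smult_left del: of_real_power)
  also have "\<dots> = complex_of_real ((cmod c * hnorm H x)\<^sup>2)"
    by (simp only: complex_norm_square[symmetric] power_mult_distrib of_real_mult)
  finally have "(hnorm H (c \<odot>\<^bsub>H\<^esub> x))\<^sup>2 = (cmod c * hnorm H x)\<^sup>2"
    by (simp only: of_real_eq_iff)
  then show ?thesis
    using assms by (simp add: power2_eq_iff_nonneg)
qed

lemma hnorm_sq_add_smult: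
  assumes "x \<in> carrier H" "y \<in> carrier H"
  shows "complex_of_real ((hnorm H (c \<odot>\<^bsub>H\<^esub> x \<oplus>\<^bsub>H\<^esub> y))\<^sup>2) =
    cnj c * c * complex_of_real ((hnorm H x)\<^sup>2) + complex_of_real ((hnorm H y)\<^sup>2)
      + cnj c * hinner H x y + c * cnj (hinner H x y)"
  using assms hinner_commute[of x y]
  by (simp add: hinner_self[symmetric] hinner_smult hinner_smult_left hinner_add hinner_add_left
      algebra_simps del: of_real_power)

text \<open>Weighting the expansion of the squared norm by the fourth roots of unity cancels
  everything except the inner product. The factor 1 is left in place so that all four terms are
  instances of one pattern when they are integrated.\<close>

lemma polarization:
  assumes "x \<in> carrier H" "y \<in> carrier H"
  shows "hinner H x y =
    (complex_of_real ((hnorm H (1 \<odot>\<^bsub>H\<^esub> x \<oplus>\<^bsub>H\<^esub> y))\<^sup>2) - complex_of_real ((hnorm H ((-1) \<odot>\<^bsub>H\<^esub> x \<oplus>\<^bsub>H\<^esub> y))\<^sup>2)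
      + \<i> * complex_of_real ((hnorm H (\<i> \<odot>\<^bsub>H\<^esub> x \<oplus>\<^bsub>H\<^esub> y))\<^sup>2)
      - \<i> * complex_of_real ((hnorm H ((-\<i>) \<odot>\<^bsub>H\<^esub> x \<oplus>\<^bsub>H\<^esub> y))\<^sup>2)) / 4"
  unfolding hnorm_sq_add_smult[OF assms] by (simp add: algebra_simps)

lemma Re_hinner_le:
  assumes "x \<in> carrier H" "y \<in> carrier H"
  shows "Re (hinner H x y) \<le> hnorm H x * hnorm H y"
proof (cases "hnorm H x = 0")
  case True
  then have "x = \<zero>\<^bsub>H\<^esub>"
    using assms by (simp add: hnorm_eq_0_iff)
  then have "hinner H x y = 0"
    using assms hinner_smult_left[of "\<zero>\<^bsub>H\<^esub>" y 0] by simp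
  then show ?thesis
    using True by simp
next
  case False
  define n where "n = hnorm H x"
  have n: "n > 0"
    using False assms by (simp add: n_def order_less_le)
  \<comment> \<open>This real \<open>t\<close> minimises the norm of \<open>t\<close> times
    \<open>x\<close> plus \<open>y\<close>.\<close>
  define t where "t = - Re (hinner H x y) / n\<^sup>2"
  have "0 \<le> (hnorm H (complex_of_real t \<odot>\<^bsub>H\<^esub> x \<oplus>\<^bsub>H\<^esub> y))\<^sup>2"
    by simp
  also have "\<dots> = t\<^sup>2 * n\<^sup>2 + (hnorm H y)\<^sup>2 + 2 * t * Re (hinner H x y)"
    using arg_cong[OF hnorm_sq_add_smult[OF assms, of "complex_of_real t"], of Re]
    by (simp add: power2_eq_square n_def)
  also have "\<dots> = (hnorm H y)\<^sup>2 - (Re (hinner H x y))\<^sup>2 / n\<^sup>2"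
    using n by (simp add: t_def power2_eq_square)
  finally have "(Re (hinner H x y))\<^sup>2 \<le> (hnorm H y)\<^sup>2 * n\<^sup>2"
    using n by (simp add: pos_divide_le_eq)
  then have "(Re (hinner H x y))\<^sup>2 \<le> (n * hnorm H y)\<^sup>2"
    by (simp add: power_mult_distrib mult.commute)
  then show ?thesis
    unfolding n_def by (rule power2_le_imp_le) (use assms in simp)
qed

lemma hnorm_triangle:
  assumes "x \<in> carrier H" "y \<in> carrier H"
  shows "hnorm H (x \<oplus>\<^bsub>H\<^esub> y) \<le> hnorm H x + hnorm H y"
proof (rule power2_le_imp_le)
  have "(hnorm H (x \<oplus>\<^bsub>H\<^esub> y))\<^sup>2 = (hnorm H x)\<^sup>2 + (hnorm H y)\<^sup>2 + 2 * Re (hinner H x y)"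
    using arg_cong[OF hnorm_sq_add_smult[OF assms, of 1], of Re] assms by (simp add: power2_eq_square)
  also have "\<dots> \<le> (hnorm H x + hnorm H y)\<^sup>2"
    using Re_hinner_le[OF assms] by (simp add: power2_sum)
  finally show "(hnorm H (x \<oplus>\<^bsub>H\<^esub> y))\<^sup>2 \<le> (hnorm H x + hnorm H y)\<^sup>2" .
qed (use assms in simp)

lemma hnorm_minus_commute:
  assumes "x \<in> carrier H" "y \<in> carrier H"
  shows "hnorm H (x \<ominus>\<^bsub>H\<^esub> y) = hnorm H (y \<ominus>\<^bsub>H\<^esub> x)"
proof -
  have "x \<ominus>\<^bsub>H\<^esub> y = (-1) \<odot>\<^bsub>H\<^esub> (y \<ominus>\<^bsub>H\<^esub> x)"
    using assms by (simp add: minus_eq_smult smult_add_right smult_smult M.a_comm)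
  then show ?thesis
    using assms by (simp add: hnorm_smult)
qed

lemma hnorm_minus_triangle:
  assumes "x \<in> carrier H" "y \<in> carrier H" "z \<in> carrier H"
  shows "hnorm H (x \<ominus>\<^bsub>H\<^esub> z) \<le> hnorm H (x \<ominus>\<^bsub>H\<^esub> y) + hnorm H (y \<ominus>\<^bsub>H\<^esub> z)"
  using hnorm_triangle[of "x \<ominus>\<^bsub>H\<^esub> y" "y \<ominus>\<^bsub>H\<^esub> z"] assms by (simp add: minus_add_minus)

lemma hnorm_le_hnorm_add_hnorm_minus:
  assumes "x \<in> carrier H" "y \<in> carrier H"
  shows "hnorm H x \<le> hnorm H y + hnorm H (x \<ominus>\<^bsub>H\<^esub> y)"
proof -
  have "hnorm H (x \<ominus>\<^bsub>H\<^esub> \<zero>\<^bsub>H\<^esub>) \<le> hnorm H (x \<ominus>\<^bsub>H\<^esub> y) + hnorm H (y \<ominus>\<^bsub>H\<^esub> \<zero>\<^bsub>H\<^esub>)"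
    using assms by (intro hnorm_minus_triangle) simp_all
  then show ?thesis
    using assms by (simp add: minus_eq_smult)
qed

lemma tendsto_hnorm:
  assumes X: "\<And>n. X n \<in> carrier H" and x: "x \<in> carrier H"
    and lim: "(\<lambda>n. hnorm H (X n \<ominus>\<^bsub>H\<^esub> x)) \<longlonglongrightarrow> 0"
  shows "(\<lambda>n. hnorm H (X n)) \<longlonglongrightarrow> hnorm H x"
proof (rule Lim_null[THEN iffD2], rule Lim_null_comparison[OF _ lim], rule always_eventually, rule allI)
  fix n
  show "norm (hnorm H (X n) - hnorm H x) \<le> hnorm H (X n \<ominus>\<^bsub>H\<^esub> x)"
    using hnorm_le_hnorm_add_hnorm_minus[OF X x, of n] hnorm_le_hnorm_add_hnorm_minus[OF x X, of n]
      hnorm_minus_commute[OF X x, of n] by simp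
qed

lemma tendsto_add_carrier:
  assumes "\<And>n. X n \<in> carrier H" "x \<in> carrier H" "\<And>n. Y n \<in> carrier H" "y \<in> carrier H"
    and "(\<lambda>n. hnorm H (X n \<ominus>\<^bsub>H\<^esub> x)) \<longlonglongrightarrow> 0" "(\<lambda>n. hnorm H (Y n \<ominus>\<^bsub>H\<^esub> y)) \<longlonglongrightarrow> 0"
  shows "(\<lambda>n. hnorm H ((X n \<oplus>\<^bsub>H\<^esub> Y n) \<ominus>\<^bsub>H\<^esub> (x \<oplus>\<^bsub>H\<^esub> y))) \<longlonglongrightarrow> 0"
proof (rule Lim_null_comparison[OF _ tendsto_add_zero[OF assms(5,6)]], rule always_eventually, rule allI)
  fix n
  show "norm (hnorm H ((X n \<oplus>\<^bsub>H\<^esub> Y n) \<ominus>\<^bsub>H\<^esub> (x \<oplus>\<^bsub>H\<^esub> y))) \<le> hnorm H (X n \<ominus>\<^bsub>H\<^esub> x) + hnorm H (Y n \<ominus>\<^bsub>H\<^esub> y)"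
    using assms(1-4) hnorm_triangle[of "X n \<ominus>\<^bsub>H\<^esub> x" "Y n \<ominus>\<^bsub>H\<^esub> y"] by (simp add: add_minus_add)
qed

lemma tendsto_smult_carrier:
  assumes "\<And>n. X n \<in> carrier H" "x \<in> carrier H" "(\<lambda>n. hnorm H (X n \<ominus>\<^bsub>H\<^esub> x)) \<longlonglongrightarrow> 0"
  shows "(\<lambda>n. hnorm H (c \<odot>\<^bsub>H\<^esub> X n \<ominus>\<^bsub>H\<^esub> c \<odot>\<^bsub>H\<^esub> x)) \<longlonglongrightarrow> 0"
  using tendsto_mult_right_zero[OF assms(3), of "cmod c"] assms(1,2)
  by (simp add: smult_minus_smult hnorm_smult)

text \<open>Telescoping bounds distances by tails of the series. Summability of the increments is
  the form in which completeness of the fibres is used almost everywhere.\<close>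

lemma complete_summable:
  assumes X: "\<And>n. X n \<in> carrier H" and sum: "summable (\<lambda>n. hnorm H (X (Suc n) \<ominus>\<^bsub>H\<^esub> X n))"
  shows "\<exists>x\<in>carrier H. (\<lambda>n. hnorm H (X n \<ominus>\<^bsub>H\<^esub> x)) \<longlonglongrightarrow> 0"
proof (rule complete[OF X], intro allI impI)
  have le: "hnorm H (X (m + k) \<ominus>\<^bsub>H\<^esub> X m) \<le> (\<Sum>i=m..<m+k. hnorm H (X (Suc i) \<ominus>\<^bsub>H\<^esub> X i))" for m k
  proof (induction k)
    case (Suc k)
    show ?case
      using hnorm_minus_triangle[of "X (Suc (m + k))" "X (m + k)" "X m"] X Suc by simp
  qed (simp add: X)
  fix e :: real assume "e > 0"
  from summable_Cauchy[THEN iffD1, OF sum, rule_format, OF this] obtain N where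
    N: "\<And>m n. m \<ge> N \<Longrightarrow> norm (\<Sum>i=m..<n. hnorm H (X (Suc i) \<ominus>\<^bsub>H\<^esub> X i)) < e"
    by blast
  have *: "hnorm H (X n \<ominus>\<^bsub>H\<^esub> X m) < e" if "m \<ge> N" "m \<le> n" for m n
    using le[of m "n - m"] N[OF that(1), of n] that(2) by simp
  show "\<exists>N. \<forall>m\<ge>N. \<forall>n\<ge>N. hnorm H (X m \<ominus>\<^bsub>H\<^esub> X n) < e"
  proof (intro exI allI impI)
    fix m n assume "m \<ge> N" "n \<ge> N"
    then show "hnorm H (X m \<ominus>\<^bsub>H\<^esub> X n) < e"
      using *[of m n] *[of n m] hnorm_minus_commute[OF X X, of m n] by (cases "m \<le> n") auto
  qed
qed

end

lemma (in hilbert_space) tendsto_imp_Cauchy: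
  assumes X: "\<And>n. X n \<in> carrier H" and x: "x \<in> carrier H"
    and lim: "(\<lambda>n. hnorm H (X n \<ominus>\<^bsub>H\<^esub> x)) \<longlonglongrightarrow> 0"
  shows "\<forall>e>0. \<exists>N. \<forall>m\<ge>N. \<forall>n\<ge>N. hnorm H (X m \<ominus>\<^bsub>H\<^esub> X n) < e"
proof (intro allI impI)
  fix e :: real assume "e > 0"
  then have "0 < e / 2"
    by simp
  from order_tendstoD(2)[OF lim this] obtain N where N: "\<And>n. n \<ge> N \<Longrightarrow> hnorm H (X n \<ominus>\<^bsub>H\<^esub> x) < e / 2"
    by (auto simp: eventually_sequentially)
  have "hnorm H (X m \<ominus>\<^bsub>H\<^esub> X n) < e" if "m \<ge> N" "n \<ge> N" for m n
    using hnorm_minus_triangle[OF X x X, of m n] hnorm_minus_commute[OF x X, of n] N[OF that(1)] N[OF that(2)]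
    by linarith
  then show "\<exists>N. \<forall>m\<ge>N. \<forall>n\<ge>N. hnorm H (X m \<ominus>\<^bsub>H\<^esub> X n) < e"
    by blast
qed

text \<open>Every axiom is pulled back along \<open>V\<close>, including completeness. For the
  direct integral this replaces a verification on classes and their chosen representatives.\<close>

lemma hilbert_space_transport:
  assumes H: "hilbert_space H" and bij: "bij_betw V (carrier H) (carrier K)"
    and zero: "V \<zero>\<^bsub>H\<^esub> = \<zero>\<^bsub>K\<^esub>"
    and add: "\<And>x y. x \<in> carrier H \<Longrightarrow> y \<in> carrier H \<Longrightarrow> V (x \<oplus>\<^bsub>H\<^esub> y) = V x \<oplus>\<^bsub>K\<^esub> V y"
    and smult: "\<And>c x. x \<in> carrier H \<Longrightarrow> V (c \<odot>\<^bsub>H\<^esub> x) = c \<odot>\<^bsub>K\<^esub> V x"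
    and inner: "\<And>x y. x \<in> carrier H \<Longrightarrow> y \<in> carrier H \<Longrightarrow> hinner K (V x) (V y) = hinner H x y"
  shows "hilbert_space K"
proof -
  interpret H: hilbert_space H by (rule H)
  have carrier: "carrier K = V ` carrier H"
    using bij by (simp add: bij_betw_def)
  have V: "\<And>x. x \<in> carrier H \<Longrightarrow> V x \<in> carrier K"
    by (simp add: carrier)
  have K: "Module.module complex_ring K"
  proof (rule moduleI)
    show "abelian_group K"
    proof (rule abelian_groupI)
      fix x assume "x \<in> carrier K"
      then obtain x' where x': "x = V x'" "x' \<in> carrier H"
        by (auto simp: carrier)
      then have "V (\<ominus>\<^bsub>H\<^esub> x') \<oplus>\<^bsub>K\<^esub> x = \<zero>\<^bsub>K\<^esub>"
        by (simp add: add[symmetric] H.M.l_neg zero)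
      then show "\<exists>y\<in>carrier K. y \<oplus>\<^bsub>K\<^esub> x = \<zero>\<^bsub>K\<^esub>"
        using V x' by (meson H.M.a_inv_closed)
    qed (auto simp: carrier add[symmetric] zero[symmetric] H.M.a_ac)
  qed (auto simp: H.R.cring_axioms carrier add[symmetric] smult[symmetric] H.smult_add_left
      H.smult_add_right H.smult_smult)
  interpret K: Module.module complex_ring K by (rule K)
  have minus: "V (x \<ominus>\<^bsub>H\<^esub> y) = V x \<ominus>\<^bsub>K\<^esub> V y" if "x \<in> carrier H" "y \<in> carrier H" for x y
  proof -
    have "V (\<ominus>\<^bsub>H\<^esub> y) \<oplus>\<^bsub>K\<^esub> V y = \<zero>\<^bsub>K\<^esub>"
      using that by (simp add: add[symmetric] H.M.l_neg zero)
    then have "\<ominus>\<^bsub>K\<^esub> V y = V (\<ominus>\<^bsub>H\<^esub> y)"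
      using that V by (intro K.M.minus_equality) auto
    then show ?thesis
      using that by (simp add: H.M.minus_eq K.M.minus_eq add)
  qed
  have norm: "hnorm K (V x) = hnorm H x" if "x \<in> carrier H" for x
    using that by (simp add: hnorm_def inner)
  show ?thesis
  proof (intro hilbert_space.intro K hilbert_space_axioms.intro)
    fix X :: "nat \<Rightarrow> _"
    assume "\<And>n. X n \<in> carrier K"
    then have "\<forall>n. \<exists>x. x \<in> carrier H \<and> X n = V x"
      by (auto simp: carrier)
    then obtain Y where Y: "\<And>n. Y n \<in> carrier H" "\<And>n. X n = V (Y n)"
      by metis
    assume "\<forall>e>0. \<exists>N. \<forall>m\<ge>N. \<forall>n\<ge>N. hnorm K (X m \<ominus>\<^bsub>K\<^esub> X n) < e"
    then have "\<forall>e>0. \<exists>N. \<forall>m\<ge>N. \<forall>n\<ge>N. hnorm H (Y m \<ominus>\<^bsub>H\<^esub> Y n) < e"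
      by (simp add: Y minus[symmetric] norm)
    from H.complete[OF Y(1) this] obtain y where
      "y \<in> carrier H" "(\<lambda>n. hnorm H (Y n \<ominus>\<^bsub>H\<^esub> y)) \<longlonglongrightarrow> 0"
      by blast
    then show "\<exists>x\<in>carrier K. (\<lambda>n. hnorm K (X n \<ominus>\<^bsub>K\<^esub> x)) \<longlonglongrightarrow> 0"
      by (intro bexI[of _ "V y"]) (simp_all add: Y minus[symmetric] norm V)
  next
    fix x y assume "x \<in> carrier K" "y \<in> carrier K"
    then show "hinner K y x = cnj (hinner K x y)"
      by (auto simp: carrier inner intro: H.hinner_commute)
  next
    fix x assume "x \<in> carrier K" "hinner K x x = 0"
    then show "x = \<zero>\<^bsub>K\<^esub>"
      by (auto simp: carrier inner zero[symmetric] dest: H.hinner_definite)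
  qed (auto simp: carrier inner add[symmetric] smult[symmetric] H.hinner_add H.hinner_smult H.hinner_nonneg)
qed

section \<open>Completed Borel measures\<close>

lemma borel_measurable_completion_cong_AE:
  fixes f g :: "'a \<Rightarrow> 'b::topological_space"
  assumes f: "f \<in> borel_measurable (completion M)" and ae: "AE x in completion M. f x = g x"
  shows "g \<in> borel_measurable (completion M)"
proof (rule measurableI)
  fix A :: "'b set" assume A: "A \<in> sets borel"
  show "g -` A \<inter> space (completion M) \<in> sets (completion M)"
  proof (rule completion.in_sets_AE)
    show "f -` A \<inter> space (completion M) \<in> sets (completion M)"
      using f A by (rule measurable_sets)
    show "AE x in completion M. x \<in> f -` A \<inter> space (completion M) \<longleftrightarrow> x \<in> g -` A \<inter> space (completion M)"
      using ae by eventually_elim simp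
  qed simp
qed simp

text \<open>Cutting all functions off to 0 where convergence fails gives convergence everywhere. The
  change happens on a null set, and in the completion it can be undone.\<close>

lemma borel_measurable_completion_AE_LIMSEQ:
  fixes f :: "nat \<Rightarrow> 'a \<Rightarrow> 'b::real_normed_vector"
  assumes f: "\<And>n. f n \<in> borel_measurable (completion M)"
    and lim: "AE x in completion M. (\<lambda>n. f n x) \<longlonglongrightarrow> g x"
  shows "g \<in> borel_measurable (completion M)"
proof -
  let ?h = "\<lambda>n x. if (\<lambda>n. f n x) \<longlonglongrightarrow> g x then f n x else 0"
  let ?g = "\<lambda>x. if (\<lambda>n. f n x) \<longlonglongrightarrow> g x then g x else 0"
  have "?g \<in> borel_measurable (completion M)"
  proof (rule borel_measurable_LIMSEQ_metric[of ?h])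
    fix n
    show "?h n \<in> borel_measurable (completion M)"
      by (rule borel_measurable_completion_cong_AE[OF f[of n]]) (use lim in eventually_elim, simp)
  qed simp
  then show ?thesis
    by (rule borel_measurable_completion_cong_AE) (use lim in eventually_elim, simp)
qed

lemma has_bochner_integral_completion:
  fixes f :: "'a \<Rightarrow> 'b::{banach, second_countable_topology}"
  assumes "has_bochner_integral M f x"
  shows "has_bochner_integral (completion M) f x"
  using assms borel_measurable_integrable[of M f]
  by (simp add: has_bochner_integral_iff integrable_completion integral_completion)

text \<open>Measurability of the limit is part of what is obtained, which is essential when
  \<open>g\<close> is the squared norm of a field known only as an almost everywhere limit.\<close>

lemma fatou_completion:
  fixes F :: "nat \<Rightarrow> 'a \<Rightarrow> real"
  assumes F: "\<And>n. integrable (completion M) (F n)" "\<And>n x. 0 \<le> F n x" and g: "\<And>x. 0 \<le> g x"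
    and lim: "AE x in completion M. (\<lambda>n. F n x) \<longlonglongrightarrow> g x"
    and c: "(\<lambda>n. \<integral>x. F n x \<partial>completion M) \<longlonglongrightarrow> c"
  shows "integrable (completion M) g" "(\<integral>x. g x \<partial>completion M) \<le> c"
proof -
  have g_meas: "g \<in> borel_measurable (completion M)"
    by (rule borel_measurable_completion_AE_LIMSEQ[OF borel_measurable_integrable[OF F(1)] lim])
  have c0: "0 \<le> c"
    using c by (rule LIMSEQ_le_const) (auto intro!: integral_nonneg_AE F(2))
  have "(\<integral>\<^sup>+x. g x \<partial>completion M) = (\<integral>\<^sup>+x. liminf (\<lambda>n. ennreal (F n x)) \<partial>completion M)"
  proof (rule nn_integral_cong_AE, use lim in eventually_elim)
    fix x assume "(\<lambda>n. F n x) \<longlonglongrightarrow> g x"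
    then have "(\<lambda>n. ennreal (F n x)) \<longlonglongrightarrow> ennreal (g x)"
      by (rule tendsto_ennrealI)
    then show "ennreal (g x) = liminf (\<lambda>n. ennreal (F n x))"
      by (rule lim_imp_Liminf[symmetric, rotated]) simp
  qed
  also have "\<dots> \<le> liminf (\<lambda>n. \<integral>\<^sup>+x. F n x \<partial>completion M)"
    using F(1) by (intro nn_integral_liminf) auto
  also have "\<dots> = liminf (\<lambda>n. ennreal (\<integral>x. F n x \<partial>completion M))"
    using F by (simp add: nn_integral_eq_integral)
  also have "\<dots> = ennreal c"
    by (rule lim_imp_Liminf[OF _ tendsto_ennrealI[OF c]]) simp
  finally have le: "(\<integral>\<^sup>+x. g x \<partial>completion M) \<le> ennreal c" .
  show int: "integrable (completion M) g"
    using g_meas g le by (intro integrableI_nonneg) (auto simp: order_le_less_trans[OF le])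
  have "ennreal (\<integral>x. g x \<partial>completion M) \<le> ennreal c"
    using le int g by (simp add: nn_integral_eq_integral)
  then show "(\<integral>x. g x \<partial>completion M) \<le> c"
    using c0 by simp
qed

text \<open>Outer and inner regularity contribute \<open>e / 2\<close> each.\<close>

lemma regular_borel_approx:
  fixes \<nu> :: "'z::t2_space measure"
  assumes "prob_space \<nu>" "regular_borel \<nu>" "B \<in> sets borel" "e > 0"
  obtains K W where "compact K" "open W" "K \<subseteq> B" "B \<subseteq> W" "measure \<nu> (W - K) < e"
proof -
  interpret prob_space \<nu> by fact
  have sets[simp]: "sets \<nu> = sets borel"
    using assms(2) by (simp add: regular_borel_def)
  have B: "emeasure \<nu> B = (INF W\<in>{W. open W \<and> B \<subseteq> W}. emeasure \<nu> W)"
    "emeasure \<nu> B = (SUP K\<in>{K. compact K \<and> K \<in> sets borel \<and> K \<subseteq> B}. emeasure \<nu> K)"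
    using assms(2,3) unfolding regular_borel_def by blast+
  have "(INF W\<in>{W. open W \<and> B \<subseteq> W}. emeasure \<nu> W) < ennreal (measure \<nu> B + e / 2)"
    unfolding B(1)[symmetric] using assms(4) by (simp add: emeasure_eq_measure ennreal_less_iff)
  then obtain W where W: "open W" "B \<subseteq> W" "emeasure \<nu> W < ennreal (measure \<nu> B + e / 2)"
    by (auto simp: INF_less_iff)
  obtain K where K: "compact K" "K \<in> sets borel" "K \<subseteq> B" "measure \<nu> B < measure \<nu> K + e / 2"
  \<comment> \<open>For small measure the empty set serves as \<open>K\<close>; otherwise the lower
    bound \<open>measure \<nu> B - e / 2\<close> is nonnegative and can be compared in the extended
    reals without truncation.\<close>
  proof (cases "measure \<nu> B < e / 2")
    case True
    then show ?thesis
      by (intro that[of "{}"]) auto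
  next
    case False
    then have "ennreal (measure \<nu> B - e / 2) < emeasure \<nu> B"
      using assms(4) by (simp add: emeasure_eq_measure ennreal_less_iff)
    then obtain K where "compact K" "K \<in> sets borel" "K \<subseteq> B" "ennreal (measure \<nu> B - e / 2) < emeasure \<nu> K"
      unfolding B(2) by (auto simp: less_SUP_iff)
    then show ?thesis
      using False by (intro that[of K]) (auto simp: emeasure_eq_measure ennreal_less_iff)
  qed
  have "measure \<nu> W < measure \<nu> B + e / 2"
    using W(3) assms(4) by (simp add: emeasure_eq_measure ennreal_less_iff del: ennreal_plus)
  moreover have "measure \<nu> (W - K) = measure \<nu> W - measure \<nu> K"
    using W K by (intro finite_measure_Diff) auto
  ultimately show ?thesis
    using K W by (intro that[of K W]) auto
qed

text \<open>A compact Hausdorff space is normal, so Urysohn separates \<open>K\<close> from the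
  complement of \<open>W\<close>.\<close>

lemma continuous_indicator_approx:
  fixes K W :: "'z::t2_space set"
  assumes "compact (UNIV :: 'z set)" "compact K" "open W" "K \<subseteq> W"
  obtains g :: "'z \<Rightarrow> real" where "continuous_on UNIV g" "\<And>z. 0 \<le> g z" "\<And>z. g z \<le> 1"
    "\<And>z. z \<in> K \<Longrightarrow> g z = 1" "\<And>z. z \<notin> W \<Longrightarrow> g z = 0"
proof -
  have "Hausdorff_space (euclidean :: 'z topology)"
    unfolding Hausdorff_space_def by (auto simp: disjnt_def dest!: hausdorff)
  then have "normal_space (euclidean :: 'z topology)"
    using assms(1) by (intro compact_Hausdorff_or_regular_imp_normal_space) (auto simp: compact_space_def)
  then obtain g :: "'z \<Rightarrow> real" where g: "continuous_map euclidean (top_of_set {0..1}) g"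
      "g ` (- W) \<subseteq> {0}" "g ` K \<subseteq> {1}"
    using assms by (rule_tac Urysohn_lemma[of euclidean "- W" K 0 1])
      (auto simp: disjnt_def compact_imp_closed)
  then have "continuous_on UNIV g" "\<And>z. g z \<in> {0..1}"
    by (auto simp: continuous_map_in_subtopology)
  then show ?thesis
    using g by (intro that[of g]) auto
qed

section \<open>Direct integrals determined by an isometric graph\<close>

lemma saturated_familyD:
  assumes "saturated_family \<nu> H T"
  shows "\<eta> \<in> T \<Longrightarrow> \<eta> z \<in> carrier (H z)"
    and "\<eta> \<in> T \<Longrightarrow> \<xi> \<in> T \<Longrightarrow> (\<lambda>z. \<eta> z \<oplus>\<^bsub>H z\<^esub> \<xi> z) \<in> T"
    and "\<eta> \<in> T \<Longrightarrow> (\<lambda>z. c \<odot>\<^bsub>H z\<^esub> \<eta> z) \<in> T"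
    and "\<eta> \<in> T \<Longrightarrow> integrable (completion \<nu>) (\<lambda>z. (hnorm (H z) (\<eta> z))\<^sup>2)"
    and "\<eta> \<in> T \<Longrightarrow> (\<And>z. \<xi> z \<in> carrier (H z)) \<Longrightarrow> AE z in \<nu>. \<xi> z = \<eta> z \<Longrightarrow> \<xi> \<in> T"
    and "(\<And>n::nat. Y n \<in> T) \<Longrightarrow> \<forall>e>0. \<exists>N. \<forall>m\<ge>N. \<forall>n\<ge>N. di_dist \<nu> H (Y m) (Y n) < e \<Longrightarrow>
      \<exists>\<eta>\<in>T. (\<lambda>n. di_dist \<nu> H (Y n) \<eta>) \<longlonglongrightarrow> 0"
proof -
  note T = assms[unfolded saturated_family_def fundamental_family_def product_subspace_def]
  show "\<eta> \<in> T \<Longrightarrow> \<eta> z \<in> carrier (H z)"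
    using T by blast
  show "\<eta> \<in> T \<Longrightarrow> \<xi> \<in> T \<Longrightarrow> (\<lambda>z. \<eta> z \<oplus>\<^bsub>H z\<^esub> \<xi> z) \<in> T"
    "\<eta> \<in> T \<Longrightarrow> (\<lambda>z. c \<odot>\<^bsub>H z\<^esub> \<eta> z) \<in> T"
    "\<eta> \<in> T \<Longrightarrow> integrable (completion \<nu>) (\<lambda>z. (hnorm (H z) (\<eta> z))\<^sup>2)"
    using T by simp_all
  have *: "\<forall>\<eta>\<in>T. \<forall>\<xi>\<in>(\<Pi> z\<in>UNIV. carrier (H z)). (AE z in \<nu>. \<xi> z = \<eta> z) \<longrightarrow> \<xi> \<in> T"
    using T by (elim conjE)
  show "\<eta> \<in> T \<Longrightarrow> (\<And>z. \<xi> z \<in> carrier (H z)) \<Longrightarrow> AE z in \<nu>. \<xi> z = \<eta> z \<Longrightarrow> \<xi> \<in> T"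
    by (rule *[rule_format]) auto
  have **: "\<forall>X::nat \<Rightarrow> _. (\<forall>n. X n \<in> T) \<longrightarrow>
        (\<forall>e>0. \<exists>N. \<forall>m\<ge>N. \<forall>n\<ge>N. di_dist \<nu> H (X m) (X n) < e) \<longrightarrow>
        (\<exists>\<eta>\<in>T. (\<lambda>n. di_dist \<nu> H (X n) \<eta>) \<longlonglongrightarrow> 0)"
    using T by (elim conjE)
  show "(\<And>n::nat. Y n \<in> T) \<Longrightarrow> \<forall>e>0. \<exists>N. \<forall>m\<ge>N. \<forall>n\<ge>N. di_dist \<nu> H (Y m) (Y n) < e \<Longrightarrow>
      \<exists>\<eta>\<in>T. (\<lambda>n. di_dist \<nu> H (Y n) \<eta>) \<longlonglongrightarrow> 0"
    by (rule **[THEN spec, THEN mp, THEN mp]) auto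
qed

text \<open>
  A pair \<open>(x, \<eta>) \<in> G\<close> stands for a vector \<open>x\<close> of a dense subspace of \<open>H0\<close> and the family
  \<open>\<eta>\<close> of vectors that represents it in the direct integral.
\<close>

locale isometric_graph = prob_space \<nu>
  for \<nu> :: "'z::t2_space measure" +
  fixes H0 :: "'u hspace" and H :: "'z \<Rightarrow> 'v hspace" and G :: "('u \<times> ('z \<Rightarrow> 'v)) set"
  assumes compact_UNIV: "compact (UNIV :: 'z set)"
    and regular: "regular_borel \<nu>"
    and hilbert_H0: "hilbert_space H0"
    and hilbert_H: "hilbert_space (H z)"
    and G_carrier: "(x, \<eta>) \<in> G \<Longrightarrow> x \<in> carrier H0" "(x, \<eta>) \<in> G \<Longrightarrow> \<eta> z \<in> carrier (H z)"
    and G_add: "(x, \<eta>) \<in> G \<Longrightarrow> (y, \<xi>) \<in> G \<Longrightarrow> (x \<oplus>\<^bsub>H0\<^esub> y, \<lambda>z. \<eta> z \<oplus>\<^bsub>H z\<^esub> \<xi> z) \<in> G"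
    and G_smult: "(x, \<eta>) \<in> G \<Longrightarrow> (c \<odot>\<^bsub>H0\<^esub> x, \<lambda>z. c \<odot>\<^bsub>H z\<^esub> \<eta> z) \<in> G"
    and G_dense: "x \<in> carrier H0 \<Longrightarrow> e > 0 \<Longrightarrow> \<exists>(y, \<eta>)\<in>G. hnorm H0 (x \<ominus>\<^bsub>H0\<^esub> y) < e"
    and G_norm: "(x, \<eta>) \<in> G \<Longrightarrow>
      has_bochner_integral (completion \<nu>) (\<lambda>z. (hnorm (H z) (\<eta> z))\<^sup>2) ((hnorm H0 x)\<^sup>2)"
    and G_mult: "continuous_on UNIV f \<Longrightarrow> (x, \<eta>) \<in> G \<Longrightarrow> \<exists>y. (y, \<lambda>z. f z \<odot>\<^bsub>H z\<^esub> \<eta> z) \<in> G"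
begin

sublocale H0: hilbert_space H0 by (rule hilbert_H0)
sublocale H: hilbert_space "H z" for z by (rule hilbert_H)

abbreviation M :: "'z measure" where "M \<equiv> completion \<nu>"

lemma sets_\<nu> [simp]: "sets \<nu> = sets borel"
  using regular by (simp add: regular_borel_def)

lemma space_\<nu> [simp]: "space \<nu> = UNIV"
  using sets_eq_imp_space_eq[OF sets_\<nu>] by simp

section \<open>The closure of the graph and its isometry\<close>

lemma G_diff:
  assumes "(x, \<eta>) \<in> G" "(y, \<xi>) \<in> G"
  shows "(x \<ominus>\<^bsub>H0\<^esub> y, \<lambda>z. \<eta> z \<ominus>\<^bsub>H z\<^esub> \<xi> z) \<in> G"
  using G_add[OF assms(1) G_smult[OF assms(2), of "-1"]] G_carrier[OF assms(1)] G_carrier[OF assms(2)]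
  by (simp add: H0.minus_eq_smult H.minus_eq_smult)

text \<open>The second limit is pointwise almost everywhere because the seminorm of a difference
  with an unrestricted field could be the default value of a non-integrable function. Integrability
  of related fields is a consequence.\<close>

definition rel :: "'u \<Rightarrow> ('z \<Rightarrow> 'v) \<Rightarrow> bool" where
  "rel x \<eta> \<longleftrightarrow> x \<in> carrier H0 \<and> (\<forall>z. \<eta> z \<in> carrier (H z)) \<and>
    (\<exists>X Y. (\<forall>n. (X n, Y n) \<in> G) \<and> (\<lambda>n. hnorm H0 (X n \<ominus>\<^bsub>H0\<^esub> x)) \<longlonglongrightarrow> 0 \<and>
      (AE z in M. (\<lambda>n. hnorm (H z) (Y n z \<ominus>\<^bsub>H z\<^esub> \<eta> z)) \<longlonglongrightarrow> 0))"

lemma relI: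
  assumes "x \<in> carrier H0" "\<And>z. \<eta> z \<in> carrier (H z)" "\<And>n. (X n, Y n) \<in> G"
    "(\<lambda>n. hnorm H0 (X n \<ominus>\<^bsub>H0\<^esub> x)) \<longlonglongrightarrow> 0" "AE z in M. (\<lambda>n. hnorm (H z) (Y n z \<ominus>\<^bsub>H z\<^esub> \<eta> z)) \<longlonglongrightarrow> 0"
  shows "rel x \<eta>"
  using assms unfolding rel_def by blast

lemma rel_carrier [simp]:
  "rel x \<eta> \<Longrightarrow> x \<in> carrier H0" "rel x \<eta> \<Longrightarrow> \<eta> z \<in> carrier (H z)"
  by (simp_all add: rel_def)

lemma rel_G: "(x, \<eta>) \<in> G \<Longrightarrow> rel x \<eta>"
  by (rule relI[of _ _ "\<lambda>_. x" "\<lambda>_. \<eta>"]) (simp_all add: G_carrier)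

lemma rel_add:
  assumes "rel x \<eta>" "rel y \<xi>"
  shows "rel (x \<oplus>\<^bsub>H0\<^esub> y) (\<lambda>z. \<eta> z \<oplus>\<^bsub>H z\<^esub> \<xi> z)"
proof -
  obtain X Y where
    X: "\<And>n. (X n, Y n) \<in> G" "(\<lambda>n. hnorm H0 (X n \<ominus>\<^bsub>H0\<^esub> x)) \<longlonglongrightarrow> 0"
      "AE z in M. (\<lambda>n. hnorm (H z) (Y n z \<ominus>\<^bsub>H z\<^esub> \<eta> z)) \<longlonglongrightarrow> 0"
    using assms(1) unfolding rel_def by blast
  obtain X' Y' where
    X': "\<And>n. (X' n, Y' n) \<in> G" "(\<lambda>n. hnorm H0 (X' n \<ominus>\<^bsub>H0\<^esub> y)) \<longlonglongrightarrow> 0"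
      "AE z in M. (\<lambda>n. hnorm (H z) (Y' n z \<ominus>\<^bsub>H z\<^esub> \<xi> z)) \<longlonglongrightarrow> 0"
    using assms(2) unfolding rel_def by blast
  note c = G_carrier[OF X(1)] G_carrier[OF X'(1)]
  show ?thesis
  proof (rule relI[of _ _ "\<lambda>n. X n \<oplus>\<^bsub>H0\<^esub> X' n" "\<lambda>n z. Y n z \<oplus>\<^bsub>H z\<^esub> Y' n z"])
    show "(\<lambda>n. hnorm H0 ((X n \<oplus>\<^bsub>H0\<^esub> X' n) \<ominus>\<^bsub>H0\<^esub> (x \<oplus>\<^bsub>H0\<^esub> y))) \<longlonglongrightarrow> 0"
      by (rule H0.tendsto_add_carrier) (use assms c X X' in simp_all)
    show "AE z in M. (\<lambda>n. hnorm (H z) ((Y n z \<oplus>\<^bsub>H z\<^esub> Y' n z) \<ominus>\<^bsub>H z\<^esub> (\<eta> z \<oplus>\<^bsub>H z\<^esub> \<xi> z))) \<longlonglongrightarrow> 0"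
      using X(3) X'(3) by eventually_elim (rule H.tendsto_add_carrier, use assms c in simp_all)
  qed (use assms G_add[OF X(1) X'(1)] in simp_all)
qed

lemma rel_smult:
  assumes "rel x \<eta>"
  shows "rel (c \<odot>\<^bsub>H0\<^esub> x) (\<lambda>z. c \<odot>\<^bsub>H z\<^esub> \<eta> z)"
proof -
  from assms obtain X Y where
    X: "\<And>n. (X n, Y n) \<in> G" "(\<lambda>n. hnorm H0 (X n \<ominus>\<^bsub>H0\<^esub> x)) \<longlonglongrightarrow> 0"
      "AE z in M. (\<lambda>n. hnorm (H z) (Y n z \<ominus>\<^bsub>H z\<^esub> \<eta> z)) \<longlonglongrightarrow> 0"
    unfolding rel_def by blast
  show ?thesis
  proof (rule relI[of _ _ "\<lambda>n. c \<odot>\<^bsub>H0\<^esub> X n" "\<lambda>n z. c \<odot>\<^bsub>H z\<^esub> Y n z"])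
    show "(\<lambda>n. hnorm H0 (c \<odot>\<^bsub>H0\<^esub> X n \<ominus>\<^bsub>H0\<^esub> c \<odot>\<^bsub>H0\<^esub> x)) \<longlonglongrightarrow> 0"
      by (rule H0.tendsto_smult_carrier) (use assms G_carrier[OF X(1)] X in simp_all)
    show "AE z in M. (\<lambda>n. hnorm (H z) (c \<odot>\<^bsub>H z\<^esub> Y n z \<ominus>\<^bsub>H z\<^esub> c \<odot>\<^bsub>H z\<^esub> \<eta> z)) \<longlonglongrightarrow> 0"
      using X(3) by eventually_elim (rule H.tendsto_smult_carrier, use assms G_carrier[OF X(1)] in simp_all)
  qed (use assms G_smult[OF X(1)] in simp_all)
qed

lemma rel_diff:
  assumes "rel x \<eta>" "rel y \<xi>"
  shows "rel (x \<ominus>\<^bsub>H0\<^esub> y) (\<lambda>z. \<eta> z \<ominus>\<^bsub>H z\<^esub> \<xi> z)"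
  using rel_add[OF assms(1) rel_smult[OF assms(2), of "-1"]] assms
  by (simp add: H0.minus_eq_smult H.minus_eq_smult)

lemma rel_cong_AE:
  assumes "rel x \<eta>" "AE z in M. \<xi> z = \<eta> z" "\<And>z. \<xi> z \<in> carrier (H z)"
  shows "rel x \<xi>"
proof -
  from assms(1) obtain X Y where
    X: "\<And>n. (X n, Y n) \<in> G" "(\<lambda>n. hnorm H0 (X n \<ominus>\<^bsub>H0\<^esub> x)) \<longlonglongrightarrow> 0"
      "AE z in M. (\<lambda>n. hnorm (H z) (Y n z \<ominus>\<^bsub>H z\<^esub> \<eta> z)) \<longlonglongrightarrow> 0"
    unfolding rel_def by blast
  have "AE z in M. (\<lambda>n. hnorm (H z) (Y n z \<ominus>\<^bsub>H z\<^esub> \<xi> z)) \<longlonglongrightarrow> 0"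
    using assms(2) X(3) by eventually_elim simp
  then show ?thesis
    using assms X by (intro relI[of x \<xi> X Y]) simp_all
qed

lemma
  assumes "rel x \<eta>"
  shows rel_integrable: "integrable M (\<lambda>z. (hnorm (H z) (\<eta> z))\<^sup>2)"
    and rel_norm_le: "(\<integral>z. (hnorm (H z) (\<eta> z))\<^sup>2 \<partial>M) \<le> (hnorm H0 x)\<^sup>2"
proof -
  from assms obtain X Y where
    X: "\<And>n. (X n, Y n) \<in> G" "(\<lambda>n. hnorm H0 (X n \<ominus>\<^bsub>H0\<^esub> x)) \<longlonglongrightarrow> 0"
      "AE z in M. (\<lambda>n. hnorm (H z) (Y n z \<ominus>\<^bsub>H z\<^esub> \<eta> z)) \<longlonglongrightarrow> 0"
    unfolding rel_def by blast
  note c = G_carrier[OF X(1)]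
  have I: "integrable M (\<lambda>z. (hnorm (H z) (Y n z))\<^sup>2)"
      "(\<integral>z. (hnorm (H z) (Y n z))\<^sup>2 \<partial>M) = (hnorm H0 (X n))\<^sup>2" for n
    using G_norm[OF X(1)] by (auto simp: has_bochner_integral_iff)
  have 1: "AE z in M. (\<lambda>n. (hnorm (H z) (Y n z))\<^sup>2) \<longlonglongrightarrow> (hnorm (H z) (\<eta> z))\<^sup>2"
    using X(3) by eventually_elim (rule tendsto_power, rule H.tendsto_hnorm, use assms c in simp_all)
  have "(\<lambda>n. hnorm H0 (X n)) \<longlonglongrightarrow> hnorm H0 x"
    by (rule H0.tendsto_hnorm) (use assms c X in simp_all)
  then have 2: "(\<lambda>n. \<integral>z. (hnorm (H z) (Y n z))\<^sup>2 \<partial>M) \<longlonglongrightarrow> (hnorm H0 x)\<^sup>2"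
    unfolding I(2) by (rule tendsto_power)
  show "integrable M (\<lambda>z. (hnorm (H z) (\<eta> z))\<^sup>2)"
    by (rule fatou_completion(1)[OF I(1) _ _ 1 2]) simp_all
  show "(\<integral>z. (hnorm (H z) (\<eta> z))\<^sup>2 \<partial>M) \<le> (hnorm H0 x)\<^sup>2"
    by (rule fatou_completion(2)[OF I(1) _ _ 1 2]) simp_all
qed

text \<open>Mass might be lost in Fatou. By linearity the difference between an approximant and
  \<open>\<eta>\<close> is related to a vector of small norm, so the inequality already known bounds
  its integral and no mass escapes.\<close>

lemma rel_norm:
  assumes "rel x \<eta>"
  shows "(\<integral>z. (hnorm (H z) (\<eta> z))\<^sup>2 \<partial>M) = (hnorm H0 x)\<^sup>2"
proof (rule antisym[OF rel_norm_le[OF assms]])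
  define c where "c = (\<integral>z. (hnorm (H z) (\<eta> z))\<^sup>2 \<partial>M)"
  from assms obtain X Y where
    X: "\<And>n. (X n, Y n) \<in> G" "(\<lambda>n. hnorm H0 (X n \<ominus>\<^bsub>H0\<^esub> x)) \<longlonglongrightarrow> 0"
    unfolding rel_def by blast
  note car = G_carrier[OF X(1)] rel_carrier[OF assms]
  have le: "(hnorm H0 x)\<^sup>2 \<le> (1 + t) * c" if "t > 0" for t
  proof (rule LIMSEQ_le)
    show "(\<lambda>n. (hnorm H0 (X n))\<^sup>2) \<longlonglongrightarrow> (hnorm H0 x)\<^sup>2"
      by (intro tendsto_power H0.tendsto_hnorm) (use car X in simp_all)
    have "(\<lambda>n. (1 + t) * c + (1 + 1 / t) * (hnorm H0 (X n \<ominus>\<^bsub>H0\<^esub> x))\<^sup>2) \<longlonglongrightarrow> (1 + t) * c + (1 + 1 / t) * 0\<^sup>2"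
      by (intro tendsto_intros X)
    then show "(\<lambda>n. (1 + t) * c + (1 + 1 / t) * (hnorm H0 (X n \<ominus>\<^bsub>H0\<^esub> x))\<^sup>2) \<longlonglongrightarrow> (1 + t) * c"
      by simp
    have "(hnorm H0 (X n))\<^sup>2 \<le> (1 + t) * c + (1 + 1 / t) * (hnorm H0 (X n \<ominus>\<^bsub>H0\<^esub> x))\<^sup>2" for n
    proof -
      let ?D = "\<lambda>z. hnorm (H z) (Y n z \<ominus>\<^bsub>H z\<^esub> \<eta> z)"
      have D: "rel (X n \<ominus>\<^bsub>H0\<^esub> x) (\<lambda>z. Y n z \<ominus>\<^bsub>H z\<^esub> \<eta> z)"
        by (intro rel_diff rel_G X assms)
      have pt: "(hnorm (H z) (Y n z))\<^sup>2 \<le> (1 + t) * (hnorm (H z) (\<eta> z))\<^sup>2 + (1 + 1 / t) * (?D z)\<^sup>2" for z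
      proof -
        let ?a = "hnorm (H z) (\<eta> z)"
        have "(hnorm (H z) (Y n z))\<^sup>2 \<le> (?a + ?D z)\<^sup>2"
          using car by (intro power_mono H.hnorm_le_hnorm_add_hnorm_minus) simp_all
        \<comment> \<open>Expanding this square gives twice \<open>?a * ?D z\<close> at most
          \<open>t * ?a\<^sup>2 + (?D z)\<^sup>2 / t\<close>. The weighted bound replaces the
          triangle inequality for the seminorm, and \<open>t\<close> is sent to 0 at the
          end.\<close>
        also have "0 \<le> (t * ?a - ?D z)\<^sup>2 / t"
          using that by simp
        then have "(?a + ?D z)\<^sup>2 \<le> (1 + t) * ?a\<^sup>2 + (1 + 1 / t) * (?D z)\<^sup>2"
          using that by (simp add: power2_eq_square field_simps)
        finally show ?thesis .
      qed
      have "(hnorm H0 (X n))\<^sup>2 = (\<integral>z. (hnorm (H z) (Y n z))\<^sup>2 \<partial>M)"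
        using G_norm[OF X(1)] by (simp add: has_bochner_integral_iff)
      also have "\<dots> \<le> (\<integral>z. (1 + t) * (hnorm (H z) (\<eta> z))\<^sup>2 + (1 + 1 / t) * (?D z)\<^sup>2 \<partial>M)"
        using rel_integrable[OF assms] rel_integrable[OF D] rel_integrable[OF rel_G[OF X(1)]] pt
        by (intro integral_mono) simp_all
      also have "\<dots> = (1 + t) * c + (1 + 1 / t) * (\<integral>z. (?D z)\<^sup>2 \<partial>M)"
        using rel_integrable[OF assms] rel_integrable[OF D] by (simp add: c_def)
      also have "\<dots> \<le> (1 + t) * c + (1 + 1 / t) * (hnorm H0 (X n \<ominus>\<^bsub>H0\<^esub> x))\<^sup>2"
        using that rel_norm_le[OF D] by (intro add_left_mono mult_left_mono) simp_all
      finally show ?thesis .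
    qed
    then show "\<exists>N. \<forall>n\<ge>N. (hnorm H0 (X n))\<^sup>2 \<le> (1 + t) * c + (1 + 1 / t) * (hnorm H0 (X n \<ominus>\<^bsub>H0\<^esub> x))\<^sup>2"
      by blast
  qed
  have "((\<lambda>t. (1 + t) * c) \<longlongrightarrow> (1 + 0) * c) (at_right 0)"
    by (intro tendsto_intros)
  then show "(hnorm H0 x)\<^sup>2 \<le> (\<integral>z. (hnorm (H z) (\<eta> z))\<^sup>2 \<partial>M)"
    unfolding c_def[symmetric]
    by (intro tendsto_lowerbound[where F = "at_right (0::real)"]) (auto simp: le eventually_at_right_less intro!: eventually_mono[OF eventually_at_right_less])
qed

text \<open>This is the Riesz-Fischer argument: geometrically fast approximants of \<open>x\<close>
  have fields whose increments are summable at almost every point.\<close>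

lemma rel_ex:
  assumes x: "x \<in> carrier H0"
  shows "\<exists>\<eta>. rel x \<eta>"
proof -
  have "\<exists>p. p \<in> G \<and> hnorm H0 (x \<ominus>\<^bsub>H0\<^esub> fst p) < (1/2) ^ n" for n :: nat
    using G_dense[OF x, of "(1/2) ^ n"] by auto
  then obtain P where P: "\<And>n. P n \<in> G" "\<And>n. hnorm H0 (x \<ominus>\<^bsub>H0\<^esub> fst (P n)) < (1/2) ^ n"
    by metis
  define X where "X n = fst (P n)" for n
  define Y where "Y n = snd (P n)" for n
  have X: "(X n, Y n) \<in> G" "hnorm H0 (x \<ominus>\<^bsub>H0\<^esub> X n) < (1/2) ^ n" for n
    using P by (simp_all add: X_def Y_def)
  note c = G_carrier[OF X(1)]
  have X': "hnorm H0 (X n \<ominus>\<^bsub>H0\<^esub> x) < (1/2) ^ n" for n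
    using X(2) H0.hnorm_minus_commute[OF x c(1)] by simp
  define D where "D n z = hnorm (H z) (Y (Suc n) z \<ominus>\<^bsub>H z\<^esub> Y n z)" for n z
  have "integrable M (\<lambda>z. (D n z)\<^sup>2)"
    and D_le: "(\<integral>z. (D n z)\<^sup>2 \<partial>M) \<le> (2 * (1/2) ^ n)\<^sup>2" for n
  proof -
    note I = G_norm[OF G_diff[OF X(1)[of "Suc n"] X(1)[of n]]]
    show "integrable M (\<lambda>z. (D n z)\<^sup>2)"
      using I by (simp add: has_bochner_integral_iff D_def)
    have "(1/2) ^ Suc n \<le> ((1/2) ^ n :: real)"
      by simp
    then have "hnorm H0 (X (Suc n) \<ominus>\<^bsub>H0\<^esub> X n) \<le> 2 * (1/2) ^ n"
      using H0.hnorm_minus_triangle[OF c(1) x c(1), of "Suc n" n] X(2)[of n] X'[of "Suc n"] by linarith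
    then have "(hnorm H0 (X (Suc n) \<ominus>\<^bsub>H0\<^esub> X n))\<^sup>2 \<le> (2 * (1/2) ^ n)\<^sup>2"
      using c by (intro power_mono) simp_all
    then show "(\<integral>z. (D n z)\<^sup>2 \<partial>M) \<le> (2 * (1/2) ^ n)\<^sup>2"
      using I by (simp add: has_bochner_integral_iff D_def)
  qed
  \<comment> \<open>The integral of the squared increment is at most 4 times
    \<open>(1/4) ^ n\<close>. The weight \<open>2 ^ n\<close> leaves a convergent geometric series
    and is strong enough to recover summability of the increments from that of their
    squares.\<close>
  then have D_int: "integrable M (\<lambda>z. 2 ^ n * (D n z)\<^sup>2)" for n
    by simp
  have "(\<integral>\<^sup>+z. (\<Sum>n. ennreal (2 ^ n * (D n z)\<^sup>2)) \<partial>M) = (\<Sum>n. \<integral>\<^sup>+z. ennreal (2 ^ n * (D n z)\<^sup>2) \<partial>M)"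
    by (rule nn_integral_suminf) (use borel_measurable_integrable[OF D_int] in measurable)
  also have "\<dots> \<le> (\<Sum>n. ennreal (4 * (1/2) ^ n))"
  proof (rule suminf_le)
    fix n
    have "(\<integral>\<^sup>+z. ennreal (2 ^ n * (D n z)\<^sup>2) \<partial>M) = ennreal (2 ^ n * (\<integral>z. (D n z)\<^sup>2 \<partial>M))"
      using D_int[of n] by (subst nn_integral_eq_integral) simp_all
    also have "\<dots> \<le> ennreal (2 ^ n * (2 * (1/2) ^ n)\<^sup>2)"
      by (intro ennreal_leI mult_left_mono D_le) simp
    also have "2 ^ n * (2 * (1/2) ^ n)\<^sup>2 = (4 * (1/2) ^ n :: real)"
      by (simp add: power2_eq_square power_divide)
    finally show "(\<integral>\<^sup>+z. ennreal (2 ^ n * (D n z)\<^sup>2) \<partial>M) \<le> ennreal (4 * (1/2) ^ n)" .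
  qed simp_all
  also have "\<dots> = ennreal (\<Sum>n. 4 * (1/2) ^ n)"
    by (rule suminf_ennreal2) (auto intro!: summable_mult summable_geometric)
  finally have "(\<integral>\<^sup>+z. (\<Sum>n. ennreal (2 ^ n * (D n z)\<^sup>2)) \<partial>M) \<noteq> \<infinity>"
    by (auto simp: top_unique)
  then have "AE z in M. (\<Sum>n. ennreal (2 ^ n * (D n z)\<^sup>2)) \<noteq> \<infinity>"
    by (rule nn_integral_PInf_AE[rotated]) (use borel_measurable_integrable[OF D_int] in measurable)
  then have ae: "AE z in M. \<exists>y\<in>carrier (H z). (\<lambda>n. hnorm (H z) (Y n z \<ominus>\<^bsub>H z\<^esub> y)) \<longlonglongrightarrow> 0"
  proof eventually_elim
    fix z assume "(\<Sum>n. ennreal (2 ^ n * (D n z)\<^sup>2)) \<noteq> \<infinity>"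
    then have sum: "summable (\<lambda>n. 2 ^ n * (D n z)\<^sup>2)"
      by (intro summable_suminf_not_top) simp_all
    have "summable (\<lambda>n. D n z)"
    proof (rule summable_comparison_test')
      show "summable (\<lambda>n. (1/2) ^ n + 2 ^ n * (D n z)\<^sup>2)"
        by (intro summable_add sum summable_geometric) simp
      fix n :: nat
      have D0: "0 \<le> D n z"
        using c by (simp add: D_def)
      \<comment> \<open>The square yields twice \<open>D n z\<close> at most
        \<open>(1/2) ^ n + 2 ^ n * (D n z)\<^sup>2\<close>, so two summable series control the
        increments themselves.\<close>
      have "0 \<le> (1/2) ^ n * (1 - 2 ^ n * D n z)\<^sup>2"
        by simp
      also have "\<dots> = (1/2) ^ n + 2 ^ n * (D n z)\<^sup>2 - 2 * D n z"
        by (simp add: power2_eq_square algebra_simps power_divide)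
      finally show "norm (D n z) \<le> (1/2) ^ n + 2 ^ n * (D n z)\<^sup>2"
        using D0 by simp
    qed
    then show "\<exists>y\<in>carrier (H z). (\<lambda>n. hnorm (H z) (Y n z \<ominus>\<^bsub>H z\<^esub> y)) \<longlonglongrightarrow> 0"
      unfolding D_def by (intro H.complete_summable c)
  qed
  define Q where "Q z y \<longleftrightarrow> y \<in> carrier (H z) \<and> (\<lambda>n. hnorm (H z) (Y n z \<ominus>\<^bsub>H z\<^esub> y)) \<longlonglongrightarrow> 0" for z y
  \<comment> \<open>The default zero keeps the field inside the fibres also at the points of
    divergence.\<close>
  define \<eta> where "\<eta> z = (if \<exists>y. Q z y then SOME y. Q z y else \<zero>\<^bsub>H z\<^esub>)" for z
  have Q: "Q z (\<eta> z)" if "\<exists>y. Q z y" for z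
    using someI_ex[OF that] that by (simp add: \<eta>_def)
  have "rel x \<eta>"
  proof (rule relI[OF x _ X(1)])
    show "\<eta> z \<in> carrier (H z)" for z
    proof (cases "\<exists>y. Q z y")
      case True
      then show ?thesis
        using Q by (simp add: Q_def)
    qed (simp add: \<eta>_def)
    have "norm (hnorm H0 (X n \<ominus>\<^bsub>H0\<^esub> x)) \<le> (1/2) ^ n" for n
      using X'[of n] c x by simp
    then show "(\<lambda>n. hnorm H0 (X n \<ominus>\<^bsub>H0\<^esub> x)) \<longlonglongrightarrow> 0"
      by (rule Lim_null_comparison[OF always_eventually[OF allI]]) (rule LIMSEQ_power_zero, simp)
    show "AE z in M. (\<lambda>n. hnorm (H z) (Y n z \<ominus>\<^bsub>H z\<^esub> \<eta> z)) \<longlonglongrightarrow> 0"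
      using ae
    proof eventually_elim
      fix z assume "\<exists>y\<in>carrier (H z). (\<lambda>n. hnorm (H z) (Y n z \<ominus>\<^bsub>H z\<^esub> y)) \<longlonglongrightarrow> 0"
      then have "\<exists>y. Q z y"
        by (auto simp: Q_def)
      then show "(\<lambda>n. hnorm (H z) (Y n z \<ominus>\<^bsub>H z\<^esub> \<eta> z)) \<longlonglongrightarrow> 0"
        using Q by (simp add: Q_def)
    qed
  qed
  then show ?thesis
    by blast
qed

lemma rel_dist: "rel x \<eta> \<Longrightarrow> rel y \<xi> \<Longrightarrow> di_dist \<nu> H \<eta> \<xi> = hnorm H0 (x \<ominus>\<^bsub>H0\<^esub> y)"
  unfolding di_dist_def di_seminorm_def by (subst rel_norm[OF rel_diff]) auto

text \<open>Fatou bounds the integral of the squared distance between the pointwise limit and the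
  seminorm limit by 0. It serves both for related fields and for fields of an arbitrary saturated
  family.\<close>

lemma AE_eq_if_limits:
  assumes Y: "\<And>n z. Y n z \<in> carrier (H z)" and \<eta>: "\<And>z. \<eta> z \<in> carrier (H z)" and \<xi>: "\<And>z. \<xi> z \<in> carrier (H z)"
    and ae: "AE z in M. (\<lambda>n. hnorm (H z) (Y n z \<ominus>\<^bsub>H z\<^esub> \<eta> z)) \<longlonglongrightarrow> 0"
    and int: "\<And>n. integrable M (\<lambda>z. (hnorm (H z) (Y n z \<ominus>\<^bsub>H z\<^esub> \<xi> z))\<^sup>2)"
    and lim: "(\<lambda>n. di_dist \<nu> H (Y n) \<xi>) \<longlonglongrightarrow> 0"
  shows "AE z in M. \<eta> z = \<xi> z"
proof -
  have 1: "AE z in M. (\<lambda>n. (hnorm (H z) (Y n z \<ominus>\<^bsub>H z\<^esub> \<xi> z))\<^sup>2) \<longlonglongrightarrow> (hnorm (H z) (\<eta> z \<ominus>\<^bsub>H z\<^esub> \<xi> z))\<^sup>2"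
    using ae
  proof eventually_elim
    fix z assume "(\<lambda>n. hnorm (H z) (Y n z \<ominus>\<^bsub>H z\<^esub> \<eta> z)) \<longlonglongrightarrow> 0"
    then have "(\<lambda>n. hnorm (H z) ((Y n z \<oplus>\<^bsub>H z\<^esub> (-1) \<odot>\<^bsub>H z\<^esub> \<xi> z) \<ominus>\<^bsub>H z\<^esub> (\<eta> z \<oplus>\<^bsub>H z\<^esub> (-1) \<odot>\<^bsub>H z\<^esub> \<xi> z))) \<longlonglongrightarrow> 0"
      by (intro H.tendsto_add_carrier) (simp_all add: Y \<eta> \<xi>)
    then show "(\<lambda>n. (hnorm (H z) (Y n z \<ominus>\<^bsub>H z\<^esub> \<xi> z))\<^sup>2) \<longlonglongrightarrow> (hnorm (H z) (\<eta> z \<ominus>\<^bsub>H z\<^esub> \<xi> z))\<^sup>2"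
      by (intro tendsto_power H.tendsto_hnorm) (simp_all add: Y \<eta> \<xi> flip: H.minus_eq_smult)
  qed
  have "(\<lambda>n. (di_dist \<nu> H (Y n) \<xi>)\<^sup>2) \<longlonglongrightarrow> 0\<^sup>2"
    by (intro tendsto_power lim)
  then have 2: "(\<lambda>n. \<integral>z. (hnorm (H z) (Y n z \<ominus>\<^bsub>H z\<^esub> \<xi> z))\<^sup>2 \<partial>M) \<longlonglongrightarrow> 0"
    by (simp add: di_dist_def di_seminorm_def)
  note F = fatou_completion[OF int _ _ 1 2]
  have "(\<integral>z. (hnorm (H z) (\<eta> z \<ominus>\<^bsub>H z\<^esub> \<xi> z))\<^sup>2 \<partial>M) = 0"
    by (rule antisym[OF F(2)]) simp_all
  then have "AE z in M. (hnorm (H z) (\<eta> z \<ominus>\<^bsub>H z\<^esub> \<xi> z))\<^sup>2 = 0"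
    using integral_nonneg_eq_0_iff_AE[OF F(1)] by simp
  then show ?thesis
    by eventually_elim (rule H.eq_if_minus_zero, use \<eta> \<xi> in \<open>simp_all add: H.hnorm_eq_0_iff\<close>)
qed

lemma rel_complete:
  assumes rel: "\<And>n. rel (X n) (Y n)"
    and cauchy: "\<forall>e>0. \<exists>N. \<forall>m\<ge>N. \<forall>n\<ge>N. hnorm H0 (X m \<ominus>\<^bsub>H0\<^esub> X n) < e"
  shows "\<exists>y \<xi>. rel y \<xi> \<and> (\<lambda>n. hnorm H0 (X n \<ominus>\<^bsub>H0\<^esub> y)) \<longlonglongrightarrow> 0 \<and> (\<lambda>n. di_dist \<nu> H (Y n) \<xi>) \<longlonglongrightarrow> 0"
proof -
  obtain y where y: "y \<in> carrier H0" "(\<lambda>n. hnorm H0 (X n \<ominus>\<^bsub>H0\<^esub> y)) \<longlonglongrightarrow> 0"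
    using H0.complete[OF rel_carrier(1)[OF rel] cauchy] by blast
  obtain \<xi> where \<xi>: "rel y \<xi>"
    using rel_ex[OF y(1)] by blast
  then show ?thesis
    using y by (intro exI[of _ y] exI[of _ \<xi>]) (simp add: rel_dist[OF rel \<xi>])
qed

section \<open>From continuous to bounded measurable multipliers\<close>

definition multiplier :: "('z \<Rightarrow> complex) \<Rightarrow> bool" where
  "multiplier f \<longleftrightarrow> (\<forall>x \<eta>. rel x \<eta> \<longrightarrow> (\<exists>y. rel y (\<lambda>z. f z \<odot>\<^bsub>H z\<^esub> \<eta> z)))"

text \<open>\<open>G_mult\<close> provides partners in \<open>H0\<close> without any bound on them.
  The isometry converts the pointwise bound \<open>K\<close> of \<open>f\<close> into a Lipschitz
  bound for the partners, whence they converge.\<close>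

lemma multiplier_continuous:
  assumes f: "continuous_on UNIV f"
  shows "multiplier f"
  unfolding multiplier_def
proof (intro allI impI)
  fix x \<eta> assume rel: "rel x \<eta>"
  then obtain X Y where
    X: "\<And>n. (X n, Y n) \<in> G" "(\<lambda>n. hnorm H0 (X n \<ominus>\<^bsub>H0\<^esub> x)) \<longlonglongrightarrow> 0"
      "AE z in M. (\<lambda>n. hnorm (H z) (Y n z \<ominus>\<^bsub>H z\<^esub> \<eta> z)) \<longlonglongrightarrow> 0"
    unfolding rel_def by blast
  note c = G_carrier[OF X(1)] rel_carrier[OF rel]
  obtain Z where Z: "\<And>n. (Z n, \<lambda>z. f z \<odot>\<^bsub>H z\<^esub> Y n z) \<in> G"
    using G_mult[OF f X(1)] by metis
  have "bounded (range f)"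
    using compact_continuous_image[OF f compact_UNIV] by (rule compact_imp_bounded)
  then obtain K where K: "K > 0" "\<And>z. cmod (f z) \<le> K"
    unfolding bounded_pos by auto
  have le: "hnorm H0 (Z m \<ominus>\<^bsub>H0\<^esub> Z n) \<le> K * hnorm H0 (X m \<ominus>\<^bsub>H0\<^esub> X n)" for m n
  proof (rule power2_le_imp_le)
    note 1 = G_norm[OF G_diff[OF Z Z, of m n]] and 2 = G_norm[OF G_diff[OF X(1) X(1), of m n]]
    have "(hnorm H0 (Z m \<ominus>\<^bsub>H0\<^esub> Z n))\<^sup>2 = (\<integral>z. (hnorm (H z) (f z \<odot>\<^bsub>H z\<^esub> Y m z \<ominus>\<^bsub>H z\<^esub> f z \<odot>\<^bsub>H z\<^esub> Y n z))\<^sup>2 \<partial>M)"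
      using 1 by (simp add: has_bochner_integral_iff)
    also have "\<dots> \<le> (\<integral>z. K\<^sup>2 * (hnorm (H z) (Y m z \<ominus>\<^bsub>H z\<^esub> Y n z))\<^sup>2 \<partial>M)"
    proof (rule integral_mono)
      fix z
      show "(hnorm (H z) (f z \<odot>\<^bsub>H z\<^esub> Y m z \<ominus>\<^bsub>H z\<^esub> f z \<odot>\<^bsub>H z\<^esub> Y n z))\<^sup>2 \<le> K\<^sup>2 * (hnorm (H z) (Y m z \<ominus>\<^bsub>H z\<^esub> Y n z))\<^sup>2"
        using K c by (simp add: H.smult_minus_smult H.hnorm_smult power_mult_distrib mult_right_mono power_mono)
    qed (use 1 2 in \<open>simp_all add: has_bochner_integral_iff\<close>)
    also have "\<dots> = (K * hnorm H0 (X m \<ominus>\<^bsub>H0\<^esub> X n))\<^sup>2"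
      using 2 by (simp add: has_bochner_integral_iff power_mult_distrib)
    finally show "(hnorm H0 (Z m \<ominus>\<^bsub>H0\<^esub> Z n))\<^sup>2 \<le> (K * hnorm H0 (X m \<ominus>\<^bsub>H0\<^esub> X n))\<^sup>2" .
  qed (use K c in simp)
  have "\<exists>y\<in>carrier H0. (\<lambda>n. hnorm H0 (Z n \<ominus>\<^bsub>H0\<^esub> y)) \<longlonglongrightarrow> 0"
  proof (rule H0.complete[OF G_carrier(1)[OF Z]], intro allI impI)
    fix e :: real assume "e > 0"
    then have "0 < e / (2 * K)"
      using K by (intro divide_pos_pos mult_pos_pos) simp_all
    from order_tendstoD(2)[OF X(2) this]
    obtain N where N: "\<And>n. n \<ge> N \<Longrightarrow> hnorm H0 (X n \<ominus>\<^bsub>H0\<^esub> x) < e / (2 * K)"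
      by (auto simp: eventually_sequentially)
    have "hnorm H0 (Z m \<ominus>\<^bsub>H0\<^esub> Z n) < e" if "m \<ge> N" "n \<ge> N" for m n
    proof -
      have "hnorm H0 (X m \<ominus>\<^bsub>H0\<^esub> X n) \<le> hnorm H0 (X m \<ominus>\<^bsub>H0\<^esub> x) + hnorm H0 (X n \<ominus>\<^bsub>H0\<^esub> x)"
        using H0.hnorm_minus_triangle[of "X m" x "X n"] H0.hnorm_minus_commute[of x "X n"] c by simp
      also have "\<dots> < e / (2 * K) + e / (2 * K)"
        using N that by (intro add_strict_mono) auto
      finally have "K * hnorm H0 (X m \<ominus>\<^bsub>H0\<^esub> X n) < K * (e / (2 * K) + e / (2 * K))"
        using K by (simp only: mult_less_cancel_left_pos)
      also have "\<dots> = e"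
        using K by simp
      finally show ?thesis
        using le[of m n] by linarith
    qed
    then show "\<exists>N. \<forall>m\<ge>N. \<forall>n\<ge>N. hnorm H0 (Z m \<ominus>\<^bsub>H0\<^esub> Z n) < e"
      by blast
  qed
  then obtain y where y: "y \<in> carrier H0" "(\<lambda>n. hnorm H0 (Z n \<ominus>\<^bsub>H0\<^esub> y)) \<longlonglongrightarrow> 0"
    by blast
  have "rel y (\<lambda>z. f z \<odot>\<^bsub>H z\<^esub> \<eta> z)"
  proof (rule relI[OF y(1) _ Z y(2)])
    show "AE z in M. (\<lambda>n. hnorm (H z) (f z \<odot>\<^bsub>H z\<^esub> Y n z \<ominus>\<^bsub>H z\<^esub> f z \<odot>\<^bsub>H z\<^esub> \<eta> z)) \<longlonglongrightarrow> 0"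
      using X(3) by eventually_elim (rule H.tendsto_smult_carrier, use c in simp_all)
  qed (simp add: c)
  then show "\<exists>y. rel y (\<lambda>z. f z \<odot>\<^bsub>H z\<^esub> \<eta> z)"
    by blast
qed

lemma multiplier_add:
  assumes "multiplier f" "multiplier g"
  shows "multiplier (\<lambda>z. f z + g z)"
  unfolding multiplier_def
proof (intro allI impI)
  fix x \<eta> assume rel: "rel x \<eta>"
  then obtain y y' where "rel y (\<lambda>z. f z \<odot>\<^bsub>H z\<^esub> \<eta> z)" "rel y' (\<lambda>z. g z \<odot>\<^bsub>H z\<^esub> \<eta> z)"
    using assms unfolding multiplier_def by blast
  from rel_add[OF this] show "\<exists>y. rel y (\<lambda>z. (f z + g z) \<odot>\<^bsub>H z\<^esub> \<eta> z)"
    using rel by (auto simp: H.smult_add_left)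
qed

lemma multiplier_sum: "(\<And>i. i \<in> I \<Longrightarrow> multiplier (f i)) \<Longrightarrow> multiplier (\<lambda>z. \<Sum>i\<in>I. f i z)"
  by (induction I rule: infinite_finite_induct) (auto intro: multiplier_add multiplier_continuous)

lemma multiplier_cmult:
  assumes "multiplier f"
  shows "multiplier (\<lambda>z. c * f z)"
  unfolding multiplier_def
proof (intro allI impI)
  fix x \<eta> assume rel: "rel x \<eta>"
  then obtain y where "rel y (\<lambda>z. f z \<odot>\<^bsub>H z\<^esub> \<eta> z)"
    using assms unfolding multiplier_def by blast
  from rel_smult[OF this, of c] show "\<exists>y. rel y (\<lambda>z. (c * f z) \<odot>\<^bsub>H z\<^esub> \<eta> z)"
    using rel by (auto simp: H.smult_smult)
qed

lemma multiplier_cong_AE: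
  assumes "multiplier f" "AE z in M. g z = f z"
  shows "multiplier g"
  unfolding multiplier_def
proof (intro allI impI)
  fix x \<eta> assume rel: "rel x \<eta>"
  then obtain y where y: "rel y (\<lambda>z. f z \<odot>\<^bsub>H z\<^esub> \<eta> z)"
    using assms unfolding multiplier_def by blast
  have "rel y (\<lambda>z. g z \<odot>\<^bsub>H z\<^esub> \<eta> z)"
    by (rule rel_cong_AE[OF y]) (use assms(2) in eventually_elim, use rel in simp_all)
  then show "\<exists>y. rel y (\<lambda>z. g z \<odot>\<^bsub>H z\<^esub> \<eta> z)"
    by blast
qed

text \<open>Dominated convergence makes the partners of the fields multiplied by \<open>f n\<close>
  Cauchy in \<open>H0\<close>. Their limit has a related field, which must agree almost everywhere
  with the pointwise limit.\<close>

lemma multiplier_LIMSEQ: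
  assumes f: "\<And>n. multiplier (f n)" and meas: "\<And>n. f n \<in> borel_measurable M" "g \<in> borel_measurable M"
    and bound: "\<And>n z. cmod (f n z) \<le> K"
    and lim: "AE z in M. (\<lambda>n. f n z) \<longlonglongrightarrow> g z"
  shows "multiplier g"
  unfolding multiplier_def
proof (intro allI impI)
  fix x \<eta> assume rel: "rel x \<eta>"
  let ?N = "\<lambda>z. hnorm (H z) (\<eta> z)"
  note int = rel_integrable[OF rel]
  have fg_meas: "(\<lambda>z. (cmod (f n z - g z))\<^sup>2 * (?N z)\<^sup>2) \<in> borel_measurable M" for n
    by (rule borel_measurable_times[OF _ borel_measurable_integrable[OF int]])
      (use meas in measurable)
  have "\<exists>y. rel y (\<lambda>z. f n z \<odot>\<^bsub>H z\<^esub> \<eta> z)" for n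
    using f[of n] rel unfolding multiplier_def by blast
  then have "\<exists>X. \<forall>n. rel (X n) (\<lambda>z. f n z \<odot>\<^bsub>H z\<^esub> \<eta> z)"
    by (intro choice allI)
  then obtain X where X: "\<And>n. rel (X n) (\<lambda>z. f n z \<odot>\<^bsub>H z\<^esub> \<eta> z)"
    by blast
  \<comment> \<open>This is the squared seminorm distance of the fields multiplied by
    \<open>f n\<close> and by \<open>g\<close>, written with scalar factors so that its integrand is
    visibly measurable.\<close>
  define h where "h n = (\<integral>z. (cmod (f n z - g z))\<^sup>2 * (?N z)\<^sup>2 \<partial>M)" for n
  have g_bound: "AE z in M. cmod (g z) \<le> K"
    using lim
  proof eventually_elim
    fix z assume "(\<lambda>n. f n z) \<longlonglongrightarrow> g z"
    from tendsto_norm[OF this] show "cmod (g z) \<le> K"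
      by (rule LIMSEQ_le_const2) (simp add: bound)
  qed
  have dom: "AE z in M. norm ((cmod (f n z - g z))\<^sup>2 * (?N z)\<^sup>2) \<le> (2 * K)\<^sup>2 * (?N z)\<^sup>2" for n
    using g_bound
  proof eventually_elim
    fix z assume "cmod (g z) \<le> K"
    then have "cmod (f n z - g z) \<le> 2 * K"
      using norm_triangle_ineq4[of "f n z" "g z"] bound[of n z] by linarith
    then have "(cmod (f n z - g z))\<^sup>2 * (?N z)\<^sup>2 \<le> (2 * K)\<^sup>2 * (?N z)\<^sup>2"
      by (intro mult_right_mono power_mono) simp_all
    then show "norm ((cmod (f n z - g z))\<^sup>2 * (?N z)\<^sup>2) \<le> (2 * K)\<^sup>2 * (?N z)\<^sup>2"
      by simp
  qed
  have conv: "AE z in M. (\<lambda>n. (cmod (f n z - g z))\<^sup>2 * (?N z)\<^sup>2) \<longlonglongrightarrow> 0"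
    using lim
  proof eventually_elim
    fix z assume "(\<lambda>n. f n z) \<longlonglongrightarrow> g z"
    then have "(\<lambda>n. (cmod (f n z - g z))\<^sup>2 * (?N z)\<^sup>2) \<longlonglongrightarrow> (cmod (g z - g z))\<^sup>2 * (?N z)\<^sup>2"
      by (intro tendsto_intros)
    then show "(\<lambda>n. (cmod (f n z - g z))\<^sup>2 * (?N z)\<^sup>2) \<longlonglongrightarrow> 0"
      by simp
  qed
  have dom_int: "integrable M (\<lambda>z. (2 * K)\<^sup>2 * (?N z)\<^sup>2)"
    using int by simp
  have fg_int: "integrable M (\<lambda>z. (cmod (f n z - g z))\<^sup>2 * (?N z)\<^sup>2)" for n
    by (rule Bochner_Integration.integrable_bound[OF dom_int fg_meas]) (use dom[of n] in eventually_elim, simp)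
  have "(\<lambda>n. h n) \<longlonglongrightarrow> (\<integral>z. 0 \<partial>M)"
    unfolding h_def by (rule integral_dominated_convergence[OF _ fg_meas dom_int conv dom]) simp
  then have h: "h \<longlonglongrightarrow> 0"
    by simp
  have le: "(hnorm H0 (X m \<ominus>\<^bsub>H0\<^esub> X n))\<^sup>2 \<le> 2 * h m + 2 * h n" for m n
  proof -
    note D = rel_diff[OF X X, of m n]
    have "(hnorm H0 (X m \<ominus>\<^bsub>H0\<^esub> X n))\<^sup>2 = (\<integral>z. (hnorm (H z) (f m z \<odot>\<^bsub>H z\<^esub> \<eta> z \<ominus>\<^bsub>H z\<^esub> f n z \<odot>\<^bsub>H z\<^esub> \<eta> z))\<^sup>2 \<partial>M)"
      by (rule rel_norm[OF D, symmetric])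
    also have "\<dots> \<le> (\<integral>z. 2 * ((cmod (f m z - g z))\<^sup>2 * (?N z)\<^sup>2) + 2 * ((cmod (f n z - g z))\<^sup>2 * (?N z)\<^sup>2) \<partial>M)"
    proof (rule integral_mono)
      fix z
      let ?a = "cmod (f m z - g z)" and ?b = "cmod (f n z - g z)"
      have "cmod (f m z - f n z) \<le> ?a + ?b"
        using norm_triangle_ineq4[of "f m z - g z" "f n z - g z"] by simp
      then have "(cmod (f m z - f n z))\<^sup>2 \<le> (?a + ?b)\<^sup>2"
        by (intro power_mono) simp_all
      also have "\<dots> \<le> 2 * ?a\<^sup>2 + 2 * ?b\<^sup>2"
        using sum_squares_bound[of ?a ?b] by (simp add: power2_sum)
      finally have "(cmod (f m z - f n z))\<^sup>2 * (?N z)\<^sup>2 \<le> (2 * ?a\<^sup>2 + 2 * ?b\<^sup>2) * (?N z)\<^sup>2"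
        by (rule mult_right_mono) simp
      then show "(hnorm (H z) (f m z \<odot>\<^bsub>H z\<^esub> \<eta> z \<ominus>\<^bsub>H z\<^esub> f n z \<odot>\<^bsub>H z\<^esub> \<eta> z))\<^sup>2
          \<le> 2 * (?a\<^sup>2 * (?N z)\<^sup>2) + 2 * (?b\<^sup>2 * (?N z)\<^sup>2)"
        using rel by (simp add: H.smult_minus_left H.hnorm_smult power_mult_distrib distrib_right)
    qed (use rel_integrable[OF D] fg_int in simp_all)
    also have "\<dots> = 2 * h m + 2 * h n"
      using fg_int by (simp add: h_def)
    finally show ?thesis .
  qed
  have cauchy: "\<forall>e>0. \<exists>N. \<forall>m\<ge>N. \<forall>n\<ge>N. hnorm H0 (X m \<ominus>\<^bsub>H0\<^esub> X n) < e"
  proof (intro allI impI)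
    fix e :: real assume e: "e > 0"
    then have "\<forall>\<^sub>F n in sequentially. h n < e\<^sup>2 / 4"
      using order_tendstoD(2)[OF h, of "e\<^sup>2 / 4"] by simp
    then obtain N where N: "\<And>n. n \<ge> N \<Longrightarrow> h n < e\<^sup>2 / 4"
      by (auto simp: eventually_sequentially)
    have "hnorm H0 (X m \<ominus>\<^bsub>H0\<^esub> X n) < e" if "m \<ge> N" "n \<ge> N" for m n
    proof (rule power_less_imp_less_base)
      show "(hnorm H0 (X m \<ominus>\<^bsub>H0\<^esub> X n))\<^sup>2 < e\<^sup>2"
        using le[of m n] N[OF that(1)] N[OF that(2)] by linarith
    qed (use e in simp)
    then show "\<exists>N. \<forall>m\<ge>N. \<forall>n\<ge>N. hnorm H0 (X m \<ominus>\<^bsub>H0\<^esub> X n) < e"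
      by blast
  qed
  obtain y \<xi> where y: "rel y \<xi>" and lim_\<xi>: "(\<lambda>n. di_dist \<nu> H (\<lambda>z. f n z \<odot>\<^bsub>H z\<^esub> \<eta> z) \<xi>) \<longlonglongrightarrow> 0"
    using rel_complete[OF X cauchy] by blast
  have "AE z in M. g z \<odot>\<^bsub>H z\<^esub> \<eta> z = \<xi> z"
  proof (rule AE_eq_if_limits[OF _ _ _ _ _ lim_\<xi>])
    show "AE z in M. (\<lambda>n. hnorm (H z) (f n z \<odot>\<^bsub>H z\<^esub> \<eta> z \<ominus>\<^bsub>H z\<^esub> g z \<odot>\<^bsub>H z\<^esub> \<eta> z)) \<longlonglongrightarrow> 0"
      using lim
    proof eventually_elim
      fix z assume "(\<lambda>n. f n z) \<longlonglongrightarrow> g z"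
      then have "(\<lambda>n. cmod (f n z - g z) * ?N z) \<longlonglongrightarrow> 0"
        by (intro tendsto_mult_left_zero tendsto_norm_zero LIM_zero)
      then show "(\<lambda>n. hnorm (H z) (f n z \<odot>\<^bsub>H z\<^esub> \<eta> z \<ominus>\<^bsub>H z\<^esub> g z \<odot>\<^bsub>H z\<^esub> \<eta> z)) \<longlonglongrightarrow> 0"
        using rel by (simp add: H.smult_minus_left H.hnorm_smult)
    qed
  qed (use rel y rel_integrable[OF rel_diff[OF X y]] in simp_all)
  then show "\<exists>y. rel y (\<lambda>z. g z \<odot>\<^bsub>H z\<^esub> \<eta> z)"
    using rel by (intro exI[of _ y] rel_cong_AE[OF y]) simp_all
qed

text \<open>The Urysohn functions differ from the indicator only on \<open>W n - K n\<close>. These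
  sets have summable measure, so by Borel-Cantelli almost every point eventually sees exact
  equality.\<close>

lemma multiplier_indicator_borel:
  assumes B: "B \<in> sets borel"
  shows "multiplier (indicator B)"
proof -
  have "\<exists>K W. compact K \<and> open W \<and> K \<subseteq> B \<and> B \<subseteq> W \<and> measure \<nu> (W - K) < (1/2) ^ n" for n :: nat
    by (rule regular_borel_approx[OF prob_space_axioms regular B, of "(1/2) ^ n"]) auto
  then obtain K W where KW: "\<And>n::nat. compact (K n)" "\<And>n. open (W n)" "\<And>n. K n \<subseteq> B" "\<And>n. B \<subseteq> W n"
      "\<And>n. measure \<nu> (W n - K n) < (1/2) ^ n"
    by metis
  have "\<exists>g::'z \<Rightarrow> real. continuous_on UNIV g \<and> (\<forall>z. 0 \<le> g z \<and> g z \<le> 1) \<and> (\<forall>z\<in>K n. g z = 1) \<and> (\<forall>z. z \<notin> W n \<longrightarrow> g z = 0)" for n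
    by (rule continuous_indicator_approx[OF compact_UNIV KW(1)[of n] KW(2)[of n]]) (use KW in blast)+
  then obtain g :: "nat \<Rightarrow> 'z \<Rightarrow> real" where g: "\<And>n. continuous_on UNIV (g n)" "\<And>n z. 0 \<le> g n z" "\<And>n z. g n z \<le> 1"
      "\<And>n z. z \<in> K n \<Longrightarrow> g n z = 1" "\<And>n z. z \<notin> W n \<Longrightarrow> g n z = 0"
    by metis
  have "AE z in \<nu>. \<forall>\<^sub>F n in sequentially. z \<in> space \<nu> - (W n - K n)"
  proof (rule borel_cantelli_AE1)
    show "summable (\<lambda>n. measure \<nu> (W n - K n))"
      by (rule summable_comparison_test'[of "\<lambda>n. (1/2) ^ n" 0])
        (auto intro: summable_geometric less_imp_le KW(5))
    show "W n - K n \<in> sets \<nu>" for n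
      using borel_open[OF KW(2)[of n]] borel_compact[OF KW(1)[of n]] by auto
  qed (simp add: emeasure_eq_measure)
  then have ae: "AE z in M. \<forall>\<^sub>F n in sequentially. z \<in> space \<nu> - (W n - K n)"
    by (rule AE_completion)
  have cont: "continuous_on UNIV (\<lambda>z. complex_of_real (g n z))" for n
    by (intro continuous_intros g)
  show ?thesis
  proof (rule multiplier_LIMSEQ[where f = "\<lambda>n z. complex_of_real (g n z)" and K = 1])
    show "multiplier (\<lambda>z. complex_of_real (g n z))" for n
      by (rule multiplier_continuous[OF cont])
    show "(\<lambda>z. complex_of_real (g n z)) \<in> borel_measurable M" for n
      using borel_measurable_continuous_onI[OF cont] by (intro measurable_completion) (simp cong: measurable_cong_sets)
    show "(indicator B :: 'z \<Rightarrow> complex) \<in> borel_measurable M"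
      using B by (intro borel_measurable_indicator) simp
    show "cmod (complex_of_real (g n z)) \<le> 1" for n z
      using g(2,3) by simp
    show "AE z in M. (\<lambda>n. complex_of_real (g n z)) \<longlonglongrightarrow> indicator B z"
      using ae
    proof eventually_elim
      fix z assume "\<forall>\<^sub>F n in sequentially. z \<in> space \<nu> - (W n - K n)"
      then have "\<forall>\<^sub>F n in sequentially. complex_of_real (g n z) = indicator B z"
      proof eventually_elim
        fix n assume "z \<in> space \<nu> - (W n - K n)"
        then show "complex_of_real (g n z) = indicator B z"
          using KW(3,4)[of n] g(4,5)[of z n] by (auto simp: indicator_def)
      qed
      then show "(\<lambda>n. complex_of_real (g n z)) \<longlonglongrightarrow> indicator B z"
        by (rule tendsto_eventually)
    qed
  qed
qed

text \<open>A set measurable for the completion is a Borel set up to a null set, and multipliers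
  ignore null sets.\<close>

lemma multiplier_indicator:
  assumes E: "E \<in> sets M"
  shows "multiplier (indicator E)"
proof (rule multiplier_cong_AE[OF multiplier_indicator_borel])
  show "main_part \<nu> E \<in> sets borel"
    using main_part_sets[OF E] by simp
  have "AE z in M. z \<notin> null_part \<nu> E"
    using null_part_null_sets[OF E] by (rule AE_not_in)
  then show "AE z in M. indicator E z = (indicator (main_part \<nu> E) z :: complex)"
  proof eventually_elim
    fix z assume "z \<notin> null_part \<nu> E"
    then show "indicator E z = (indicator (main_part \<nu> E) z :: complex)"
      using main_part_null_part_Un[OF E] by (auto simp: indicator_def)
  qed
qed

lemma multiplier_bounded_measurable:
  assumes f: "f \<in> borel_measurable M" and bound: "AE z in M. cmod (f z) \<le> K"
  shows "multiplier f"
proof -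
  \<comment> \<open>Limits of multipliers require bounds at every point, while \<open>f\<close> is
    bounded only almost everywhere.\<close>
  define g where "g z = (if cmod (f z) \<le> K then f z else 0)" for z
  have g: "g \<in> borel_measurable M"
    using f unfolding g_def by measurable
  obtain F where F: "\<And>i. simple_function M (F i)" "\<And>z. (\<lambda>i. F i z) \<longlonglongrightarrow> g z" "\<And>i z. cmod (F i z) \<le> 2 * cmod (g z)"
    using borel_measurable_implies_sequence_metric[OF g, of 0] by (auto simp: dist_norm)
  \<comment> \<open>The factor 2 comes from the approximating simple functions; the absolute value
    covers a negative \<open>K\<close>, for which \<open>g\<close> is identically 0.\<close>
  have "multiplier g"
  proof (rule multiplier_LIMSEQ[where f = F and K = "2 * \<bar>K\<bar>"])
    fix i
    have "multiplier (\<lambda>z. \<Sum>y\<in>F i ` UNIV. y * indicator (F i -` {y}) z)"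
      using simple_functionD(2)[OF F(1)] by (intro multiplier_sum multiplier_cmult multiplier_indicator) simp
    moreover have "(\<Sum>y\<in>F i ` UNIV. y * indicator (F i -` {y}) z) = F i z" for z
    proof -
      have "(\<Sum>y\<in>F i ` UNIV. y * indicator (F i -` {y}) z) = (\<Sum>y\<in>F i ` UNIV. if y = F i z then y else 0)"
        by (rule sum.cong) auto
      then show ?thesis
        using simple_functionD(1)[OF F(1), of i] by simp
    qed
    ultimately show "multiplier (F i)"
      by simp
    show "F i \<in> borel_measurable M"
      using F(1) by (rule borel_measurable_simple_function)
    show "cmod (F i z) \<le> 2 * \<bar>K\<bar>" for z
      using F(3)[of i z] by (auto simp: g_def split: if_splits)
  qed (simp_all add: g F)
  then show ?thesis
    by (rule multiplier_cong_AE) (use bound in eventually_elim, simp add: g_def)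
qed

section \<open>The saturation and the isomorphism onto the direct integral\<close>

lemma rel_inj:
  assumes "rel x \<eta>" "rel y \<eta>"
  shows "x = y"
proof -
  have "(hnorm H0 (x \<ominus>\<^bsub>H0\<^esub> y))\<^sup>2 = 0"
    using rel_norm[OF rel_diff[OF assms]] assms by simp
  then show ?thesis
    by - (rule H0.eq_if_minus_zero, use assms in \<open>simp_all add: H0.hnorm_eq_0_iff\<close>)
qed

lemma rel_inner:
  assumes "rel x \<eta>" "rel y \<xi>"
  shows "(\<integral>z. hinner (H z) (\<eta> z) (\<xi> z) \<partial>M) = hinner H0 x y"
proof -
  have *: "has_bochner_integral M (\<lambda>z. complex_of_real ((hnorm (H z) (c \<odot>\<^bsub>H z\<^esub> \<eta> z \<oplus>\<^bsub>H z\<^esub> \<xi> z))\<^sup>2))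
      (complex_of_real ((hnorm H0 (c \<odot>\<^bsub>H0\<^esub> x \<oplus>\<^bsub>H0\<^esub> y))\<^sup>2))" for c
  proof (rule has_bochner_integral_of_real)
    note r = rel_add[OF rel_smult[OF assms(1), of c] assms(2)]
    show "has_bochner_integral M (\<lambda>z. (hnorm (H z) (c \<odot>\<^bsub>H z\<^esub> \<eta> z \<oplus>\<^bsub>H z\<^esub> \<xi> z))\<^sup>2)
        ((hnorm H0 (c \<odot>\<^bsub>H0\<^esub> x \<oplus>\<^bsub>H0\<^esub> y))\<^sup>2)"
      using rel_integrable[OF r] rel_norm[OF r] by (simp add: has_bochner_integral_iff)
  qed
  have "has_bochner_integral M (\<lambda>z. hinner (H z) (\<eta> z) (\<xi> z)) (hinner H0 x y)"
    unfolding H.polarization[OF rel_carrier(2)[OF assms(1)] rel_carrier(2)[OF assms(2)]]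
      H0.polarization[OF rel_carrier(1)[OF assms(1)] rel_carrier(1)[OF assms(2)]]
    by (intro has_bochner_integral_divide_zero has_bochner_integral_add has_bochner_integral_diff
        has_bochner_integral_mult_right *)
  then show ?thesis
    by (rule has_bochner_integral_integral_eq)
qed

lemma rel_zero: "rel \<zero>\<^bsub>H0\<^esub> (\<lambda>z. \<zero>\<^bsub>H z\<^esub>)"
proof -
  \<comment> \<open>Density makes the graph nonempty, and 0 times any of its pairs is the zero
    pair.\<close>
  obtain y \<eta> where G: "(y, \<eta>) \<in> G"
    using G_dense[of "\<zero>\<^bsub>H0\<^esub>" 1] by auto
  show ?thesis
    using rel_smult[OF rel_G[OF G], of 0] G_carrier[OF G] by simp
qed

text \<open>Completeness is borrowed from \<open>H0\<close>: \<open>rel_dist\<close> carries Cauchy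
  sequences over, and \<open>rel_ex\<close> supplies a field for the limit vector.\<close>

lemma saturated_range_rel: "saturated_family \<nu> H {\<eta>. \<exists>x. rel x \<eta>}"
  unfolding saturated_family_def fundamental_family_def product_subspace_def
proof (intro conjI ballI allI impI)
  show "(\<lambda>z. \<zero>\<^bsub>H z\<^esub>) \<in> {\<eta>. \<exists>x. rel x \<eta>}"
    using rel_zero by blast
next
  fix \<eta> \<xi> assume "\<eta> \<in> {\<eta>. \<exists>x. rel x \<eta>}" "\<xi> \<in> {\<eta>. \<exists>x. rel x \<eta>}"
  then show "(\<lambda>z. \<eta> z \<oplus>\<^bsub>H z\<^esub> \<xi> z) \<in> {\<eta>. \<exists>x. rel x \<eta>}"
    using rel_add by blast
next
  fix c \<eta> assume "\<eta> \<in> {\<eta>. \<exists>x. rel x \<eta>}"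
  then show "(\<lambda>z. c \<odot>\<^bsub>H z\<^esub> \<eta> z) \<in> {\<eta>. \<exists>x. rel x \<eta>}"
    using rel_smult by blast
next
  fix \<eta> assume "\<eta> \<in> {\<eta>. \<exists>x. rel x \<eta>}"
  then show "integrable M (\<lambda>z. (hnorm (H z) (\<eta> z))\<^sup>2)"
    using rel_integrable by blast
next
  fix \<eta> \<xi> assume "\<eta> \<in> {\<eta>. \<exists>x. rel x \<eta>}" "\<xi> \<in> (\<Pi> z\<in>UNIV. carrier (H z))" "AE z in \<nu>. \<xi> z = \<eta> z"
  then show "\<xi> \<in> {\<eta>. \<exists>x. rel x \<eta>}"
    using rel_cong_AE AE_completion[of "\<lambda>z. \<xi> z = \<eta> z" \<nu>] by blast
next
  fix f :: "'z \<Rightarrow> complex" and \<eta>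
  assume f: "f \<in> borel_measurable M" "\<exists>K. AE z in \<nu>. cmod (f z) \<le> K" and \<eta>: "\<eta> \<in> {\<eta>. \<exists>x. rel x \<eta>}"
  then obtain K where "AE z in M. cmod (f z) \<le> K"
    using AE_completion by blast
  then have "multiplier f"
    by (rule multiplier_bounded_measurable[OF f(1)])
  then show "(\<lambda>z. f z \<odot>\<^bsub>H z\<^esub> \<eta> z) \<in> {\<eta>. \<exists>x. rel x \<eta>}"
    using \<eta> by (auto simp: multiplier_def)
next
  fix Y :: "nat \<Rightarrow> 'z \<Rightarrow> 'v"
  assume "\<forall>n. Y n \<in> {\<eta>. \<exists>x. rel x \<eta>}"
  then have "\<exists>X. \<forall>n. rel (X n) (Y n)"
    by (intro choice) simp
  then obtain X where X: "\<And>n. rel (X n) (Y n)"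
    by blast
  assume "\<forall>e>0. \<exists>N. \<forall>m\<ge>N. \<forall>n\<ge>N. di_dist \<nu> H (Y m) (Y n) < e"
  then have "\<forall>e>0. \<exists>N. \<forall>m\<ge>N. \<forall>n\<ge>N. hnorm H0 (X m \<ominus>\<^bsub>H0\<^esub> X n) < e"
    by (simp add: rel_dist[OF X X])
  from rel_complete[OF X this] show "\<exists>\<eta>\<in>{\<eta>. \<exists>x. rel x \<eta>}. (\<lambda>n. di_dist \<nu> H (Y n) \<eta>) \<longlonglongrightarrow> 0"
    by blast
qed auto

text \<open>The approximating graph fields lie in \<open>T\<close> and are Cauchy, so
  \<open>T\<close> contains a seminorm limit. It agrees almost everywhere with
  \<open>\<eta>\<close>, and \<open>T\<close> is closed under such modifications.\<close>

lemma range_rel_minimal: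
  assumes T: "saturated_family \<nu> H T" and G: "snd ` G \<subseteq> T" and rel: "rel x \<eta>"
  shows "\<eta> \<in> T"
proof -
  from rel obtain X Y where
    X: "\<And>n. (X n, Y n) \<in> G" "(\<lambda>n. hnorm H0 (X n \<ominus>\<^bsub>H0\<^esub> x)) \<longlonglongrightarrow> 0"
      "AE z in M. (\<lambda>n. hnorm (H z) (Y n z \<ominus>\<^bsub>H z\<^esub> \<eta> z)) \<longlonglongrightarrow> 0"
    unfolding rel_def by blast
  note T = saturated_familyD[OF T]
  have Y: "Y n \<in> T" for n
    using X(1) G by force
  have "\<forall>e>0. \<exists>N. \<forall>m\<ge>N. \<forall>n\<ge>N. di_dist \<nu> H (Y m) (Y n) < e"
    unfolding rel_dist[OF rel_G[OF X(1)] rel_G[OF X(1)]]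
    by (rule H0.tendsto_imp_Cauchy[OF G_carrier(1)[OF X(1)] rel_carrier(1)[OF rel] X(2)])
  from T(6)[OF Y this] obtain \<xi> where \<xi>: "\<xi> \<in> T" "(\<lambda>n. di_dist \<nu> H (Y n) \<xi>) \<longlonglongrightarrow> 0"
    by blast
  have "integrable M (\<lambda>z. (hnorm (H z) (Y n z \<ominus>\<^bsub>H z\<^esub> \<xi> z))\<^sup>2)" for n
    using T(4)[OF T(2)[OF Y[of n] T(3)[OF \<xi>(1), of "-1"]]] T(1)[OF Y] T(1)[OF \<xi>(1)]
    by (simp add: H.minus_eq_smult)
  from AE_eq_if_limits[OF T(1)[OF Y] rel_carrier(2)[OF rel] T(1)[OF \<xi>(1)] X(3) this \<xi>(2)]
  have "AE z in \<nu>. \<eta> z = \<xi> z"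
    by (simp add: AE_completion_iff)
  then show ?thesis
    using rel by (intro T(5)[OF \<xi>(1)]) simp_all
qed

lemma saturation_eq: "saturation \<nu> H (snd ` G) = {\<eta>. \<exists>x. rel x \<eta>}"
  unfolding saturation_def
proof (rule hull_unique)
  show "snd ` G \<subseteq> {\<eta>. \<exists>x. rel x \<eta>}"
    using rel_G by fastforce
  show "saturated_family \<nu> H {\<eta>. \<exists>x. rel x \<eta>}"
    by (rule saturated_range_rel)
  show "{\<eta>. \<exists>x. rel x \<eta>} \<subseteq> T" if "snd ` G \<subseteq> T" "saturated_family \<nu> H T" for T
    using range_rel_minimal[OF that(2,1)] by blast
qed

text \<open>Distances of related fields are distances in \<open>H0\<close>, so seminorm 0 means a
  common vector: classes are exactly the fibres of \<open>rel\<close>.\<close>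

lemma di_class_eq: "rel x \<eta> \<Longrightarrow> di_class \<nu> H (snd ` G) \<eta> = {\<xi>. rel x \<xi>}"
  unfolding di_class_def di_rel_def saturation_eq
  by (auto simp: rel_dist H0.hnorm_eq_0_iff dest!: H0.eq_if_minus_zero[rotated 2])

lemma rel_di_rep: "x \<in> carrier H0 \<Longrightarrow> rel x (di_rep {\<eta>. rel x \<eta>})"
  unfolding di_rep_def using rel_ex by (simp add: someI_ex)

text \<open>Sending \<open>x\<close> to its whole fibre avoids a choice of field. The operations on
  classes do choose, through \<open>di_rep\<close>, but the rules for \<open>rel\<close> hold for
  every representative.\<close>

lemma direct_integral_iso: "hilbert_iso (\<lambda>x. {\<eta>. rel x \<eta>}) H0 (direct_integral \<nu> H (snd ` G))"
proof -
  let ?V = "\<lambda>x. {\<eta>. rel x \<eta>}" and ?K = "direct_integral \<nu> H (snd ` G)"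
  have "carrier ?K = ?V ` carrier H0"
  proof -
    have "carrier ?K = {di_class \<nu> H (snd ` G) \<eta> | \<eta>. \<exists>x. rel x \<eta>}"
      by (auto simp: direct_integral_def quotient_def saturation_eq di_class_def)
    also have "\<dots> = ?V ` carrier H0"
    proof (intro equalityI subsetI)
      fix X assume "X \<in> {di_class \<nu> H (snd ` G) \<eta> | \<eta>. \<exists>x. rel x \<eta>}"
      then obtain x \<eta> where "X = di_class \<nu> H (snd ` G) \<eta>" "rel x \<eta>"
        by blast
      then show "X \<in> ?V ` carrier H0"
        by (intro image_eqI[of _ _ x]) (simp_all add: di_class_eq)
    next
      fix X assume "X \<in> ?V ` carrier H0"
      then obtain x where X: "X = ?V x" "x \<in> carrier H0"
        by blast
      then obtain \<eta> where "rel x \<eta>"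
        using rel_ex by blast
      then show "X \<in> {di_class \<nu> H (snd ` G) \<eta> | \<eta>. \<exists>x. rel x \<eta>}"
        using X(1) di_class_eq[of x \<eta>] by blast
    qed
    finally show ?thesis .
  qed
  moreover have "inj_on ?V (carrier H0)"
    by (rule inj_onI) (metis (no_types, lifting) mem_Collect_eq rel_ex rel_inj)
  ultimately have bij: "bij_betw ?V (carrier H0) (carrier ?K)"
    by (simp add: bij_betw_def)
  have zero: "?V \<zero>\<^bsub>H0\<^esub> = \<zero>\<^bsub>?K\<^esub>"
    by (simp add: direct_integral_def di_class_eq[OF rel_zero])
  have add: "?V (x \<oplus>\<^bsub>H0\<^esub> y) = ?V x \<oplus>\<^bsub>?K\<^esub> ?V y" if "x \<in> carrier H0" "y \<in> carrier H0" for x y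
    by (simp add: direct_integral_def di_class_eq[OF rel_add[OF rel_di_rep rel_di_rep]] that)
  have smult: "?V (c \<odot>\<^bsub>H0\<^esub> x) = c \<odot>\<^bsub>?K\<^esub> ?V x" if "x \<in> carrier H0" for c x
    by (simp add: direct_integral_def di_class_eq[OF rel_smult[OF rel_di_rep]] that)
  have inner: "hinner ?K (?V x) (?V y) = hinner H0 x y" if "x \<in> carrier H0" "y \<in> carrier H0" for x y
    by (simp add: direct_integral_def rel_inner[OF rel_di_rep rel_di_rep] that)
  have "hilbert_space ?K"
    by (rule hilbert_space_transport[OF hilbert_H0 bij zero add smult inner])
  then show ?thesis
    using bij add smult inner hilbert_H0 unfolding hilbert_iso_def by blast
qed

lemma fundamental_family_graph: "fundamental_family \<nu> H (snd ` G)"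
  unfolding fundamental_family_def product_subspace_def
proof (intro conjI ballI allI)
  show "snd ` G \<subseteq> (\<Pi> z\<in>UNIV. carrier (H z))"
    using G_carrier(2) by fastforce
  obtain y \<eta> where "(y, \<eta>) \<in> G"
    using G_dense[of "\<zero>\<^bsub>H0\<^esub>" 1] by auto
  from G_smult[OF this, of 0] G_carrier[OF this] show "(\<lambda>z. \<zero>\<^bsub>H z\<^esub>) \<in> snd ` G"
    by force
next
  fix \<eta> \<xi> assume "\<eta> \<in> snd ` G" "\<xi> \<in> snd ` G"
  then show "(\<lambda>z. \<eta> z \<oplus>\<^bsub>H z\<^esub> \<xi> z) \<in> snd ` G"
    using G_add by force
next
  fix c \<eta> assume "\<eta> \<in> snd ` G"
  then show "(\<lambda>z. c \<odot>\<^bsub>H z\<^esub> \<eta> z) \<in> snd ` G"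
    using G_smult by force
next
  fix \<eta> assume "\<eta> \<in> snd ` G"
  then show "integrable M (\<lambda>z. (hnorm (H z) (\<eta> z))\<^sup>2)"
    using rel_G rel_integrable by force
qed

end

section \<open>GNS representations of limit states\<close>

lemma gns_tripleD:
  assumes "gns_triple X w H \<pi> \<Omega>"
  shows "hilbert_space H" "\<Omega> \<in> carrier H"
    and "A \<in> X \<Longrightarrow> x \<in> carrier H \<Longrightarrow> \<pi> A x \<in> carrier H"
    and "A \<in> X \<Longrightarrow> x \<in> carrier H \<Longrightarrow> \<pi> A (c \<odot>\<^bsub>H\<^esub> x) = c \<odot>\<^bsub>H\<^esub> \<pi> A x"
    and "A \<in> X \<Longrightarrow> B \<in> X \<Longrightarrow> x \<in> carrier H \<Longrightarrow> \<pi> (sadd A B) x = \<pi> A x \<oplus>\<^bsub>H\<^esub> \<pi> B x"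
    and "A \<in> X \<Longrightarrow> x \<in> carrier H \<Longrightarrow> \<pi> (sscale c A) x = c \<odot>\<^bsub>H\<^esub> \<pi> A x"
    and "A \<in> X \<Longrightarrow> B \<in> X \<Longrightarrow> x \<in> carrier H \<Longrightarrow> \<pi> (sprod A B) x = \<pi> A (\<pi> B x)"
    and "A \<in> X \<Longrightarrow> x \<in> carrier H \<Longrightarrow> y \<in> carrier H \<Longrightarrow> hinner H (\<pi> (sadj A) x) y = hinner H x (\<pi> A y)"
    and "x \<in> carrier H \<Longrightarrow> \<pi> sone x = x"
    and "A \<in> X \<Longrightarrow> w A = hinner H \<Omega> (\<pi> A \<Omega>)"
    and "x \<in> carrier H \<Longrightarrow> e > 0 \<Longrightarrow> \<exists>A\<in>X. hnorm H (x \<ominus>\<^bsub>H\<^esub> \<pi> A \<Omega>) < e"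
  using assms unfolding gns_triple_def star_representation_def by auto

context positive_energy
begin

text \<open>Norms of GNS vectors become values of the state, so the integral decomposition of states
  turns into the isometry of the graph.\<close>

lemma gns_inner:
  assumes gns: "gns_triple X w H \<pi> \<xi>" and A: "A \<in> X"
  shows "complex_of_real ((hnorm H (\<pi> A \<xi>))\<^sup>2) = w (sprod (sadj A) A)"
proof -
  note g = gns_tripleD[OF gns]
  interpret hilbert_space H by (rule g(1))
  have adj: "sadj A \<in> X"
    by (rule scaling_algebra_sadj[OF A])
  have "hinner H (\<pi> A \<xi>) (\<pi> A \<xi>) = cnj (hinner H (\<pi> (sadj A) (\<pi> A \<xi>)) \<xi>)"
    using hinner_commute[of "\<pi> A \<xi>" "\<pi> A \<xi>"] by (simp add: g A)
  also have "\<dots> = hinner H \<xi> (\<pi> (sadj A) (\<pi> A \<xi>))"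
    by (rule hinner_commute[symmetric]) (simp_all add: g A adj)
  also have "\<dots> = w (sprod (sadj A) A)"
    by (simp add: g(2,7) g(10)[OF scaling_algebra_sprod[OF adj A]] A adj)
  finally show ?thesis
    by (simp add: hinner_self g A)
qed

text \<open>The squared norm of \<open>\<pi> D \<xi>\<close> minus \<open>w D\<close> times
  \<open>\<xi>\<close> expands to the state on \<open>sprod (sadj D) D\<close> minus the squared
  modulus of \<open>w D\<close>, which vanishes by \<open>mult\<close>.\<close>

lemma gns_eigenvector:
  assumes gns: "gns_triple X w H \<pi> \<xi>" and D: "D \<in> X"
    and mult: "w (sprod (sadj D) D) = w (sadj D) * w D" and sone: "w sone = 1"
  shows "\<pi> D \<xi> = w D \<odot>\<^bsub>H\<^esub> \<xi>"
proof -
  note g = gns_tripleD[OF gns]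
  interpret hilbert_space H by (rule g(1))
  have adj: "w (sadj D) = cnj (w D)"
  proof -
    have "w (sadj D) = hinner H \<xi> (\<pi> (sadj D) \<xi>)"
      by (rule g(10)[OF scaling_algebra_sadj[OF D]])
    also have "\<dots> = cnj (hinner H (\<pi> (sadj D) \<xi>) \<xi>)"
      by (rule hinner_commute) (simp_all add: g scaling_algebra_sadj D)
    also have "\<dots> = cnj (w D)"
      by (simp add: g D)
    finally show ?thesis .
  qed
  have one: "complex_of_real ((hnorm H \<xi>)\<^sup>2) = 1"
    using g(10)[OF scaling_algebra_sone] sone by (simp add: hinner_self g)
  have "complex_of_real ((hnorm H ((- w D) \<odot>\<^bsub>H\<^esub> \<xi> \<oplus>\<^bsub>H\<^esub> \<pi> D \<xi>))\<^sup>2) = 0"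
    unfolding hnorm_sq_add_smult[OF g(2) g(3)[OF D g(2)]] one gns_inner[OF gns D] mult adj g(10)[OF D, symmetric]
    by simp
  then have "(- w D) \<odot>\<^bsub>H\<^esub> \<xi> \<oplus>\<^bsub>H\<^esub> \<pi> D \<xi> = \<zero>\<^bsub>H\<^esub>"
    by (simp add: hnorm_eq_0_iff g D)
  then have "\<pi> D \<xi> \<ominus>\<^bsub>H\<^esub> w D \<odot>\<^bsub>H\<^esub> \<xi> = \<zero>\<^bsub>H\<^esub>"
    by (simp add: minus_eq_smult smult_smult M.a_comm g D)
  then show ?thesis
    by (rule eq_if_minus_zero[rotated 2]) (simp_all add: g D)
qed

end

theorem theorem3p2:
  fixes \<AA> :: "'s::finite mink set \<Rightarrow> 'h::chilbert_space oper set"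
    and U :: "'s poinc \<Rightarrow> 'h oper"
    and \<Omega> :: 'h
    and w0 :: "'h sfun \<Rightarrow> complex"
    and H0 :: "'u hspace" and \<pi>0 :: "'h sfun \<Rightarrow> 'u \<Rightarrow> 'u" and \<Omega>0 :: 'u
    and \<nu> :: "'z::t2_space measure"
    and w :: "'z \<Rightarrow> 'h sfun \<Rightarrow> complex"
    and H :: "'z \<Rightarrow> 'v hspace" and \<pi> :: "'z \<Rightarrow> 'h sfun \<Rightarrow> 'v \<Rightarrow> 'v" and \<Omega>z :: "'z \<Rightarrow> 'v"
    and \<Gamma> :: "('z \<Rightarrow> 'v) set"
  assumes "\<Gamma> = {\<lambda>z. \<pi> z A (\<Omega>z z) | A. A \<in> scaling_algebra \<AA> U}"
    and "vacuum_sector \<AA> U \<Omega>"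
    and "limit_state \<AA> U \<Omega> w0"
    and "gns_triple (scaling_algebra \<AA> U) w0 H0 \<pi>0 \<Omega>0"
    and "compact (UNIV :: 'z set)"
    and "prob_space \<nu>" and "regular_borel \<nu>"
    and "\<And>z. multiplicative_limit_state \<AA> U \<Omega> (w z)"
    and "\<And>A. A \<in> scaling_algebra \<AA> U \<Longrightarrow> has_bochner_integral \<nu> (\<lambda>z. w z A) (w0 A)"
    and "(\<lambda>C z. w z C) ` scaling_center \<AA> U = {f. continuous_on UNIV f}"
    and "\<And>z. gns_triple (scaling_algebra \<AA> U) (w z) (H z) (\<pi> z) (\<Omega>z z)"
  shows "fundamental_family \<nu> H \<Gamma> \<and>
    (\<exists>V. hilbert_iso V H0 (direct_integral \<nu> H \<Gamma>) \<and>
         (\<forall>A\<in>scaling_algebra \<AA> U.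
            V (\<pi>0 A \<Omega>0) = di_class \<nu> H \<Gamma> (\<lambda>z. \<pi> z A (\<Omega>z z))))"
proof -
  interpret vacuum_sector \<AA> U \<Omega> by fact
  note g0 = gns_tripleD[OF assms(4)] and gz = gns_tripleD[OF assms(11)]
  interpret H0: hilbert_space H0 by (rule g0(1))
  interpret H: hilbert_space "H z" for z by (rule gz(1))
  let ?v = "\<lambda>A z. \<pi> z A (\<Omega>z z)"
  \<comment> \<open>Pairs are indexed by algebra elements, so different elements may yield the same
    vector; that the field is then the same up to null sets follows from the isometry.\<close>
  define G where "G = {(\<pi>0 A \<Omega>0, ?v A) | A. A \<in> X}"
  have \<Gamma>: "\<Gamma> = snd ` G"
    unfolding assms(1) G_def by force
  \<comment> \<open>Multiplicativity of the states over the points of the base space enters here: it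
    makes their GNS vectors eigenvectors of scalar functions.\<close>
  have scalar: "\<pi> z (vacuum_map \<Omega> C) (\<Omega>z z) = w z C \<odot>\<^bsub>H z\<^esub> \<Omega>z z" if C: "C \<in> X" for z C
  proof -
    have "w z sone = 1"
      using assms(8)[of z] by (simp add: multiplicative_limit_state_def sstate_def)
    then show ?thesis
      using gns_eigenvector[OF assms(11) scaling_algebra_vacuum_map[OF C]
          multiplicative_limit_state_vacuum_map(2)[OF assms(8) C]]
      by (simp add: multiplicative_limit_state_vacuum_map(1)[OF assms(8) C])
  qed
  interpret isometric_graph \<nu> H0 H G
  proof (intro isometric_graph.intro isometric_graph_axioms.intro assms g0(1) gz(1))
    fix x \<eta> y \<xi> assume "(x, \<eta>) \<in> G" "(y, \<xi>) \<in> G"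
    then obtain A B where AB: "x = \<pi>0 A \<Omega>0" "\<eta> = ?v A" "A \<in> X" "y = \<pi>0 B \<Omega>0" "\<xi> = ?v B" "B \<in> X"
      by (auto simp: G_def)
    then have "x \<oplus>\<^bsub>H0\<^esub> y = \<pi>0 (sadd A B) \<Omega>0" "(\<lambda>z. \<eta> z \<oplus>\<^bsub>H z\<^esub> \<xi> z) = ?v (sadd A B)"
      by (simp_all add: g0 gz)
    then show "(x \<oplus>\<^bsub>H0\<^esub> y, \<lambda>z. \<eta> z \<oplus>\<^bsub>H z\<^esub> \<xi> z) \<in> G"
      using scaling_algebra_sadd[OF AB(3,6)] by (auto simp: G_def)
  next
    fix x \<eta> assume "(x, \<eta>) \<in> G"
    then obtain A where A: "x = \<pi>0 A \<Omega>0" "\<eta> = ?v A" "A \<in> X"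
      by (auto simp: G_def)
    show "x \<in> carrier H0" "\<eta> z \<in> carrier (H z)" for z
      by (simp_all add: A g0 gz)
    have "c \<odot>\<^bsub>H0\<^esub> x = \<pi>0 (sscale c A) \<Omega>0" "(\<lambda>z. c \<odot>\<^bsub>H z\<^esub> \<eta> z) = ?v (sscale c A)" for c
      by (simp_all add: A g0 gz)
    then show "(c \<odot>\<^bsub>H0\<^esub> x, \<lambda>z. c \<odot>\<^bsub>H z\<^esub> \<eta> z) \<in> G" for c
      using scaling_algebra_sscale[OF A(3)] by (auto simp: G_def)
    \<comment> \<open>On this element the states give squared norms, and the real part of the
      integral decomposition becomes the norm identity required of the graph.\<close>
    have "sprod (sadj A) A \<in> X"
      by (intro scaling_algebra_sprod scaling_algebra_sadj A)
    from has_bochner_integral_bounded_linear[OF bounded_linear_Re assms(9)[OF this]]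
    have "has_bochner_integral \<nu> (\<lambda>z. (hnorm (H z) (\<eta> z))\<^sup>2) ((hnorm H0 x)\<^sup>2)"
      unfolding gns_inner[OF assms(4) A(3), symmetric] gns_inner[OF assms(11) A(3), symmetric] A
      by (simp del: of_real_power)
    then show "has_bochner_integral (completion \<nu>) (\<lambda>z. (hnorm (H z) (\<eta> z))\<^sup>2) ((hnorm H0 x)\<^sup>2)"
      by (rule has_bochner_integral_completion)
    fix f :: "'z \<Rightarrow> complex" assume "continuous_on UNIV f"
    then have "f \<in> (\<lambda>C z. w z C) ` scaling_center \<AA> U"
      unfolding assms(10) by simp
    then obtain C where C: "C \<in> scaling_center \<AA> U" "f = (\<lambda>z. w z C)"
      by blast
    then have CX: "C \<in> X"
      by (simp add: scaling_center_def)
    note D = scaling_algebra_vacuum_map[OF CX]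
    \<comment> \<open>The scalar function is placed on the right so that it meets the cyclic vector
      first; its eigenvalue \<open>f z\<close> then passes through the linear map
      \<open>\<pi> z A\<close>.\<close>
    have "(\<lambda>z. f z \<odot>\<^bsub>H z\<^esub> \<eta> z) = ?v (sprod A (vacuum_map \<Omega> C))"
      by (simp add: A C(2) gz(2,4,7) D scalar[OF CX])
    then show "\<exists>y. (y, \<lambda>z. f z \<odot>\<^bsub>H z\<^esub> \<eta> z) \<in> G"
      using scaling_algebra_sprod[OF A(3) D] by (auto simp: G_def)
  next
    fix x and e :: real assume "x \<in> carrier H0" "e > 0"
    from g0(11)[OF this] show "\<exists>(y, \<eta>)\<in>G. hnorm H0 (x \<ominus>\<^bsub>H0\<^esub> y) < e"
      unfolding G_def by blast
  qed
  have "{\<eta>. rel (\<pi>0 A \<Omega>0) \<eta>} = di_class \<nu> H \<Gamma> (?v A)" if "A \<in> X" for A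
    unfolding \<Gamma> by (rule di_class_eq[symmetric], rule rel_G) (use that in \<open>auto simp: G_def\<close>)
  then show ?thesis
    using fundamental_family_graph direct_integral_iso unfolding \<Gamma>
    by (intro conjI exI[of _ "\<lambda>x. {\<eta>. rel x \<eta>}"]) simp_all
qed

end
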